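(* Let $d\ge 2$ and let $K\in\mathcal{K}^3_+$ be a convex body in $\mathbb{R}^d$. There exist $\varrho>0$ and $C>0$ such that, for any finite point set $P\subset\partial K$ with $\varrho(P)\le\varrho$, $$\Big|\delta_H(\operatorname{conv}(P),K)-\frac{\varrho(P)^2}{2}\Big|\le C\varrho(P)^3,$$ where $\varrho(P)$ is the geodesic covering radius of $P$ with respect to the metric on $\partial K$ induced by the second fundamental form.
   Context: A convex body in $\mathbb{R}^d$ is a compact convex set with nonempty interior. $\mathcal{K}^3_+$ is the set of convex bodies $K\subset\mathbb{R}^d$ whose boundary $\partial K$ is three times continuously differentiable and has everywhere positive Gaussian curvature. Riemannian structure on $\partial K$: for $p\in\partial K$ let $H_K(p)$ be the unique supporting hyperplane of $K$ at $p$, identified with $\mathbb{R}^{d-1}$ with $p$ as origin, and let $\operatorname{proj}_p$ be the orthogonal projection onto $H_K(p)$. A neighborhood $U$ of $p$ in $\partial K$ that $\operatorname{proj}_p$ maps homeomorphically onto a ball around the origin is the graph $\{(u,f(u))\}$ of a convex $C^3$ function $f=f^{(p)}\ge 0$, where $f(u)$ is the distance from $u$ to its preimage in $U$. With partial derivatives $f_k,f_{ij}$, the second fundamental form is $$q_u(s)=\sum_{i,j}\frac{f_{ij}(u)}{\sqrt{1+\sum_k f_k(u)^2}}s_is_j,\quad s\in\mathbb{R}^{d-1},$$ which is positive definite. The length of a continuously differentiable curve $k:[0,1]\to U$ is $\ell(k)=\int_0^1\sqrt{q_{u(\tau)}(u'(\tau))}\,\mathrm{d}\tau$ with $u=\operatorname{proj}_p(k)$;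 the length of a general continuously differentiable curve in $\partial K$ is obtained by dissecting it into pieces lying in such neighborhoods and adding (it does not depend on the charts chosen). The geodesic distance $\gamma(x,y)$ of $x,y\in\partial K$ is the infimum of the lengths of continuously differentiable curves in $\partial K$ connecting $x$ and $y$, and $B_\gamma(x,r)=\{y\in\partial K:\gamma(x,y)\le r\}$. For a finite $P\subset\partial K$, the geodesic covering radius is $\varrho(P)=\inf\{\varrho>0:\partial K\subset\bigcup_{x\in P}B_\gamma(x,\varrho)\}$. The Hausdorff distance is $\delta_H(\operatorname{conv}(P),K)=\max_{x\in\partial K}\min_{y\in\operatorname{conv}(P)}\|x-y\|$, with $\|\cdot\|$ the Euclidean norm. *)

theory Defs
  imports "HOL-Analysis.Analysis" "Jordan_Normal_Form.Determinant"
begin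

no_notation Matrix.scalar_prod (infix \<open>\<bullet>\<close> 70)

definition outer_unit_normal :: "'a::euclidean_space set \<Rightarrow> 'a \<Rightarrow> 'a \<Rightarrow> bool" where
  "outer_unit_normal K p \<nu> \<longleftrightarrow> norm \<nu> = 1 \<and> (\<forall>y\<in>K. \<nu> \<bullet> y \<le> \<nu> \<bullet> p)"

text \<open>The supporting hyperplane of \<open>K\<close> at \<open>p\<close> with normal \<open>\<nu>\<close>, with \<open>p\<close> as origin, is the linear
  subspace of all \<open>u\<close> with \<open>\<nu> \<bullet> u = 0\<close>. An orthonormal basis \<open>e 0, \<dots>, e (DIM('a) - 2)\<close> of it
  fixes the identification with the coordinate space of dimension \<open>DIM('a) - 1\<close>.\<close>

definition hyperplane_basis :: "'a::euclidean_space \<Rightarrow> (nat \<Rightarrow> 'a) \<Rightarrow> bool" where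
  "hyperplane_basis \<nu> e \<longleftrightarrow>
     (\<forall>i<DIM('a) - 1. \<nu> \<bullet> e i = 0) \<and>
     (\<forall>i<DIM('a) - 1. \<forall>j<DIM('a) - 1. e i \<bullet> e j = (if i = j then 1 else 0))"

definition hyperplane_ball :: "'a::euclidean_space \<Rightarrow> real \<Rightarrow> 'a set" where
  "hyperplane_ball \<nu> r = {u. \<nu> \<bullet> u = 0 \<and> norm u < r}"

definition hyperplane_proj :: "'a::euclidean_space \<Rightarrow> 'a \<Rightarrow> 'a \<Rightarrow> 'a" where
  "hyperplane_proj p \<nu> x = (x - p) - (\<nu> \<bullet> (x - p)) *\<^sub>R \<nu>"

definition partial :: "'a::euclidean_space \<Rightarrow> ('a \<Rightarrow> real) \<Rightarrow> 'a \<Rightarrow> real" where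
  "partial b f u = deriv (\<lambda>t. f (u + t *\<^sub>R b)) 0"

text \<open>Continuity of all partial derivatives up to order \<open>k\<close> along the directions \<open>e i\<close>, \<open>i < m\<close>,
  on a set \<open>D\<close> that is relatively open in the span of these directions.\<close>

fun Ck_on :: "nat \<Rightarrow> nat \<Rightarrow> (nat \<Rightarrow> 'a::euclidean_space) \<Rightarrow> 'a set \<Rightarrow> ('a \<Rightarrow> real) \<Rightarrow> bool" where
  "Ck_on 0 m e D f \<longleftrightarrow> continuous_on D f"
| "Ck_on (Suc k) m e D f \<longleftrightarrow> continuous_on D f \<and>
     (\<forall>i<m. (\<forall>u\<in>D. (\<lambda>t. f (u + t *\<^sub>R e i)) differentiable at 0) \<and>
            Ck_on k m e D (partial (e i) f))"

definition graph_fun :: "'a::euclidean_space \<Rightarrow> 'a \<Rightarrow> 'a set \<Rightarrow> 'a \<Rightarrow> real" where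
  "graph_fun p \<nu> U u = dist (p + u) (inv_into U (hyperplane_proj p \<nu>) u)"

definition graph_chart ::
  "'a::euclidean_space set \<Rightarrow> 'a \<Rightarrow> 'a \<Rightarrow> (nat \<Rightarrow> 'a) \<Rightarrow> 'a set \<Rightarrow> bool" where
  "graph_chart K p \<nu> e U \<longleftrightarrow>
     outer_unit_normal K p \<nu> \<and> hyperplane_basis \<nu> e \<and>
     openin (top_of_set (frontier K)) U \<and> p \<in> U \<and>
     (\<exists>r>0. (\<exists>g. homeomorphism U (hyperplane_ball \<nu> r) (hyperplane_proj p \<nu>) g) \<and>
            Ck_on 3 (DIM('a) - 1) e (hyperplane_ball \<nu> r) (graph_fun p \<nu> U))"

definition second_form :: "(nat \<Rightarrow> 'a::euclidean_space) \<Rightarrow> ('a \<Rightarrow> real) \<Rightarrow> 'a \<Rightarrow> 'a \<Rightarrow> real" where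
  "second_form e f u s =
     (\<Sum>i<DIM('a) - 1. \<Sum>j<DIM('a) - 1.
        partial (e j) (partial (e i) f) u / sqrt (1 + (\<Sum>k<DIM('a) - 1. (partial (e k) f u)\<^sup>2))
        * (s \<bullet> e i) * (s \<bullet> e j))"

text \<open>Gaussian curvature at the base point of a chart. The gradient of \<open>f\<close> vanishes there, so the
  first fundamental form is the identity and the normalising square root is 1.\<close>

definition gauss_curvature :: "(nat \<Rightarrow> 'a::euclidean_space) \<Rightarrow> ('a \<Rightarrow> real) \<Rightarrow> real" where
  "gauss_curvature e f =
     Determinant.det (Matrix.mat (DIM('a) - 1) (DIM('a) - 1)
       (\<lambda>(i, j). partial (e j) (partial (e i) f) 0))"

definition K3_plus :: "'a::euclidean_space set set" where
  "K3_plus = {K. compact K \<and> convex K \<and> interior K \<noteq> {} \<and>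
     (\<forall>p\<in>frontier K. \<exists>\<nu> e U. graph_chart K p \<nu> e U \<and> gauss_curvature e (graph_fun p \<nu> U) > 0)}"

definition piece_length :: "'a::euclidean_space set \<Rightarrow> (real \<Rightarrow> 'a) \<Rightarrow> real \<Rightarrow> real \<Rightarrow> real \<Rightarrow> bool" where
  "piece_length K k a b l \<longleftrightarrow>
     (\<exists>p \<nu> e U. graph_chart K p \<nu> e U \<and> k ` {a..b} \<subseteq> U \<and>
        l = integral {a..b} (\<lambda>\<tau>. sqrt (second_form e (graph_fun p \<nu> U) (hyperplane_proj p \<nu> (k \<tau>))
              (vector_derivative (\<lambda>\<sigma>. hyperplane_proj p \<nu> (k \<sigma>)) (at \<tau>)))))"

text \<open>A relation, since the length is computed from an arbitrary dissection and arbitrary charts;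
  for \<open>K \<in> K3_plus\<close> the value does not depend on them.\<close>

definition curve_length :: "'a::euclidean_space set \<Rightarrow> (real \<Rightarrow> 'a) \<Rightarrow> real \<Rightarrow> bool" where
  "curve_length K k L \<longleftrightarrow>
     (\<exists>(m::nat) t l. t 0 = 0 \<and> t m = 1 \<and>
        (\<forall>i<m. t i < t (Suc i) \<and> piece_length K k (t i) (t (Suc i)) (l i)) \<and>
        L = (\<Sum>i<m. l i))"

text \<open>\<open>C1_differentiable_on\<close> uses two-sided derivatives at 0 and 1. This is no restriction, since a
  curve that is continuously differentiable on \<open>{0..1}\<close> in the one-sided sense extends to the line;
  only its restriction to \<open>{0..1}\<close> has to lie in the boundary.\<close>

definition geodesic_dist :: "'a::euclidean_space set \<Rightarrow> 'a \<Rightarrow> 'a \<Rightarrow> real" where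
  "geodesic_dist K x y =
     Inf {L. \<exists>k. k C1_differentiable_on {0..1} \<and> path_image k \<subseteq> frontier K \<and>
                 pathstart k = x \<and> pathfinish k = y \<and> curve_length K k L}"

definition geodesic_ball :: "'a::euclidean_space set \<Rightarrow> 'a \<Rightarrow> real \<Rightarrow> 'a set" where
  "geodesic_ball K x r = {y \<in> frontier K. geodesic_dist K x y \<le> r}"

text \<open>Meaningful only for nonempty \<open>P\<close>: the real infimum of the empty set is unspecified.\<close>

definition covering_radius :: "'a::euclidean_space set \<Rightarrow> 'a set \<Rightarrow> real" where
  "covering_radius K P = Inf {\<rho>. \<rho> > 0 \<and> frontier K \<subseteq> (\<Union>x\<in>P. geodesic_ball K x \<rho>)}"

text \<open>The Hausdorff distance of a compact convex \<open>Q \<subseteq> K\<close> and \<open>K\<close>; supremum and infimum are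
  attained.\<close>

definition hausdorff_dist_inner :: "'a::euclidean_space set \<Rightarrow> 'a set \<Rightarrow> real" where
  "hausdorff_dist_inner Q K = (SUP x\<in>frontier K. INF y\<in>Q. norm (x - y))"

end

(* In a chart of the boundary as the graph of f over a tangent hyperplane, the height n . (x - z) of
   z below the tangent hyperplane at x is a Bregman divergence of f, and the squared speed of a curve
   is the second derivative of f in its direction, both divided by the norm of (nu + grad f). A
   Bregman divergence is half the second derivative up to third order, so nearby points satisfy
   height = gamma^2 / 2 + O(gamma^3), with constants made uniform by compactness.
   The upper bound of gamma is the length of a segment in a chart. The lower bound needs all curves:
   since the tangent hyperplane at x supports K, the height is nonnegative on a parabola through z in
   any tangent direction, and the discriminant of that quadratic bounds the derivative of the height
   along a curve by sqrt(2 height) times its speed, up to a factor 1 + O(sqrt(height)).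
   If x is not closer than r to any point of P, the hyperplane at x has distance at least about
   r^2 / 2 from P, hence from conv P. Conversely, separating x from its nearest point in conv P by
   a hyperplane and moving to the boundary point with that normal bounds the distance from above. *)

theory Submission
  imports Defs
begin

section \<open>Uniform constants on compact sets\<close>

text \<open>Two obstacles shape the proof. Lengths are defined through arbitrary charts and
  dissections, while every estimate lives in one chart; and the curvature hypothesis speaks only
  about base points of charts. One device handles both: the squared speed of a boundary curve is the
  limit of twice the height over the squared time, which mentions no chart. Uniqueness of limits
  then carries positivity and all bounds from a conveniently centred chart to whatever chart
  measures a piece of a curve. No shortest curve is shown to exist. Upper bounds of gamma come from
  one explicit competitor, lower bounds from a differential inequality integrated along every
  competitor. That inequality must hold globally, since a competitor may wander far from x; far away
  the height is bounded below by compactness. Infima of empty sets are unspecified, so any two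
  boundary points must be joined by an admissible curve that has a length. Here the dimension
  enters, through the connectedness of the boundary.\<close>

lemma compact_uniform_pairs:
  fixes S :: "'a::metric_space set"
  assumes "compact S"
    and mono: "\<And>C C' x z. x \<in> S \<Longrightarrow> z \<in> S \<Longrightarrow> E C x z \<Longrightarrow> C \<le> C' \<Longrightarrow> E C' x z"
    and loc: "\<And>p. p \<in> S \<Longrightarrow> \<exists>\<epsilon>>0. \<exists>C::real. \<forall>x\<in>S \<inter> ball p \<epsilon>. \<forall>z\<in>S \<inter> ball p \<epsilon>. E C x z"
  shows "\<exists>l>0. \<exists>C. \<forall>x\<in>S. \<forall>z\<in>S. dist x z < l \<longrightarrow> E C x z"
proof -
  obtain \<epsilon> c where \<epsilon>: "\<And>p. p \<in> S \<Longrightarrow> \<epsilon> p > 0"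
    and c: "\<And>p x z. p \<in> S \<Longrightarrow> x \<in> S \<inter> ball p (\<epsilon> p) \<Longrightarrow> z \<in> S \<inter> ball p (\<epsilon> p) \<Longrightarrow> E (c p) x z"
    using loc by metis
  have "S \<subseteq> (\<Union>p\<in>S. ball p (\<epsilon> p))"
    using \<epsilon> by force
  then obtain F where F: "F \<subseteq> S" "finite F" "S \<subseteq> (\<Union>p\<in>F. ball p (\<epsilon> p))"
    using compactE_image[OF \<open>compact S\<close>, of S "\<lambda>p. ball p (\<epsilon> p)"] by auto
  \<comment> \<open>A Lebesgue number of the finite cover puts any two points closer than
    \<open>l\<close> into one common ball, whose constant is at most the maximum.\<close>
  obtain l where l: "l > 0" "\<And>x. x \<in> S \<Longrightarrow> \<exists>G\<in>(\<lambda>p. ball p (\<epsilon> p)) ` F. ball x l \<subseteq> G"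
    using Heine_Borel_lemma[OF \<open>compact S\<close> F(3)] by blast
  have "E (Max (c ` F)) x z" if "x \<in> S" "z \<in> S" "dist x z < l" for x z
  proof -
    obtain p where p: "p \<in> F" "ball x l \<subseteq> ball p (\<epsilon> p)"
      using l(2)[OF \<open>x \<in> S\<close>] by blast
    have "x \<in> ball x l" "z \<in> ball x l" using l(1) that by auto
    then have "E (c p) x z" using c p F(1) that by blast
    then show ?thesis using mono that F(2) p(1) by simp
  qed
  then show ?thesis using l(1) by blast
qed

lemma compact_uniform:
  fixes S :: "'a::metric_space set"
  assumes "compact S"
    and "\<And>C C' x. E C x \<Longrightarrow> C \<le> C' \<Longrightarrow> E C' x"
    and "\<And>p. p \<in> S \<Longrightarrow> \<exists>\<epsilon>>0. \<exists>C::real. \<forall>x\<in>S \<inter> ball p \<epsilon>. E C x"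
  shows "\<exists>C. \<forall>x\<in>S. E C x"
proof -
  have "\<exists>l>0. \<exists>C. \<forall>x\<in>S. \<forall>z\<in>S. dist x z < l \<longrightarrow> E C x"
    using assms by (intro compact_uniform_pairs[where E = "\<lambda>C x z. E C x"]) (auto, metis)
  then show ?thesis by (metis dist_self)
qed

section \<open>Calculus in a hyperplane\<close>

text \<open>The mean value inequality applied to \<open>g t - c * t\<close>. The increment
  \<open>a\<close> may have either sign, hence \<open>closed_segment\<close>.\<close>

lemma mean_value_linear_bound:
  fixes g :: "real \<Rightarrow> real"
  assumes d: "\<And>t. t \<in> closed_segment 0 a \<Longrightarrow> (g has_real_derivative g' t) (at t)"
    and b: "\<And>t. t \<in> closed_segment 0 a \<Longrightarrow> \<bar>g' t - c\<bar> \<le> \<epsilon>"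
  shows "\<bar>g a - g 0 - c * a\<bar> \<le> \<epsilon> * \<bar>a\<bar>"
proof -
  have "norm ((g a - c * a) - (g 0 - c * 0)) \<le> \<epsilon> * norm (a - 0)"
  proof (rule field_differentiable_bound[where S = "closed_segment 0 a" and f' = "\<lambda>t. g' t - c"])
    show "((\<lambda>a. g a - c * a) has_field_derivative g' z - c) (at z within closed_segment 0 a)"
      if "z \<in> closed_segment 0 a" for z
      using d[OF that] by (auto intro!: derivative_eq_intros intro: has_field_derivative_at_within)
  qed (use b in auto)
  then show ?thesis by (simp add: algebra_simps)
qed

text \<open>Together with \<nu> the basis consists of \<open>DIM('a)\<close> nonzero, pairwise
  orthogonal vectors, so it spans the space; the remainder \<open>w\<close> is orthogonal to all of
  them.\<close>

lemma hyperplane_orthonormal_expansion: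
  fixes u :: "'a::euclidean_space"
  assumes nu: "norm \<nu> = 1" and e: "hyperplane_basis \<nu> e" and u: "\<nu> \<bullet> u = 0"
  shows "u = (\<Sum>i<DIM('a) - 1. (u \<bullet> e i) *\<^sub>R e i)"
proof -
  let ?m = "DIM('a) - 1"
  define w where "w = u - (\<Sum>i<?m. (u \<bullet> e i) *\<^sub>R e i)"
  have ne: "\<nu> \<bullet> e i = 0" if "i < ?m" for i using e that by (auto simp: hyperplane_basis_def)
  have ee: "e i \<bullet> e j = (if i = j then 1 else 0)" if "i < ?m" "j < ?m" for i j
    using e that by (auto simp: hyperplane_basis_def)
  let ?B = "insert \<nu> (e ` {..<?m})"
  have inj: "inj_on e {..<?m}"
  proof (rule inj_onI)
    fix i j assume "i \<in> {..<?m}" "j \<in> {..<?m}" "e i = e j"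
    then show "i = j" using ee[of i j] ee[of i i] by (auto split: if_splits)
  qed
  have notin: "\<nu> \<notin> e ` {..<?m}"
  proof
    assume "\<nu> \<in> e ` {..<?m}"
    then obtain i where "i < ?m" "\<nu> = e i" by auto
    then show False using ne[of i] ee[of i i] by auto
  qed
  have card: "card ?B = DIM('a)"
    using inj notin by (simp add: card_image)
  have "pairwise real_inner_class.orthogonal ?B"
    using ne ee by (auto simp: pairwise_def real_inner_class.orthogonal_def inner_commute)
  moreover have "0 \<notin> ?B"
    using nu ee by fastforce
  ultimately have "independent ?B" by (rule pairwise_orthogonal_independent)
  then have span: "span ?B = UNIV"
    using card by (metis card_eq_dim dim_UNIV finite_imageI finite_insert finite_lessThan subset_UNIV top.extremum_uniqueI)
  have "b \<bullet> w = 0" if "b \<in> ?B" for b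
  proof (cases "b = \<nu>")
    case True
    then show ?thesis using u ne by (simp add: w_def inner_diff_right inner_sum_right)
  next
    case False
    then obtain i where i: "i < ?m" "b = e i" using \<open>b \<in> ?B\<close> by auto
    have "(\<Sum>j<?m. (u \<bullet> e j) * (e i \<bullet> e j)) = (\<Sum>j<?m. if i = j then u \<bullet> e j else 0)"
      by (intro sum.cong) (use ee i in auto)
    also have "\<dots> = u \<bullet> e i" using i by simp
    finally show ?thesis using i by (simp add: w_def inner_diff_right inner_sum_right inner_commute)
  qed
  then have "w \<bullet> w = 0"
    using orthogonal_to_span[of w ?B w] span by (auto simp: real_inner_class.orthogonal_def inner_commute)
  then show ?thesis by (simp add: w_def)
qed

section \<open>Differentiability from continuous partial derivatives\<close>

locale hyperplane_frame =
  fixes \<nu> :: "'a::euclidean_space" and e :: "nat \<Rightarrow> 'a" and m :: nat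
  assumes norm_nu: "norm \<nu> = 1" and basis: "hyperplane_basis \<nu> e" and m_def: "m = DIM('a) - 1"
begin

lemma nu_nu: "\<nu> \<bullet> \<nu> = 1"
  using norm_nu by (simp add: dot_square_norm)

lemma nu_e: "i < m \<Longrightarrow> \<nu> \<bullet> e i = 0"
  using basis by (simp add: hyperplane_basis_def m_def)

lemma e_e: "i < m \<Longrightarrow> j < m \<Longrightarrow> e i \<bullet> e j = (if i = j then 1 else 0)"
  using basis by (simp add: hyperplane_basis_def m_def)

lemma norm_e: "i < m \<Longrightarrow> norm (e i) = 1"
  by (simp add: norm_eq_sqrt_inner e_e)

lemma expansion: "\<nu> \<bullet> u = 0 \<Longrightarrow> (\<Sum>i<m. (u \<bullet> e i) *\<^sub>R e i) = u"
  using hyperplane_orthonormal_expansion[OF norm_nu basis] unfolding m_def by metis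

lemma abs_coord_le: "i < m \<Longrightarrow> \<bar>u \<bullet> e i\<bar> \<le> norm u"
  using Cauchy_Schwarz_ineq2[of u "e i"] norm_e by simp

lemma sum_coord_e: "j < m \<Longrightarrow> (\<Sum>i<m. c i *\<^sub>R e i) \<bullet> e j = c j"
proof -
  assume j: "j < m"
  have "(\<Sum>i<m. c i *\<^sub>R e i) \<bullet> e j = (\<Sum>i<m. if j = i then c i else 0)"
    unfolding inner_sum_left by (intro sum.cong) (use j in \<open>auto simp: e_e\<close>)
  then show ?thesis using j by simp
qed

lemma nu_sum_coord: "\<nu> \<bullet> (\<Sum>i<m. c i *\<^sub>R e i) = 0"
  by (simp add: inner_sum_right nu_e)

lemma hyperplane_ball_shift:
  "u \<in> hyperplane_ball \<nu> r \<Longrightarrow> \<nu> \<bullet> h = 0 \<Longrightarrow> norm h < r - norm u \<Longrightarrow> u + h \<in> hyperplane_ball \<nu> r"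
  using norm_triangle_ineq[of u h] by (auto simp: hyperplane_ball_def inner_add_right)

text \<open>\<open>partial\<close> differentiates at parameter 0 of a line through a moving point; a
  shift of the parameter gives the derivative at \<open>t\<close> along one fixed line.\<close>

lemma partial_line:
  assumes "(\<lambda>s. f ((u + t *\<^sub>R e i) + s *\<^sub>R e i)) differentiable at (0::real)"
  shows "((\<lambda>s. f (u + s *\<^sub>R e i)) has_real_derivative partial (e i) f (u + t *\<^sub>R e i)) (at t)"
proof -
  have "((\<lambda>s. f ((u + t *\<^sub>R e i) + s *\<^sub>R e i)) has_real_derivative partial (e i) f (u + t *\<^sub>R e i)) (at 0)"
    using assms DERIV_deriv_iff_real_differentiable by (fastforce simp: partial_def)
  moreover have "(\<lambda>s. f ((u + t *\<^sub>R e i) + s *\<^sub>R e i)) = (\<lambda>s. f (u + (s + t) *\<^sub>R e i))"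
    by (simp add: algebra_simps)
  ultimately show ?thesis
    using DERIV_at_within_shift[of "\<lambda>s. f (u + s *\<^sub>R e i)" _ t 0 UNIV] by (simp add: add.commute)
qed

definition C1 :: "real \<Rightarrow> ('a \<Rightarrow> real) \<Rightarrow> bool" where
  "C1 r f \<longleftrightarrow> (\<forall>i<m. (\<forall>u\<in>hyperplane_ball \<nu> r. (\<lambda>t. f (u + t *\<^sub>R e i)) differentiable at 0) \<and>
     continuous_on (hyperplane_ball \<nu> r) (partial (e i) f))"

definition grad :: "('a \<Rightarrow> real) \<Rightarrow> 'a \<Rightarrow> 'a" where
  "grad f u = (\<Sum>i<m. partial (e i) f u *\<^sub>R e i)"

lemma nu_grad: "\<nu> \<bullet> grad f u = 0"
  by (simp add: grad_def nu_sum_coord)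

lemma grad_inner: "grad f u \<bullet> h = (\<Sum>i<m. (h \<bullet> e i) * partial (e i) f u)"
  unfolding grad_def inner_sum_left by (intro sum.cong) (simp_all add: inner_commute)

lemma grad_e: "i < m \<Longrightarrow> grad f u \<bullet> e i = partial (e i) f u"
  by (simp add: grad_def sum_coord_e)

text \<open>Continuous partial derivatives give a total derivative. It is taken within the ball,
  since the ball lies in a hyperplane and is not a neighbourhood of its points in the whole
  space.\<close>

lemma C1_has_derivative:
  assumes f: "C1 r f" and u: "u \<in> hyperplane_ball \<nu> r"
  shows "(f has_derivative (\<lambda>h. grad f u \<bullet> h)) (at u within hyperplane_ball \<nu> r)"
  unfolding has_derivative_within_alt
proof (intro conjI allI impI)
  show "bounded_linear ((\<bullet>) (grad f u))" by (rule bounded_linear_inner_right)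
  fix \<epsilon> :: real assume \<epsilon>: "\<epsilon> > 0"
  let ?B = "hyperplane_ball \<nu> r"
  let ?M = "real (Suc m)"
  have r: "r - norm u > 0" using u by (simp add: hyperplane_ball_def)
  have "\<exists>d>0. \<forall>v\<in>?B. dist v u < d \<longrightarrow> \<bar>partial (e i) f v - partial (e i) f u\<bar> < \<epsilon> / ?M" if "i < m" for i
  proof -
    have "continuous_on ?B (partial (e i) f)" using f that by (simp add: C1_def)
    moreover have "\<epsilon> / ?M > 0" using \<epsilon> by simp
    ultimately show ?thesis using u unfolding continuous_on_iff by (metis dist_real_def)
  qed
  then obtain d where d: "\<And>i. i < m \<Longrightarrow> d i > 0"
    and dd: "\<And>i v. i < m \<Longrightarrow> v \<in> ?B \<Longrightarrow> dist v u < d i \<Longrightarrow> \<bar>partial (e i) f v - partial (e i) f u\<bar> < \<epsilon> / ?M"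
    by metis
  define \<delta> where "\<delta> = Min (insert (r - norm u) (d ` {..<m}))"
  have \<delta>0: "\<delta> > 0" unfolding \<delta>_def using r d by (subst Min_gr_iff) auto
  have \<delta>r: "\<delta> \<le> r - norm u" unfolding \<delta>_def by (intro Min_le) auto
  have \<delta>d: "\<delta> \<le> d i" if "i < m" for i unfolding \<delta>_def using that by (intro Min_le) auto
  show "\<exists>d>0. \<forall>y\<in>?B. norm (y - u) < d \<longrightarrow> norm (f y - f u - grad f u \<bullet> (y - u)) \<le> \<epsilon> * norm (y - u)"
  proof (intro exI[of _ "\<delta> / ?M"] conjI ballI impI)
    show "\<delta> / ?M > 0" using \<delta>0 by simp
    fix y assume y: "y \<in> ?B" and yd: "norm (y - u) < \<delta> / ?M"
    define h where "h = y - u"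
    have hn: "\<nu> \<bullet> h = 0" using y u by (simp add: h_def hyperplane_ball_def inner_diff_right)
    \<comment> \<open>The path goes from \<open>u\<close> to \<open>y\<close> one coordinate
      direction at a time. Its points have distance at most \<open>?M * norm h\<close> from
      \<open>u\<close>, which is why the radius is \<open>\<delta> / ?M\<close>.\<close>
    define P where "P k = (\<Sum>i<k. (h \<bullet> e i) *\<^sub>R e i)" for k
    have Pm: "P m = h" using expansion[OF hn] by (simp add: P_def)
    have pt: "u + P k + t *\<^sub>R e k \<in> ?B \<and> dist (u + P k + t *\<^sub>R e k) u < \<delta>"
      if k: "k < m" and t: "\<bar>t\<bar> \<le> \<bar>h \<bullet> e k\<bar>" for k t
    proof -
      have "norm (P k) \<le> (\<Sum>i<k. norm h)"
        unfolding P_def by (rule sum_norm_le) (use k in \<open>auto simp: norm_e intro!: abs_coord_le\<close>)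
      moreover have "\<bar>t\<bar> \<le> norm h" using t abs_coord_le[OF k, of h] by linarith
      ultimately have "norm (P k + t *\<^sub>R e k) \<le> real k * norm h + norm h"
        using norm_triangle_ineq[of "P k" "t *\<^sub>R e k"] k by (simp add: norm_e)
      also have "\<dots> \<le> ?M * norm h"
        using k mult_right_mono[of "real k + 1" ?M "norm h"] by (simp add: algebra_simps)
      also have "\<dots> < \<delta>" using yd by (simp add: h_def field_simps)
      finally have n: "norm (P k + t *\<^sub>R e k) < \<delta>" .
      have "\<nu> \<bullet> (P k + t *\<^sub>R e k) = 0"
        using k by (simp add: P_def inner_add_right inner_sum_right nu_e)
      then have "u + (P k + t *\<^sub>R e k) \<in> ?B"
        using hyperplane_ball_shift[OF u] n \<delta>r by simp
      then show ?thesis using n by (simp add: dist_norm add.assoc)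
    qed
    have step: "\<bar>f (u + P (Suc k)) - f (u + P k) - (h \<bullet> e k) * partial (e k) f u\<bar> \<le> \<epsilon> / ?M * norm h"
      if k: "k < m" for k
    proof -
      have seg: "\<bar>t\<bar> \<le> \<bar>h \<bullet> e k\<bar>" if "t \<in> closed_segment 0 (h \<bullet> e k)" for t
        using that by (auto simp: closed_segment_eq_real_ivl split: if_splits)
      have "\<bar>f (u + P k + (h \<bullet> e k) *\<^sub>R e k) - f (u + P k + 0 *\<^sub>R e k) - partial (e k) f u * (h \<bullet> e k)\<bar>
          \<le> \<epsilon> / ?M * \<bar>h \<bullet> e k\<bar>"
      proof (rule mean_value_linear_bound[where g' = "\<lambda>t. partial (e k) f (u + P k + t *\<^sub>R e k)"])
        fix t assume t: "t \<in> closed_segment 0 (h \<bullet> e k)"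
        have B: "u + P k + t *\<^sub>R e k \<in> ?B" "dist (u + P k + t *\<^sub>R e k) u < d k"
          using pt[OF k seg[OF t]] \<delta>d[OF k] by auto
        show "((\<lambda>s. f (u + P k + s *\<^sub>R e k)) has_real_derivative partial (e k) f (u + P k + t *\<^sub>R e k)) (at t)"
          using f k B(1) by (intro partial_line) (auto simp: C1_def)
        show "\<bar>partial (e k) f (u + P k + t *\<^sub>R e k) - partial (e k) f u\<bar> \<le> \<epsilon> / ?M"
          using dd[OF k B] by simp
      qed
      also have "\<dots> \<le> \<epsilon> / ?M * norm h"
        using abs_coord_le[OF k, of h] \<epsilon> by (intro mult_left_mono) auto
      finally show ?thesis by (simp add: P_def add.assoc mult.commute)
    qed
    have tele: "f (u + P k) - f u - (\<Sum>i<k. (h \<bullet> e i) * partial (e i) f u)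
       = (\<Sum>i<k. f (u + P (Suc i)) - f (u + P i) - (h \<bullet> e i) * partial (e i) f u)" for k
      by (induction k) (auto simp: P_def)
    have "\<bar>f (u + P m) - f u - (\<Sum>i<m. (h \<bullet> e i) * partial (e i) f u)\<bar> \<le> (\<Sum>i<m. \<epsilon> / ?M * norm h)"
      unfolding tele by (rule order_trans[OF sum_abs]) (intro sum_mono step, simp)
    also have "\<dots> = (real m / ?M) * (\<epsilon> * norm h)" by simp
    also have "\<dots> \<le> 1 * (\<epsilon> * norm h)" using \<epsilon> by (intro mult_right_mono) auto
    finally have "\<bar>f (u + P m) - f u - (\<Sum>i<m. (h \<bullet> e i) * partial (e i) f u)\<bar> \<le> 1 * (\<epsilon> * norm h)" .
    moreover have "u + h = y" by (simp add: h_def)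
    ultimately show "norm (f y - f u - grad f u \<bullet> (y - u)) \<le> \<epsilon> * norm (y - u)"
      unfolding Pm by (simp add: grad_inner flip: h_def)
  qed
qed

lemma eventually_line_in_ball:
  assumes "u + t *\<^sub>R d \<in> hyperplane_ball \<nu> r" "\<nu> \<bullet> d = 0"
  shows "\<forall>\<^sub>F s in nhds t. u + s *\<^sub>R d \<in> hyperplane_ball \<nu> r"
proof -
  have "((\<lambda>s. norm (u + s *\<^sub>R d)) \<longlongrightarrow> norm (u + t *\<^sub>R d)) (nhds t)"
    by (intro tendsto_intros filterlim_ident)
  then have "\<forall>\<^sub>F s in nhds t. norm (u + s *\<^sub>R d) < r"
    using assms by (intro order_tendstoD) (auto simp: hyperplane_ball_def)
  then show ?thesis
    by eventually_elim (use assms in \<open>auto simp: hyperplane_ball_def inner_add_right\<close>)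
qed

text \<open>A line in the hyperplane stays in the ball for all parameters near \<open>t\<close>, so
  along it the derivative within the ball becomes an ordinary one.\<close>

lemma C1_has_derivative_line:
  assumes f: "C1 r f" and u: "u + t *\<^sub>R d \<in> hyperplane_ball \<nu> r" and d: "\<nu> \<bullet> d = 0"
  shows "((\<lambda>s. f (u + s *\<^sub>R d)) has_real_derivative grad f (u + t *\<^sub>R d) \<bullet> d) (at t)"
proof -
  define S where "S = {s. u + s *\<^sub>R d \<in> hyperplane_ball \<nu> r}"
  have "t \<in> S" using u by (simp add: S_def)
  have "(f has_derivative (\<lambda>h. grad f (u + t *\<^sub>R d) \<bullet> h)) (at (u + t *\<^sub>R d) within (\<lambda>s. u + s *\<^sub>R d) ` S)"
    by (rule has_derivative_subset[OF C1_has_derivative[OF f u]]) (auto simp: S_def)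
  moreover have "((\<lambda>s. u + s *\<^sub>R d) has_derivative (\<lambda>s. s *\<^sub>R d)) (at t within S)"
    by (auto intro!: derivative_eq_intros)
  ultimately have hd: "((\<lambda>s. f (u + s *\<^sub>R d)) has_derivative (\<lambda>s. grad f (u + t *\<^sub>R d) \<bullet> (s *\<^sub>R d))) (at t within S)"
    by (rule has_derivative_in_compose[rotated])
  have at: "at t within S = at t"
    using eventually_line_in_ball[OF u d]
    by (intro at_within_interior) (auto simp: eventually_nhds interior_def S_def)
  have "(\<lambda>s. grad f (u + t *\<^sub>R d) \<bullet> (s *\<^sub>R d)) = (*) (grad f (u + t *\<^sub>R d) \<bullet> d)"
    by (auto simp: fun_eq_iff)
  from hd[unfolded this at] show ?thesis
    unfolding has_field_derivative_def .
qed

text \<open>The second difference is the increment, along \<open>e i\<close>, of the difference of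
  \<open>f\<close> on two parallel lines shifted by \<open>s *\<^sub>R e j\<close>; the mean value
  inequality reduces it to the differentiability of the first partial derivative at
  \<open>u\<close>. Since the second difference is symmetric in \<open>i\<close> and
  \<open>j\<close>, using this twice makes the mixed derivatives equal.\<close>

lemma mixed_partial_bound:
  assumes f: "C1 r f" and fi: "C1 r (partial (e i) f)" and u: "u \<in> hyperplane_ball \<nu> r"
    and i: "i < m" and j: "j < m" and \<epsilon>: "\<epsilon> > 0"
  shows "\<exists>\<delta>>0. \<forall>s. 0 < s \<and> s < \<delta> \<longrightarrow>
    \<bar>f (u + s *\<^sub>R e i + s *\<^sub>R e j) - f (u + s *\<^sub>R e i) - f (u + s *\<^sub>R e j) + f u
      - s^2 * partial (e j) (partial (e i) f) u\<bar> \<le> \<epsilon> * s^2"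
proof -
  let ?B = "hyperplane_ball \<nu> r" and ?g = "partial (e i) f"
  have r: "r - norm u > 0" using u by (simp add: hyperplane_ball_def)
  have "\<epsilon> / 3 > 0" using \<epsilon> by simp
  \<comment> \<open>Error \<epsilon> / 3 per unit of length: the two points compared below lie at
    distance at most \<open>2 * s\<close> and \<open>s\<close> from \<open>u\<close>, which adds up
    to \<open>\<epsilon> * s\<close>.\<close>
  then obtain d where d: "d > 0" and dd: "\<And>y. y \<in> ?B \<Longrightarrow> norm (y - u) < d \<Longrightarrow>
      \<bar>?g y - ?g u - grad ?g u \<bullet> (y - u)\<bar> \<le> \<epsilon> / 3 * norm (y - u)"
    using C1_has_derivative[OF fi u] unfolding has_derivative_within_alt by (metis real_norm_def)
  define \<delta> where "\<delta> = min d (r - norm u) / 2"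
  have \<delta>: "\<delta> > 0" "2 * \<delta> \<le> d" "2 * \<delta> \<le> r - norm u" using d r by (auto simp: \<delta>_def)
  have "\<bar>f (u + s *\<^sub>R e i + s *\<^sub>R e j) - f (u + s *\<^sub>R e i) - f (u + s *\<^sub>R e j) + f u
      - s^2 * partial (e j) ?g u\<bar> \<le> \<epsilon> * s^2" if s: "0 < s" "s < \<delta>" for s
  proof -
    have nij: "norm (a *\<^sub>R e i + b *\<^sub>R e j) \<le> \<bar>a\<bar> + \<bar>b\<bar>" for a b
      using norm_triangle_ineq[of "a *\<^sub>R e i" "b *\<^sub>R e j"] i j by (simp add: norm_e)
    have inB: "u + (a *\<^sub>R e i + b *\<^sub>R e j) \<in> ?B" if "0 \<le> a" "a \<le> s" "0 \<le> b" "b \<le> s" for a b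
      using that nij[of a b] s \<delta> i j by (intro hyperplane_ball_shift[OF u]) (auto simp: inner_add_right nu_e)
    have est: "\<bar>?g (u + (a *\<^sub>R e i + b *\<^sub>R e j)) - ?g u - (a * partial (e i) ?g u + b * partial (e j) ?g u)\<bar>
        \<le> \<epsilon> / 3 * (\<bar>a\<bar> + \<bar>b\<bar>)" if ab: "0 \<le> a" "a \<le> s" "0 \<le> b" "b \<le> s" for a b
    proof -
      have "norm (a *\<^sub>R e i + b *\<^sub>R e j) < d" using nij[of a b] that s \<delta> by auto
      then have "\<bar>?g (u + (a *\<^sub>R e i + b *\<^sub>R e j)) - ?g u - grad ?g u \<bullet> (a *\<^sub>R e i + b *\<^sub>R e j)\<bar>
        \<le> \<epsilon> / 3 * norm (a *\<^sub>R e i + b *\<^sub>R e j)"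
        using dd[OF inB[OF ab]] by simp
      also have "\<dots> \<le> \<epsilon> / 3 * (\<bar>a\<bar> + \<bar>b\<bar>)" using nij \<epsilon> by (intro mult_left_mono) auto
      finally show ?thesis using i j by (simp add: inner_add_right grad_e)
    qed
    define c where "c = s * partial (e j) ?g u"
    have "\<bar>(f (u + s *\<^sub>R e j + s *\<^sub>R e i) - f (u + s *\<^sub>R e i)) - (f (u + s *\<^sub>R e j + 0 *\<^sub>R e i) - f (u + 0 *\<^sub>R e i)) - c * s\<bar> \<le> \<epsilon> * s * \<bar>s\<bar>"
    proof (rule mean_value_linear_bound[where g' = "\<lambda>t. ?g (u + s *\<^sub>R e j + t *\<^sub>R e i) - ?g (u + t *\<^sub>R e i)"])
      fix t assume "t \<in> closed_segment 0 s"
      then have t: "0 \<le> t" "t \<le> s" using s by (auto simp: closed_segment_eq_real_ivl)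
      have B1: "u + s *\<^sub>R e j + t *\<^sub>R e i \<in> ?B" using inB[of t s] t s by (simp add: algebra_simps)
      have B2: "u + t *\<^sub>R e i \<in> ?B" using inB[of t 0] t s by simp
      show "((\<lambda>t. f (u + s *\<^sub>R e j + t *\<^sub>R e i) - f (u + t *\<^sub>R e i)) has_real_derivative
          ?g (u + s *\<^sub>R e j + t *\<^sub>R e i) - ?g (u + t *\<^sub>R e i)) (at t)"
        using f i B1 B2 by (intro DERIV_diff partial_line) (auto simp: C1_def)
      have "\<epsilon> * t \<le> \<epsilon> * s" using t \<epsilon> by (intro mult_left_mono) auto
      then have "\<epsilon> / 3 * (\<bar>t\<bar> + \<bar>s\<bar>) + \<epsilon> / 3 * \<bar>t\<bar> \<le> \<epsilon> * s"
        using t s by (simp add: algebra_simps add_divide_distrib)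
      moreover have "\<bar>?g (u + s *\<^sub>R e j + t *\<^sub>R e i) - ?g u - (t * partial (e i) ?g u + s * partial (e j) ?g u)\<bar>
          \<le> \<epsilon> / 3 * (\<bar>t\<bar> + \<bar>s\<bar>)"
        using est[of t s] t s by (simp add: ac_simps)
      moreover have "\<bar>?g (u + t *\<^sub>R e i) - ?g u - t * partial (e i) ?g u\<bar> \<le> \<epsilon> / 3 * \<bar>t\<bar>"
        using est[of t 0] t s by simp
      ultimately show "\<bar>?g (u + s *\<^sub>R e j + t *\<^sub>R e i) - ?g (u + t *\<^sub>R e i) - c\<bar> \<le> \<epsilon> * s"
        unfolding c_def by linarith
    qed
    then show ?thesis using s by (simp add: c_def power2_eq_square algebra_simps)
  qed
  then show ?thesis using \<delta>(1) by blast
qed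

lemma mixed_partials_commute:
  assumes f: "C1 r f" "C1 r (partial (e i) f)" "C1 r (partial (e j) f)"
    and u: "u \<in> hyperplane_ball \<nu> r" and ij: "i < m" "j < m"
  shows "partial (e j) (partial (e i) f) u = partial (e i) (partial (e j) f) u"
proof (rule ccontr)
  let ?a = "partial (e j) (partial (e i) f) u" and ?b = "partial (e i) (partial (e j) f) u"
  assume "?a \<noteq> ?b"
  \<comment> \<open>A third of the gap, because the two estimates together allow a gap of only 2
    \<epsilon>.\<close>
  define \<epsilon> where "\<epsilon> = \<bar>?a - ?b\<bar> / 3"
  have \<epsilon>: "\<epsilon> > 0" using \<open>?a \<noteq> ?b\<close> by (simp add: \<epsilon>_def)
  let ?D = "\<lambda>s. f (u + s *\<^sub>R e i + s *\<^sub>R e j) - f (u + s *\<^sub>R e i) - f (u + s *\<^sub>R e j) + f u"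
  obtain d1 where d1: "d1 > 0" "\<And>s. 0 < s \<Longrightarrow> s < d1 \<Longrightarrow> \<bar>?D s - s^2 * ?a\<bar> \<le> \<epsilon> * s^2"
    using mixed_partial_bound[OF f(1,2) u ij \<epsilon>] by blast
  obtain d2 where d2: "d2 > 0" "\<And>s. 0 < s \<Longrightarrow> s < d2 \<Longrightarrow> \<bar>?D s - s^2 * ?b\<bar> \<le> \<epsilon> * s^2"
    using mixed_partial_bound[OF f(1,3) u ij(2,1) \<epsilon>] by (auto simp: algebra_simps)
  define s where "s = min d1 d2 / 2"
  have s: "0 < s" "s < d1" "s < d2" using d1(1) d2(1) by (auto simp: s_def)
  have "\<bar>s^2 * ?a - s^2 * ?b\<bar> \<le> 2 * (\<epsilon> * s^2)" using d1(2)[of s] d2(2)[of s] s by linarith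
  moreover have "\<bar>s^2 * ?a - s^2 * ?b\<bar> = s^2 * \<bar>?a - ?b\<bar>"
    by (simp add: abs_mult right_diff_distrib[symmetric])
  ultimately have "s^2 * \<bar>?a - ?b\<bar> \<le> s^2 * (2 * \<epsilon>)" by (simp add: ac_simps)
  then have "\<bar>?a - ?b\<bar> \<le> 2 * \<epsilon>" using s by simp
  then show False using \<epsilon> by (simp add: \<epsilon>_def)
qed

section \<open>Lipschitz bounds on smaller closed balls\<close>

definition hcball :: "real \<Rightarrow> 'a set" where
  "hcball r = {u. \<nu> \<bullet> u = 0 \<and> norm u \<le> r}"

lemma hcball_eq: "hcball r = {u. \<nu> \<bullet> u = 0} \<inter> cball 0 r"
  by (auto simp: hcball_def)

lemma compact_hcball: "compact (hcball r)"
  unfolding hcball_eq by (intro closed_Int_compact closed_hyperplane compact_cball)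

lemma convex_hcball: "convex (hcball r)"
  unfolding hcball_eq by (intro convex_Int convex_hyperplane convex_cball)

lemma hcball_subset: "r' < r \<Longrightarrow> hcball r' \<subseteq> hyperplane_ball \<nu> r"
  by (auto simp: hcball_def hyperplane_ball_def)

text \<open>Near the rim of the open ball the gradient may be unbounded. The smaller closed ball is
  compact, and being convex it contains the segments that the mean value inequality needs.\<close>

lemma C1_lipschitz:
  assumes f: "C1 r f" and r: "r' < r"
  shows "\<exists>M\<ge>0. \<forall>u\<in>hcball r'. \<forall>v\<in>hcball r'. \<bar>f u - f v\<bar> \<le> M * norm (u - v)"
proof -
  have "continuous_on (hcball r') (grad f)"
    unfolding grad_def using f hcball_subset[OF r]
    by (intro continuous_intros) (auto simp: C1_def intro: continuous_on_subset)
  then have "bounded (grad f ` hcball r')"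
    using compact_continuous_image compact_hcball compact_imp_bounded by blast
  then obtain M where M: "M > 0" "\<And>u. u \<in> hcball r' \<Longrightarrow> norm (grad f u) \<le> M"
    unfolding bounded_pos by auto
  have "norm (f u - f v) \<le> M * norm (u - v)" if "u \<in> hcball r'" "v \<in> hcball r'" for u v
  proof (rule differentiable_bound[OF convex_hcball, where f' = "\<lambda>u h. grad f u \<bullet> h"])
    fix x assume x: "x \<in> hcball r'"
    show "(f has_derivative (\<bullet>) (grad f x)) (at x within hcball r')"
      using C1_has_derivative[OF f] x hcball_subset[OF r] by (blast intro: has_derivative_subset)
    have "onorm ((\<bullet>) (grad f x)) \<le> norm (grad f x)"
      by (rule onorm_le) (simp add: Cauchy_Schwarz_ineq2)
    then show "onorm ((\<bullet>) (grad f x)) \<le> M" using M(2)[OF x] by simp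
  qed (use that in auto)
  then show ?thesis using M(1) by (intro exI[of _ M]) auto
qed

end

text \<open>A zero \<open>c\<close> of a nonnegative form is a minimum, so the linear term at
  \<open>c\<close> vanishes in every direction. Hence \<open>c\<close> lies in the kernel of the
  matrix, which is trivial by the determinant.\<close>

lemma psd_form_definite:
  fixes A :: "nat \<Rightarrow> nat \<Rightarrow> real"
  assumes sym: "\<And>i j. i < m \<Longrightarrow> j < m \<Longrightarrow> A i j = A j i"
    and psd: "\<And>c. (\<Sum>i<m. \<Sum>j<m. A i j * c i * c j) \<ge> 0"
    and det: "Determinant.det (Matrix.mat m m (\<lambda>(i, j). A i j)) \<noteq> 0"
    and zero: "(\<Sum>i<m. \<Sum>j<m. A i j * c i * c j) = 0" and k: "k < m"
  shows "c k = 0"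
proof (rule ccontr)
  assume ck: "c k \<noteq> 0"
  let ?Q = "\<lambda>a b. \<Sum>i<m. \<Sum>j<m. A i j * a i * b j"
  have comm: "?Q a b = ?Q b a" for a b
    by (subst sum.swap) (intro sum.cong, auto simp: sym)
  have ker: "(\<Sum>j<m. A i j * c j) = 0" if i: "i < m" for i
  proof (rule ccontr)
    assume ne: "(\<Sum>j<m. A i j * c j) \<noteq> 0"
    define d where "d j = (if j = i then 1 else 0 :: real)" for j
    have dc: "?Q d c = (\<Sum>j<m. A i j * c j)"
    proof -
      have "?Q d c = (\<Sum>i'<m. if i' = i then \<Sum>j<m. A i j * c j else 0)"
        by (intro sum.cong) (auto simp: d_def)
      then show ?thesis using i by simp
    qed
    define b where "b = ?Q d c"
    define a where "a = ?Q d d"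
    have exp: "?Q (\<lambda>i. c i + t * d i) (\<lambda>i. c i + t * d i) = 2 * t * b + t^2 * a" for t
    proof -
      have "?Q (\<lambda>i. c i + t * d i) (\<lambda>i. c i + t * d i) = ?Q c c + t * ?Q c d + t * ?Q d c + t^2 * ?Q d d"
        by (simp add: sum_distrib_left sum.distrib[symmetric] algebra_simps power2_eq_square)
      then show ?thesis using zero comm[of c d] by (simp add: a_def b_def)
    qed
    have nn: "2 * t * b + t^2 * a \<ge> 0" for t
      using psd[of "\<lambda>i. c i + t * d i"] unfolding exp .
    have a0: "a \<ge> 0" using psd[of d] by (simp add: a_def)
    \<comment> \<open>The minimiser of the quadratic would be \<open>- b / a\<close>; adding 1
      avoids a division by zero, and the value stays negative for nonzero \<open>b\<close>.\<close>
    define t where "t = - b / (a + 1)"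
    have "2 * t * b + t^2 * a = - (b^2 * (a + 2)) / (a + 1)^2"
      using a0 by (simp add: t_def power2_eq_square divide_simps) (simp add: algebra_simps)
    moreover have "b^2 * (a + 2) / (a + 1)^2 > 0" using ne dc a0 by (simp add: b_def)
    ultimately show False using nn[of t] by simp
  qed
  let ?M = "Matrix.mat m m (\<lambda>(i, j). A i j)" and ?v = "Matrix.vec m c"
  have "?M *\<^sub>v ?v = 0\<^sub>v m"
    by (rule eq_vecI) (auto simp: Matrix.scalar_prod_def ker lessThan_atLeast0[symmetric])
  moreover have "?v \<noteq> 0\<^sub>v m"
    using ck k by (metis index_vec index_zero_vec(1))
  ultimately have "Determinant.det ?M = 0"
    using det_0_iff_vec_prod_zero[OF mat_carrier, of m "\<lambda>(i, j). A i j"] vec_carrier[of m c] by blast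
  then show False using det by simp
qed

section \<open>Hessian and Taylor expansion\<close>

context hyperplane_frame
begin

definition hess :: "('a \<Rightarrow> real) \<Rightarrow> 'a \<Rightarrow> 'a \<Rightarrow> real" where
  "hess f u s = (\<Sum>i<m. \<Sum>j<m. partial (e j) (partial (e i) f) u * (s \<bullet> e i) * (s \<bullet> e j))"

definition C2 :: "real \<Rightarrow> ('a \<Rightarrow> real) \<Rightarrow> bool" where
  "C2 r f \<longleftrightarrow> C1 r f \<and> (\<forall>i<m. C1 r (partial (e i) f))"

definition C3 :: "real \<Rightarrow> ('a \<Rightarrow> real) \<Rightarrow> bool" where
  "C3 r f \<longleftrightarrow> C1 r f \<and> (\<forall>i<m. C2 r (partial (e i) f))"

lemma C3_C2: "C3 r f \<Longrightarrow> C2 r f"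
  by (simp add: C3_def C2_def)

lemma hess_scaleR: "hess f u (c *\<^sub>R s) = c^2 * hess f u s"
  by (simp add: hess_def sum_distrib_left power2_eq_square algebra_simps)

lemma hess_sum_coord:
  "hess f u (\<Sum>i<m. a i *\<^sub>R e i) = (\<Sum>i<m. \<Sum>j<m. partial (e j) (partial (e i) f) u * a i * a j)"
  unfolding hess_def by (intro sum.cong refl) (simp add: sum_coord_e)

lemma norm_nu_grad: "norm (\<nu> + grad f u) = sqrt (1 + (\<Sum>k<m. (partial (e k) f u)^2))"
proof -
  have "grad f u \<bullet> grad f u = (\<Sum>k<m. (partial (e k) f u)^2)"
    by (subst grad_inner) (intro sum.cong, auto simp: grad_e power2_eq_square)
  then have "(\<nu> + grad f u) \<bullet> (\<nu> + grad f u) = 1 + (\<Sum>k<m. (partial (e k) f u)^2)"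
    by (simp add: inner_add_left inner_add_right nu_nu nu_grad inner_commute[of "grad f u" \<nu>])
  then show ?thesis by (simp add: norm_eq_sqrt_inner)
qed

lemma norm_nu_grad_ge: "1 \<le> norm (\<nu> + grad f u)"
  unfolding norm_nu_grad by (simp add: sum_nonneg)

lemma second_form_eq: "second_form e f u s = hess f u s / norm (\<nu> + grad f u)"
  unfolding second_form_def norm_nu_grad hess_def m_def[symmetric]
  by (simp add: sum_divide_distrib)

text \<open>The Lagrange form keeps the Hessian at an intermediate point \<open>w\<close>: a lower
  bound of the Hessian then bounds heights below without an error term, and its Lipschitz continuity
  gives the cubic error of \<open>taylor3\<close>.\<close>

lemma taylor2:
  assumes f: "C2 r f" and u: "u \<in> hcball r'" and v: "v \<in> hcball r'" and r': "r' < r"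
  obtains w where "w \<in> hcball r'" "norm (w - u) \<le> norm (v - u)"
    "f v = f u + grad f u \<bullet> (v - u) + hess f w (v - u) / 2"
proof -
  define d where "d = v - u"
  have d: "\<nu> \<bullet> d = 0" using u v by (simp add: d_def hcball_def inner_diff_right)
  have seg: "u + t *\<^sub>R d \<in> hcball r'" if "0 \<le> t" "t \<le> 1" for t
    using convexD_alt[OF convex_hcball u v that] by (simp add: d_def algebra_simps)
  define F :: "nat \<Rightarrow> real \<Rightarrow> real" where "F k t = (if k = 0 then f (u + t *\<^sub>R d)
     else if k = 1 then grad f (u + t *\<^sub>R d) \<bullet> d else hess f (u + t *\<^sub>R d) d)" for k t
  have "\<forall>k t. k < 2 \<and> 0 \<le> t \<and> t \<le> 1 \<longrightarrow> (F k has_real_derivative F (Suc k) t) (at t)"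
  proof (intro allI impI)
    fix k :: nat and t :: real assume *: "k < 2 \<and> 0 \<le> t \<and> t \<le> 1"
    have B: "u + t *\<^sub>R d \<in> hyperplane_ball \<nu> r" using seg * hcball_subset[OF r'] by blast
    have 0: "((\<lambda>t. f (u + t *\<^sub>R d)) has_real_derivative grad f (u + t *\<^sub>R d) \<bullet> d) (at t)"
      using f B d by (intro C1_has_derivative_line) (auto simp: C2_def)
    have "((\<lambda>t. \<Sum>i<m. (d \<bullet> e i) * partial (e i) f (u + t *\<^sub>R d)) has_real_derivative
         (\<Sum>i<m. (d \<bullet> e i) * (grad (partial (e i) f) (u + t *\<^sub>R d) \<bullet> d))) (at t)"
      using f B d by (intro DERIV_sum DERIV_cmult C1_has_derivative_line) (auto simp: C2_def)
    moreover have "(\<Sum>i<m. (d \<bullet> e i) * (grad (partial (e i) f) (u + t *\<^sub>R d) \<bullet> d)) = hess f (u + t *\<^sub>R d) d"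
      unfolding hess_def grad_inner by (simp add: sum_distrib_left ac_simps)
    ultimately have 1: "((\<lambda>t. grad f (u + t *\<^sub>R d) \<bullet> d) has_real_derivative hess f (u + t *\<^sub>R d) d) (at t)"
      unfolding grad_inner by simp
    have "k = 0 \<or> k = 1" using * by auto
    then show "(F k has_real_derivative F (Suc k) t) (at t)" using 0 1 by (auto simp: F_def[abs_def])
  qed
  then obtain t where t: "0 < t" "t \<le> 1"
      "f (u + 1 *\<^sub>R d) = (\<Sum>k<2. F k 0 / fact k * 1 ^ k) + F 2 t / fact 2 * 1 ^ 2"
    using Maclaurin2[of 1 F "\<lambda>t. f (u + t *\<^sub>R d)" 2] by (auto simp: F_def[abs_def])
  have "norm (t *\<^sub>R d) \<le> norm d" using t by (simp add: mult_left_le_one_le)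
  then show ?thesis
    using t by (intro that[of "u + t *\<^sub>R d"] seg) (auto simp: F_def numeral_2_eq_2 d_def)
qed

lemma abs_hess_le:
  assumes "\<And>i j. i < m \<Longrightarrow> j < m \<Longrightarrow> \<bar>A i j\<bar> \<le> M"
  shows "\<bar>\<Sum>i<m. \<Sum>j<m. A i j * (s \<bullet> e i) * (s \<bullet> e j)\<bar> \<le> (real m)^2 * M * (norm s)^2"
proof -
  have "\<bar>\<Sum>i<m. \<Sum>j<m. A i j * (s \<bullet> e i) * (s \<bullet> e j)\<bar> \<le> (\<Sum>i<m. \<Sum>j<m. M * (norm s)^2)"
  proof (rule order_trans[OF sum_abs], rule sum_mono, rule order_trans[OF sum_abs], rule sum_mono)
    fix i j assume ij: "i \<in> {..<m}" "j \<in> {..<m}"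
    then have "\<bar>A i j\<bar> * (\<bar>s \<bullet> e i\<bar> * \<bar>s \<bullet> e j\<bar>) \<le> M * (norm s * norm s)"
      using assms[of i j] by (intro mult_mono abs_coord_le) auto
    then show "\<bar>A i j * (s \<bullet> e i) * (s \<bullet> e j)\<bar> \<le> M * (norm s)^2"
      by (simp add: abs_mult power2_eq_square mult.assoc)
  qed
  then show ?thesis by (simp add: power2_eq_square)
qed

lemma uniform_lipschitz_family:
  assumes "finite I" and "\<And>i. i \<in> I \<Longrightarrow> C1 r (g i)" and "r' < r"
  shows "\<exists>M\<ge>0. \<forall>i\<in>I. \<forall>u\<in>hcball r'. \<forall>v\<in>hcball r'. \<bar>g i u - g i v\<bar> \<le> M * norm (u - v)"
proof -
  have "\<exists>M\<ge>0. \<forall>u\<in>hcball r'. \<forall>v\<in>hcball r'. \<bar>g i u - g i v\<bar> \<le> M * norm (u - v)" if "i \<in> I" for i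
    using C1_lipschitz assms(2)[OF that] assms(3) by blast
  then obtain M where M: "\<And>i. i \<in> I \<Longrightarrow> M i \<ge> 0"
    "\<And>i u v. i \<in> I \<Longrightarrow> u \<in> hcball r' \<Longrightarrow> v \<in> hcball r' \<Longrightarrow> \<bar>g i u - g i v\<bar> \<le> M i * norm (u - v)"
    by metis
  \<comment> \<open>The sum instead of the maximum also covers an empty family.\<close>
  have "M i \<le> sum M I" if "i \<in> I" for i using M(1) assms(1) that by (intro member_le_sum) auto
  then have "\<bar>g i u - g i v\<bar> \<le> sum M I * norm (u - v)" if "i \<in> I" "u \<in> hcball r'" "v \<in> hcball r'" for i u v
    using order_trans[OF M(2)[OF that]] that by (simp add: mult_right_mono)
  moreover have "sum M I \<ge> 0" using M(1) by (intro sum_nonneg) auto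
  ultimately show ?thesis by blast
qed

text \<open>Here the third derivatives enter: the second partial derivatives are themselves
  \<open>C1\<close>, hence Lipschitz on the smaller ball. This is the source of the cubic error in
  the theorem.\<close>

lemma hess_lipschitz:
  assumes f: "C3 r f" and r: "r' < r"
  shows "\<exists>M\<ge>0. \<forall>u\<in>hcball r'. \<forall>v\<in>hcball r'. \<forall>s. \<bar>hess f u s - hess f v s\<bar> \<le> M * norm (u - v) * (norm s)^2"
proof -
  have "\<exists>M\<ge>0. \<forall>ij\<in>{..<m} \<times> {..<m}. \<forall>u\<in>hcball r'. \<forall>v\<in>hcball r'.
      \<bar>(case ij of (i, j) \<Rightarrow> partial (e j) (partial (e i) f)) u - (case ij of (i, j) \<Rightarrow> partial (e j) (partial (e i) f)) v\<bar>
        \<le> M * norm (u - v)"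
    by (rule uniform_lipschitz_family[OF _ _ r]) (use f in \<open>auto simp: C3_def C2_def\<close>)
  then obtain M where M: "M \<ge> 0" "\<And>i j u v. i < m \<Longrightarrow> j < m \<Longrightarrow> u \<in> hcball r' \<Longrightarrow> v \<in> hcball r' \<Longrightarrow>
      \<bar>partial (e j) (partial (e i) f) u - partial (e j) (partial (e i) f) v\<bar> \<le> M * norm (u - v)"
    by fastforce
  have "\<bar>hess f u s - hess f v s\<bar> \<le> (real m)^2 * M * norm (u - v) * (norm s)^2"
    if uv: "u \<in> hcball r'" "v \<in> hcball r'" for u v s
  proof -
    have "hess f u s - hess f v s =
      (\<Sum>i<m. \<Sum>j<m. (partial (e j) (partial (e i) f) u - partial (e j) (partial (e i) f) v) * (s \<bullet> e i) * (s \<bullet> e j))"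
      by (simp add: hess_def sum_subtractf[symmetric] left_diff_distrib)
    then show ?thesis
      using abs_hess_le[of "\<lambda>i j. partial (e j) (partial (e i) f) u - partial (e j) (partial (e i) f) v" "M * norm (u - v)" s] M(2) uv
      by (simp add: mult.assoc)
  qed
  then show ?thesis using M(1) by (intro exI[of _ "(real m)^2 * M"]) auto
qed

lemma taylor3:
  assumes f: "C3 r f" and r: "r' < r"
  shows "\<exists>M\<ge>0. \<forall>u\<in>hcball r'. \<forall>v\<in>hcball r'.
    \<bar>f v - f u - grad f u \<bullet> (v - u) - hess f u (v - u) / 2\<bar> \<le> M * norm (v - u) ^ 3"
proof -
  obtain M where M: "M \<ge> 0" "\<And>u v s. u \<in> hcball r' \<Longrightarrow> v \<in> hcball r' \<Longrightarrow>
      \<bar>hess f u s - hess f v s\<bar> \<le> M * norm (u - v) * (norm s)^2"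
    using hess_lipschitz[OF f r] by blast
  have "\<bar>f v - f u - grad f u \<bullet> (v - u) - hess f u (v - u) / 2\<bar> \<le> M * norm (v - u) ^ 3"
    if uv: "u \<in> hcball r'" "v \<in> hcball r'" for u v
  proof -
    obtain w where w: "w \<in> hcball r'" "norm (w - u) \<le> norm (v - u)"
      "f v = f u + grad f u \<bullet> (v - u) + hess f w (v - u) / 2"
      using taylor2[OF C3_C2[OF f] uv r] by blast
    have "\<bar>hess f w (v - u) - hess f u (v - u)\<bar> \<le> M * norm (w - u) * (norm (v - u))^2"
      using M(2) w(1) uv(1) by blast
    also have "\<dots> \<le> M * norm (v - u) * (norm (v - u))^2"
      using w(2) M(1) by (intro mult_right_mono mult_left_mono) auto
    finally have "\<bar>hess f w (v - u) - hess f u (v - u)\<bar> \<le> M * norm (v - u) ^ 3"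
      by (simp add: power2_eq_square power3_eq_cube mult.assoc)
    then show ?thesis using w(3) by auto
  qed
  then show ?thesis using M(1) by blast
qed

lemma grad_lipschitz:
  assumes f: "C2 r f" and r: "r' < r"
  shows "\<exists>M\<ge>0. \<forall>u\<in>hcball r'. \<forall>v\<in>hcball r'. norm (grad f u - grad f v) \<le> M * norm (u - v)"
proof -
  obtain M where M: "M \<ge> 0" "\<And>i u v. i < m \<Longrightarrow> u \<in> hcball r' \<Longrightarrow> v \<in> hcball r' \<Longrightarrow>
      \<bar>partial (e i) f u - partial (e i) f v\<bar> \<le> M * norm (u - v)"
    using uniform_lipschitz_family[of "{..<m}" r "\<lambda>i. partial (e i) f", OF _ _ r] f by (auto simp: C2_def)
  have "norm (grad f u - grad f v) \<le> real m * M * norm (u - v)" if "u \<in> hcball r'" "v \<in> hcball r'" for u v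
  proof -
    have "norm (grad f u - grad f v) \<le> (\<Sum>i<m. M * norm (u - v))"
      unfolding grad_def sum_subtractf[symmetric] scaleR_left_diff_distrib[symmetric]
      by (rule sum_norm_le) (use M(2) that in \<open>auto simp: norm_e\<close>)
    then show ?thesis by simp
  qed
  then show ?thesis using M(1) by (intro exI[of _ "real m * M"]) auto
qed

text \<open>Joint continuity in point and direction serves both the extrema over a compact set of
  unit directions and the integrability of speeds along a curve with varying direction.\<close>

lemma continuous_on_hess:
  assumes f: "C2 r f"
  shows "continuous_on (hyperplane_ball \<nu> r \<times> UNIV) (\<lambda>(u, s). hess f u s)"
proof -
  have "continuous_on (hyperplane_ball \<nu> r \<times> UNIV) (\<lambda>x::'a \<times> 'a. partial (e j) (partial (e i) f) (fst x))"
    if "i < m" "j < m" for i j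
    using f that
    by (intro continuous_on_compose2[OF _ continuous_on_fst[OF continuous_on_id], of "hyperplane_ball \<nu> r"])
      (auto simp: C2_def C1_def)
  then show ?thesis
    unfolding hess_def case_prod_beta by (intro continuous_intros) auto
qed

end

section \<open>Graph charts and the second fundamental form\<close>

text \<open>The squared speed, in the metric of the second fundamental form, of a curve through \<open>z\<close> with
  velocity \<open>v\<close>, read off from how fast the curve leaves the supporting hyperplane at \<open>z\<close>. This makes
  no reference to charts.\<close>

definition speed_sq :: "'a::euclidean_space set \<Rightarrow> 'a \<Rightarrow> 'a \<Rightarrow> real \<Rightarrow> bool" where
  "speed_sq K z v q \<longleftrightarrow> (\<exists>k S \<tau>. k \<tau> = z \<and> \<tau> \<in> S \<and> at \<tau> within S \<noteq> bot \<and> k ` S \<subseteq> frontier K \<and>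
     (k has_vector_derivative v) (at \<tau> within S) \<and>
     (\<forall>n. outer_unit_normal K z n \<longrightarrow>
        ((\<lambda>\<sigma>. 2 * (n \<bullet> (k \<tau> - k \<sigma>)) / (\<sigma> - \<tau>)^2) \<longlongrightarrow> q) (at \<tau> within S)))"

lemma speed_sqE:
  assumes "speed_sq K z v q"
  obtains k S \<tau> where "k \<tau> = z" "\<tau> \<in> S" "at \<tau> within S \<noteq> bot" "k ` S \<subseteq> frontier K"
    "(k has_vector_derivative v) (at \<tau> within S)"
    "\<And>n. outer_unit_normal K z n \<Longrightarrow>
      ((\<lambda>\<sigma>. 2 * (n \<bullet> (k \<tau> - k \<sigma>)) / (\<sigma> - \<tau>)^2) \<longlongrightarrow> q) (at \<tau> within S)"
  using assms unfolding speed_sq_def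
proof (elim exE conjE)
  fix k S \<tau>
  assume "k \<tau> = z" "\<tau> \<in> S" "at \<tau> within S \<noteq> bot" "k ` S \<subseteq> frontier K"
    "(k has_vector_derivative v) (at \<tau> within S)"
    "\<forall>n. outer_unit_normal K z n \<longrightarrow>
      ((\<lambda>\<sigma>. 2 * (n \<bullet> (k \<tau> - k \<sigma>)) / (\<sigma> - \<tau>)^2) \<longlongrightarrow> q) (at \<tau> within S)"
  then show thesis using that[of k \<tau> S] by blast
qed

lemma exists_outer_unit_normal:
  assumes "convex K" "closed K" "interior K \<noteq> {}" and x: "x \<in> frontier K"
  obtains n where "outer_unit_normal K x n"
proof -
  have "x \<in> closure K" "x \<notin> rel_interior K"
    using x assms by (auto simp: frontier_def rel_interior_nonempty_interior)
  then obtain a where a: "a \<noteq> 0" "\<And>y. y \<in> closure K \<Longrightarrow> a \<bullet> x \<le> a \<bullet> y"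
    using supporting_hyperplane_relative_frontier[OF assms(1)] by metis
  have "outer_unit_normal K x (- (1 / norm a) *\<^sub>R a)"
    unfolding outer_unit_normal_def
  proof (intro conjI ballI)
    fix y assume "y \<in> K"
    then have "a \<bullet> x \<le> a \<bullet> y" using a(2) closure_subset by blast
    then show "- (1 / norm a) *\<^sub>R a \<bullet> y \<le> - (1 / norm a) *\<^sub>R a \<bullet> x"
      using a(1) by (simp add: divide_right_mono)
  qed (use a(1) in simp)
  then show ?thesis by (rule that)
qed

text \<open>Excludes that a vector and its negative are both outer normals of K at the same
  point.\<close>

lemma hyperplane_interior_empty:
  fixes a :: "'a::euclidean_space"
  assumes "a \<noteq> 0" "\<And>x. x \<in> K \<Longrightarrow> a \<bullet> x = b"
  shows "interior K = {}"
proof -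
  have "interior K \<subseteq> interior {x. a \<bullet> x = b}" using assms(2) by (intro interior_mono) auto
  then show ?thesis using interior_hyperplane[OF assms(1)] by auto
qed

lemma has_vector_derivative_quotient:
  assumes "(k has_vector_derivative v) (at \<tau> within S)"
  shows "((\<lambda>\<sigma>. (1 / (\<sigma> - \<tau>)) *\<^sub>R (k \<sigma> - k \<tau>)) \<longlongrightarrow> v) (at \<tau> within S)"
proof -
  have "((\<lambda>\<sigma>. norm ((k \<sigma> - k \<tau>) - (\<sigma> - \<tau>) *\<^sub>R v) / norm (\<sigma> - \<tau>)) \<longlongrightarrow> 0) (at \<tau> within S)"
    using assms by (simp add: has_vector_derivative_def has_derivative_iff_norm)
  moreover have "\<forall>\<^sub>F \<sigma> in at \<tau> within S.
      norm ((k \<sigma> - k \<tau>) - (\<sigma> - \<tau>) *\<^sub>R v) / norm (\<sigma> - \<tau>) = norm ((1 / (\<sigma> - \<tau>)) *\<^sub>R (k \<sigma> - k \<tau>) - v)"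
    unfolding eventually_at_filter
  proof (intro always_eventually allI impI)
    fix \<sigma> assume "\<sigma> \<noteq> \<tau>"
    then have "(1 / (\<sigma> - \<tau>)) *\<^sub>R (k \<sigma> - k \<tau>) - v = (1 / (\<sigma> - \<tau>)) *\<^sub>R ((k \<sigma> - k \<tau>) - (\<sigma> - \<tau>) *\<^sub>R v)"
      by (simp add: scaleR_diff_right)
    then show "norm ((k \<sigma> - k \<tau>) - (\<sigma> - \<tau>) *\<^sub>R v) / norm (\<sigma> - \<tau>)
        = norm ((1 / (\<sigma> - \<tau>)) *\<^sub>R (k \<sigma> - k \<tau>) - v)"
      by (simp add: divide_inverse mult.commute)
  qed
  ultimately have "((\<lambda>\<sigma>. norm ((1 / (\<sigma> - \<tau>)) *\<^sub>R (k \<sigma> - k \<tau>) - v)) \<longlongrightarrow> 0) (at \<tau> within S)"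
    by (rule Lim_transform_eventually)
  then show ?thesis by (rule LIM_zero_cancel[OF tendsto_norm_zero_cancel])
qed

section \<open>Outer normals of a graph patch\<close>

locale graph_patch = hyperplane_frame \<nu> e m for \<nu> :: "'a::euclidean_space" and e m +
  fixes K :: "'a set" and p :: 'a and U :: "'a set" and r :: real
  assumes cpt: "compact K" and cvx: "convex K" and int: "interior K \<noteq> {}"
    and normal_p: "outer_unit_normal K p \<nu>"
    and U_open: "openin (top_of_set (frontier K)) U" and p_U: "p \<in> U" and r_pos: "r > 0"
    and homeo: "\<exists>g. homeomorphism U (hyperplane_ball \<nu> r) (hyperplane_proj p \<nu>) g"
    and smooth: "Ck_on 3 m e (hyperplane_ball \<nu> r) (graph_fun p \<nu> U)"
begin

abbreviation f :: "'a \<Rightarrow> real" where "f \<equiv> graph_fun p \<nu> U"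
abbreviation B :: "'a set" where "B \<equiv> hyperplane_ball \<nu> r"
abbreviation pr :: "'a \<Rightarrow> 'a" where "pr \<equiv> hyperplane_proj p \<nu>"

text \<open>The lift that inverts \<open>pr\<close>. The function \<open>f\<close> measures depth
  below the tangent hyperplane at \<open>p\<close> and \<nu> points out of K, hence the minus
  sign.\<close>

definition y :: "'a \<Rightarrow> 'a" where "y u = p + u - f u *\<^sub>R \<nu>"

text \<open>The gradient of \<open>\<nu> \<bullet> (x - p) + f (pr x)\<close>, a function of
  \<open>x\<close> that vanishes on the graph. It is left unnormalised so that heights become
  Bregman divergences of \<open>f\<close>.\<close>

definition N :: "'a \<Rightarrow> 'a" where "N u = \<nu> + grad f u"

lemma C3_f: "C3 r f"
  using smooth by (auto simp: numeral_3_eq_3 C3_def C2_def C1_def)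

lemma C2_f: "C2 r f"
  by (rule C3_C2[OF C3_f])

lemma C1_f: "C1 r f"
  using C2_f by (simp add: C2_def)

lemma closed_K: "closed K"
  using cpt by (rule compact_imp_closed)

lemma U_frontier: "U \<subseteq> frontier K"
  using U_open openin_imp_subset by blast

lemma frontier_K: "frontier K \<subseteq> K"
  using closed_K by (rule frontier_subset_closed)

lemma pr_graph: "\<nu> \<bullet> u = 0 \<Longrightarrow> pr (p + u - t *\<^sub>R \<nu>) = u"
  by (simp add: hyperplane_proj_def inner_diff_right nu_nu)

lemma pr_y: "\<nu> \<bullet> u = 0 \<Longrightarrow> pr (y u) = u"
  unfolding y_def by (rule pr_graph)

lemma nu_pr: "\<nu> \<bullet> pr z = 0"
  by (simp add: hyperplane_proj_def inner_diff_right nu_nu)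

lemma norm_pr_diff: "norm (pr x - pr z) \<le> norm (x - z)"
proof -
  have d: "pr x - pr z = (x - z) - (\<nu> \<bullet> (x - z)) *\<^sub>R \<nu>"
    by (simp add: hyperplane_proj_def algebra_simps inner_diff_right)
  have "(norm (pr x - pr z))^2 = (x - z) \<bullet> (x - z) - (\<nu> \<bullet> (x - z))^2"
    unfolding d power2_norm_eq_inner
    by (simp add: inner_diff_left inner_diff_right nu_nu inner_commute power2_eq_square algebra_simps)
  also have "\<dots> \<le> (norm (x - z))^2" by (simp add: power2_norm_eq_inner)
  finally show ?thesis by (rule power2_le_imp_le) simp
qed

lemma nu_B: "u \<in> B \<Longrightarrow> \<nu> \<bullet> u = 0"
  by (simp add: hyperplane_ball_def)

lemma zero_B: "0 \<in> B"
  using r_pos by (simp add: hyperplane_ball_def)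

lemma pr_U: "pr ` U = B" and inj_pr: "inj_on pr U"
  using homeo by (auto simp: homeomorphism_def intro: inj_on_inverseI)

text \<open>\<open>graph_fun\<close> is an unsigned distance. The support inequality at
  \<open>p\<close> supplies the sign: the preimage of \<open>u\<close> lies below the tangent
  hyperplane.\<close>

lemma y_U:
  assumes u: "u \<in> B"
  shows "y u \<in> U" "f u \<ge> 0"
proof -
  define z where "z = inv_into U pr u"
  have z: "z \<in> U" "pr z = u"
    using u pr_U by (auto simp: z_def inv_into_into f_inv_into_f)
  have "\<nu> \<bullet> (z - p) \<le> 0"
    using normal_p z(1) U_frontier frontier_K by (auto simp: outer_unit_normal_def inner_diff_right)
  moreover have "z = p + u + (\<nu> \<bullet> (z - p)) *\<^sub>R \<nu>"
    using z(2) by (simp add: hyperplane_proj_def algebra_simps)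
  moreover from this have "dist (p + u) z = \<bar>\<nu> \<bullet> (z - p)\<bar>"
    by (metis add_diff_cancel_left' dist_norm norm_minus_commute norm_scaleR norm_nu mult.right_neutral)
  ultimately have "f u = - (\<nu> \<bullet> (z - p))" "y u = z"
    by (auto simp: graph_fun_def y_def simp flip: z_def)
  then show "y u \<in> U" "f u \<ge> 0" using z(1) \<open>\<nu> \<bullet> (z - p) \<le> 0\<close> by auto
qed

lemma y_K: "u \<in> B \<Longrightarrow> y u \<in> K" and y_frontier: "u \<in> B \<Longrightarrow> y u \<in> frontier K"
  using y_U U_frontier frontier_K by auto

lemma y_pr:
  assumes "z \<in> U"
  shows "pr z \<in> B" "y (pr z) = z"
proof -
  show *: "pr z \<in> B" using assms pr_U by blast
  then show "y (pr z) = z"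
    using inj_pr assms y_U(1)[OF *] pr_y nu_B inj_onD by metis
qed

lemma pr_p: "pr p = 0"
  by (simp add: hyperplane_proj_def)

lemma y_0: "y 0 = p"
  using y_pr[OF p_U] by (simp add: pr_p)

lemma N_inner_y: "N u \<bullet> (y u - y v) = f v - f u - grad f u \<bullet> (v - u)" if "\<nu> \<bullet> u = 0" "\<nu> \<bullet> v = 0"
proof -
  have "grad f u \<bullet> \<nu> = 0" using nu_grad by (simp add: inner_commute)
  then show ?thesis
    using that by (simp add: N_def y_def inner_add_left inner_diff_right inner_add_right nu_nu)
qed

lemma norm_N: "1 \<le> norm (N u)" "N u \<noteq> 0"
  using norm_nu_grad_ge[of f u] by (auto simp: N_def)

text \<open>The height below a supporting hyperplane at \<open>y u\<close> is minimal at
  \<open>u\<close>, so its partial derivatives vanish there. They determine the tangential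
  coordinates of \<open>n\<close> up to the factor \<open>n \<bullet> \<nu>\<close>, whose sign
  stays open.\<close>

lemma normal_direction:
  assumes u: "u \<in> B" and n: "outer_unit_normal K (y u) n"
  shows "n = (n \<bullet> \<nu>) *\<^sub>R N u"
proof -
  have ne: "n \<bullet> e i = (n \<bullet> \<nu>) * partial (e i) f u" if i: "i < m" for i
  proof -
    let ?g = "\<lambda>t. n \<bullet> (y u - y (u + t *\<^sub>R e i))"
    have "((\<lambda>t. f (u + t *\<^sub>R e i)) has_real_derivative grad f (u + 0 *\<^sub>R e i) \<bullet> e i) (at 0)"
      using u i by (intro C1_has_derivative_line[OF C1_f]) (auto simp: nu_e)
    then have "((\<lambda>t. f (u + t *\<^sub>R e i)) has_real_derivative partial (e i) f u) (at 0)"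
      using i by (simp add: grad_e)
    moreover have "?g = (\<lambda>t. (f (u + t *\<^sub>R e i) - f u) * (n \<bullet> \<nu>) - t * (n \<bullet> e i))"
      by (auto simp: y_def fun_eq_iff inner_diff_right inner_add_right algebra_simps)
    ultimately have D: "(?g has_real_derivative partial (e i) f u * (n \<bullet> \<nu>) - n \<bullet> e i) (at 0)"
      by (auto intro!: derivative_eq_intros)
    have "r - norm u > 0" using u by (simp add: hyperplane_ball_def)
    moreover have "\<forall>t. \<bar>0 - t\<bar> < r - norm u \<longrightarrow> ?g 0 \<le> ?g t"
    proof (intro allI impI)
      fix t assume "\<bar>0 - t\<bar> < r - norm u"
      then have "u + t *\<^sub>R e i \<in> B"
        using u i by (intro hyperplane_ball_shift) (auto simp: nu_e norm_e)
      then show "?g 0 \<le> ?g t"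
        using n y_K by (auto simp: outer_unit_normal_def inner_diff_right)
    qed
    ultimately have "partial (e i) f u * (n \<bullet> \<nu>) - n \<bullet> e i = 0"
      by (rule DERIV_local_min[OF D])
    then show ?thesis by (simp add: mult.commute)
  qed
  define w where "w = n - (n \<bullet> \<nu>) *\<^sub>R \<nu>"
  have "\<nu> \<bullet> w = 0" by (simp add: w_def inner_diff_right nu_nu inner_commute)
  then have "w = (\<Sum>i<m. (w \<bullet> e i) *\<^sub>R e i)" by (simp add: expansion)
  also have "\<dots> = (\<Sum>i<m. (n \<bullet> \<nu>) *\<^sub>R (partial (e i) f u *\<^sub>R e i))"
    by (intro sum.cong) (auto simp: w_def inner_diff_left nu_e ne)
  also have "\<dots> = (n \<bullet> \<nu>) *\<^sub>R grad f u" by (simp add: grad_def scaleR_sum_right)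
  finally show ?thesis by (simp add: w_def N_def algebra_simps)
qed

lemma continuous_on_grad: "continuous_on B (grad f)"
  unfolding grad_def using C1_f by (intro continuous_intros) (auto simp: C1_def)

lemma continuous_on_f: "continuous_on B f"
  using smooth by (simp add: numeral_3_eq_3)

lemma continuous_on_N: "continuous_on B N"
  unfolding N_def by (intro continuous_intros continuous_on_grad)

lemma continuous_on_y: "continuous_on B y"
  unfolding y_def by (intro continuous_intros continuous_on_f)

lemma convex_B: "convex B"
proof -
  have "B = {u. \<nu> \<bullet> u = 0} \<inter> ball 0 r" by (auto simp: hyperplane_ball_def)
  then show ?thesis by (simp add: convex_Int convex_hyperplane convex_ball)
qed

text \<open>Up to sign, \<open>N u\<close> is normal at \<open>y u\<close>. The set of \<open>u\<close> where it points outward and the set where it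
  points inward are closed and disjoint, and the ball is connected.\<close>

lemma N_outward:
  assumes u: "u \<in> B" and x: "x \<in> K"
  shows "N u \<bullet> x \<le> N u \<bullet> y u"
proof -
  define E1 where "E1 = (\<Inter>x\<in>K. {u\<in>B. N u \<bullet> x \<le> N u \<bullet> y u})"
  define E2 where "E2 = (\<Inter>x\<in>K. {u\<in>B. N u \<bullet> y u \<le> N u \<bullet> x})"
  have Kne: "K \<noteq> {}" using int by auto
  have cl: "closedin (top_of_set B) {u\<in>B. g u \<le> h u}"
    if "continuous_on B g" "continuous_on B h" for g h :: "'a \<Rightarrow> real"
  proof -
    have "closedin (top_of_set B) (B \<inter> (\<lambda>u. g u - h u) -` {..0})"
      using that by (intro continuous_closedin_preimage continuous_intros) auto
    moreover have "B \<inter> (\<lambda>u. g u - h u) -` {..0} = {u\<in>B. g u \<le> h u}" by auto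
    ultimately show ?thesis by simp
  qed
  have c1: "closedin (top_of_set B) E1"
    unfolding E1_def using Kne
    by (intro closedin_INT cl continuous_intros continuous_on_N continuous_on_y) auto
  have c2: "closedin (top_of_set B) E2"
    unfolding E2_def using Kne
    by (intro closedin_INT cl continuous_intros continuous_on_N continuous_on_y) auto
  have cover: "B \<subseteq> E1 \<union> E2"
  proof
    fix v assume v: "v \<in> B"
    obtain n where n: "outer_unit_normal K (y v) n"
      using exists_outer_unit_normal[OF cvx closed_K int y_frontier[OF v]] .
    define c where "c = n \<bullet> \<nu>"
    have nN: "n = c *\<^sub>R N v" using normal_direction[OF v n] by (simp add: c_def)
    then have "c \<noteq> 0" using n by (auto simp: outer_unit_normal_def)
    have "c * (N v \<bullet> x) \<le> c * (N v \<bullet> y v)" if "x \<in> K" for x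
      using n that by (auto simp: outer_unit_normal_def nN)
    then show "v \<in> E1 \<union> E2"
      using v \<open>c \<noteq> 0\<close> Kne by (cases "c > 0") (auto simp: E1_def E2_def mult_le_cancel_left)
  qed
  \<comment> \<open>If both signs occurred at one point, K would lie in a hyperplane.\<close>
  have disj: "E1 \<inter> E2 = {}"
  proof (rule ccontr)
    assume "E1 \<inter> E2 \<noteq> {}"
    then obtain v where "v \<in> E1" "v \<in> E2" by auto
    then have "N v \<bullet> x = N v \<bullet> y v" if "x \<in> K" for x
      using that by (force simp: E1_def E2_def)
    then show False using hyperplane_interior_empty[of "N v" K] norm_N(2) int by blast
  qed
  \<comment> \<open>The base point decides which of the two sets is empty: there \<open>N\<close> is
    \<nu> itself, which is outward by assumption.\<close>
  have "\<nu> = (\<nu> \<bullet> \<nu>) *\<^sub>R N 0"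
    using normal_direction[OF zero_B] normal_p y_0 by simp
  then have N0: "N 0 = \<nu>" by (simp add: nu_nu)
  have "0 \<in> E1"
    using normal_p zero_B Kne by (auto simp: E1_def N0 y_0 outer_unit_normal_def)
  then have "E2 = {}"
    using c1 c2 cover disj convex_connected[OF convex_B] unfolding connected_closedin by blast
  then have "u \<in> E1" using cover u by auto
  then show ?thesis using x by (auto simp: E1_def)
qed

text \<open>The outer unit normal is unique, so a quantifier over all normals at a boundary point,
  as in \<open>speed_sq\<close>, refers to a single vector.\<close>

lemma normal_iff:
  assumes u: "u \<in> B"
  shows "outer_unit_normal K (y u) n \<longleftrightarrow> n = (1 / norm (N u)) *\<^sub>R N u"
proof
  assume "n = (1 / norm (N u)) *\<^sub>R N u"
  then show "outer_unit_normal K (y u) n"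
    using N_outward[OF u] norm_N(2) by (auto simp: outer_unit_normal_def divide_right_mono)
next
  assume n: "outer_unit_normal K (y u) n"
  define c where "c = n \<bullet> \<nu>"
  have nN: "n = c *\<^sub>R N u" using normal_direction[OF u n] by (simp add: c_def)
  have "c > 0"
  proof (rule ccontr)
    assume "\<not> c > 0"
    moreover have "c \<noteq> 0" using n nN by (auto simp: outer_unit_normal_def)
    ultimately have c: "c < 0" by simp
    have "N u \<bullet> x = N u \<bullet> y u" if "x \<in> K" for x
    proof -
      have "c * (N u \<bullet> x) \<le> c * (N u \<bullet> y u)"
        using n that by (auto simp: outer_unit_normal_def nN)
      then show ?thesis using c N_outward[OF u that] by (auto simp: mult_le_cancel_left)
    qed
    then show False using hyperplane_interior_empty[of "N u" K] norm_N(2) int by blast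
  qed
  moreover have "\<bar>c\<bar> * norm (N u) = 1" using n nN by (auto simp: outer_unit_normal_def)
  ultimately have "c = 1 / norm (N u)" using norm_N(2) by (simp add: field_simps)
  then show "n = (1 / norm (N u)) *\<^sub>R N u" using nN by simp
qed

section \<open>Heights over supporting hyperplanes and speeds of curves\<close>

lemma height:
  assumes "u \<in> B" "v \<in> B" "outer_unit_normal K (y u) n"
  shows "n \<bullet> (y u - y v) = (f v - f u - grad f u \<bullet> (v - u)) / norm (N u)"
  using normal_iff[of u n] N_inner_y[of u v] assms nu_B by simp

lemma second_form_N: "second_form e f u s = hess f u s / norm (N u)"
  by (simp add: second_form_eq N_def)

text \<open>The curve is only once differentiable, yet a second-order limit exists: the height
  depends on the position alone and is half the Hessian form of the projected increment
  \<open>h\<close> up to a cubic error. Dividing by the squared time turns \<open>h\<close> into the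
  difference quotient \<open>d\<close> and leaves an error of order
  \<open>\<bar>\<sigma> - \<tau>\<bar>\<close>.\<close>

lemma second_form_limit:
  fixes k :: "real \<Rightarrow> 'a"
  assumes kU: "k \<tau> \<in> U" and kS: "k ` S \<subseteq> frontier K"
    and D: "(k has_vector_derivative v) (at \<tau> within S)"
    and n: "outer_unit_normal K (k \<tau>) n"
  shows "((\<lambda>\<sigma>. 2 * (n \<bullet> (k \<tau> - k \<sigma>)) / (\<sigma> - \<tau>)^2) \<longlongrightarrow> second_form e f (pr (k \<tau>)) (v - (\<nu> \<bullet> v) *\<^sub>R \<nu>)) (at \<tau> within S)"
proof -
  define u where "u = pr (k \<tau>)"
  define w where "w = v - (\<nu> \<bullet> v) *\<^sub>R \<nu>"
  define d where "d \<sigma> = (1 / (\<sigma> - \<tau>)) *\<^sub>R (pr (k \<sigma>) - u)" for \<sigma>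
  have u: "u \<in> B" "y u = k \<tau>" using y_pr[OF kU] by (auto simp: u_def)
  define r' where "r' = (norm u + r) / 2"
  have r': "norm u < r'" "r' < r" using u(1) by (auto simp: r'_def hyperplane_ball_def)
  have uc: "u \<in> hcball r'" using u(1) r' by (auto simp: hcball_def hyperplane_ball_def)
  obtain M where M: "M \<ge> 0" "\<And>u v. u \<in> hcball r' \<Longrightarrow> v \<in> hcball r' \<Longrightarrow>
      \<bar>f v - f u - grad f u \<bullet> (v - u) - hess f u (v - u) / 2\<bar> \<le> M * norm (v - u) ^ 3"
    using taylor3[OF C3_f r'(2)] by blast
  have kc: "(k \<longlongrightarrow> k \<tau>) (at \<tau> within S)"
    using has_vector_derivative_continuous[OF D] by (simp add: continuous_within)
  obtain T where T: "open T" "U = frontier K \<inter> T"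
    using U_open by (auto simp: openin_open)
  have "((\<lambda>\<sigma>. (1 / (\<sigma> - \<tau>)) *\<^sub>R (k \<sigma> - k \<tau>) - (\<nu> \<bullet> ((1 / (\<sigma> - \<tau>)) *\<^sub>R (k \<sigma> - k \<tau>))) *\<^sub>R \<nu>) \<longlongrightarrow> w)
      (at \<tau> within S)"
    unfolding w_def by (intro tendsto_intros has_vector_derivative_quotient[OF D])
  moreover have "(\<lambda>\<sigma>. (1 / (\<sigma> - \<tau>)) *\<^sub>R (k \<sigma> - k \<tau>) - (\<nu> \<bullet> ((1 / (\<sigma> - \<tau>)) *\<^sub>R (k \<sigma> - k \<tau>))) *\<^sub>R \<nu>) = d"
  proof
    fix \<sigma>
    have "pr (k \<sigma>) - u = (k \<sigma> - k \<tau>) - (\<nu> \<bullet> (k \<sigma> - k \<tau>)) *\<^sub>R \<nu>"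
      by (simp add: u_def hyperplane_proj_def algebra_simps inner_diff_right)
    then show "(1 / (\<sigma> - \<tau>)) *\<^sub>R (k \<sigma> - k \<tau>) - (\<nu> \<bullet> ((1 / (\<sigma> - \<tau>)) *\<^sub>R (k \<sigma> - k \<tau>))) *\<^sub>R \<nu> = d \<sigma>"
      by (simp add: d_def scaleR_diff_right inner_diff_right diff_divide_distrib)
  qed
  ultimately have dw: "(d \<longlongrightarrow> w) (at \<tau> within S)" by simp
  have evS: "\<forall>\<^sub>F \<sigma> in at \<tau> within S. \<sigma> \<in> S \<and> \<sigma> \<noteq> \<tau>"
    by (simp add: eventually_at_filter)
  have prc: "((\<lambda>\<sigma>. pr (k \<sigma>)) \<longlongrightarrow> u) (at \<tau> within S)"
    unfolding u_def hyperplane_proj_def by (intro tendsto_intros kc)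
  have evU: "\<forall>\<^sub>F \<sigma> in at \<tau> within S. k \<sigma> \<in> T"
    using topological_tendstoD[OF kc T(1)] kU T(2) by auto
  have evB: "\<forall>\<^sub>F \<sigma> in at \<tau> within S. norm (pr (k \<sigma>)) < r'"
    using order_tendstoD(2)[OF tendsto_norm[OF prc] r'(1)] .
  have small: "\<forall>\<^sub>F \<sigma> in at \<tau> within S.
      norm (2 * (n \<bullet> (k \<tau> - k \<sigma>)) / (\<sigma> - \<tau>)^2 - hess f u (d \<sigma>) / norm (N u)) \<le> 2 * M * norm (d \<sigma>) ^ 3 * \<bar>\<sigma> - \<tau>\<bar>"
    using evS evU evB
  proof eventually_elim
    fix \<sigma> assume s: "\<sigma> \<in> S \<and> \<sigma> \<noteq> \<tau>" and "k \<sigma> \<in> T" and nr: "norm (pr (k \<sigma>)) < r'"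
    then have "k \<sigma> \<in> U" using kS T(2) by auto
    then have us: "pr (k \<sigma>) \<in> B" "y (pr (k \<sigma>)) = k \<sigma>" using y_pr by auto
    have usc: "pr (k \<sigma>) \<in> hcball r'" using nr nu_pr by (simp add: hcball_def)
    define h where "h = pr (k \<sigma>) - u"
    define \<theta> where "\<theta> = \<sigma> - \<tau>"
    have th: "\<theta> \<noteq> 0" using s by (simp add: \<theta>_def)
    have hd: "h = \<theta> *\<^sub>R d \<sigma>" using th by (simp add: d_def h_def \<theta>_def)
    define R where "R = f (pr (k \<sigma>)) - f u - grad f u \<bullet> h - hess f u h / 2"
    have Rb: "\<bar>R\<bar> \<le> M * norm h ^ 3" using M(2)[OF uc usc] by (simp add: R_def h_def)
    have "n \<bullet> (k \<tau> - k \<sigma>) = (R + hess f u h / 2) / norm (N u)"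
      using height[OF u(1) us(1)] n u(2) us(2) by (simp add: R_def h_def)
    then have "2 * (n \<bullet> (k \<tau> - k \<sigma>)) / \<theta>^2 - hess f u (d \<sigma>) / norm (N u) = 2 * R / (norm (N u) * \<theta>^2)"
      unfolding hd hess_scaleR using th norm_N(2)[of u] by (simp add: field_simps)
    also have "\<bar>\<dots>\<bar> = 2 * \<bar>R\<bar> / (norm (N u) * \<theta>^2)" by (simp add: abs_mult)
    also have "\<dots> \<le> 2 * (M * norm h ^ 3) / (1 * \<theta>^2)"
      using Rb norm_N(1)[of u] th M(1) by (intro frac_le mult_left_mono mult_right_mono) auto
    also have "\<dots> = 2 * M * norm (d \<sigma>) ^ 3 * \<bar>\<theta>\<bar>"
      using th unfolding hd by (simp add: power_mult_distrib power3_eq_cube power2_eq_square field_simps abs_mult_self_eq)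
    finally show "norm (2 * (n \<bullet> (k \<tau> - k \<sigma>)) / (\<sigma> - \<tau>)^2 - hess f u (d \<sigma>) / norm (N u)) \<le> 2 * M * norm (d \<sigma>) ^ 3 * \<bar>\<sigma> - \<tau>\<bar>"
      by (simp add: \<theta>_def)
  qed
  have "((\<lambda>\<sigma>. 2 * M * norm (d \<sigma>) ^ 3 * \<bar>\<sigma> - \<tau>\<bar>) \<longlongrightarrow> 2 * M * norm w ^ 3 * \<bar>\<tau> - \<tau>\<bar>) (at \<tau> within S)"
    by (intro tendsto_intros dw)
  then have "((\<lambda>\<sigma>. 2 * (n \<bullet> (k \<tau> - k \<sigma>)) / (\<sigma> - \<tau>)^2 - hess f u (d \<sigma>) / norm (N u)) \<longlongrightarrow> 0) (at \<tau> within S)"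
    by (intro Lim_null_comparison[OF small]) simp
  moreover have "((\<lambda>\<sigma>. hess f u (d \<sigma>) / norm (N u)) \<longlongrightarrow> hess f u w / norm (N u)) (at \<tau> within S)"
    unfolding hess_def using norm_N(2)[of u] by (intro tendsto_intros dw) auto
  ultimately have "((\<lambda>\<sigma>. (2 * (n \<bullet> (k \<tau> - k \<sigma>)) / (\<sigma> - \<tau>)^2 - hess f u (d \<sigma>) / norm (N u)) + hess f u (d \<sigma>) / norm (N u))
      \<longlongrightarrow> 0 + hess f u w / norm (N u)) (at \<tau> within S)"
    by (rule tendsto_add)
  then show ?thesis by (simp add: second_form_N flip: u_def w_def)
qed

text \<open>The height over the supporting hyperplane is of second order in time, so its first-order
  quotient, which tends to \<open>- (n \<bullet> v)\<close>, tends to 0.\<close>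

lemma curve_velocity_tangent:
  fixes k :: "real \<Rightarrow> 'a"
  assumes kU: "k \<tau> \<in> U" and kS: "k ` S \<subseteq> frontier K" and ne: "at \<tau> within S \<noteq> bot"
    and D: "(k has_vector_derivative v) (at \<tau> within S)"
  shows "N (pr (k \<tau>)) \<bullet> v = 0"
proof -
  let ?u = "pr (k \<tau>)" and ?F = "at \<tau> within S"
  have u: "?u \<in> B" "y ?u = k \<tau>" using y_pr[OF kU] by auto
  define n where "n = (1 / norm (N ?u)) *\<^sub>R N ?u"
  have n: "outer_unit_normal K (k \<tau>) n" using normal_iff[OF u(1)] u(2) n_def by simp
  define q where "q = second_form e f ?u (v - (\<nu> \<bullet> v) *\<^sub>R \<nu>)"
  have "((\<lambda>\<sigma>. 2 * (n \<bullet> (k \<tau> - k \<sigma>)) / (\<sigma> - \<tau>)^2 * (\<sigma> - \<tau>)) \<longlongrightarrow> q * (\<tau> - \<tau>)) ?F"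
    unfolding q_def by (intro tendsto_intros second_form_limit[OF kU kS D n])
  moreover have "((\<lambda>\<sigma>. - 2 * (n \<bullet> ((1 / (\<sigma> - \<tau>)) *\<^sub>R (k \<sigma> - k \<tau>)))) \<longlongrightarrow> - 2 * (n \<bullet> v)) ?F"
    by (intro tendsto_intros has_vector_derivative_quotient[OF D])
  moreover have "(\<lambda>\<sigma>. 2 * (n \<bullet> (k \<tau> - k \<sigma>)) / (\<sigma> - \<tau>)^2 * (\<sigma> - \<tau>)) =
      (\<lambda>\<sigma>. - 2 * (n \<bullet> ((1 / (\<sigma> - \<tau>)) *\<^sub>R (k \<sigma> - k \<tau>))))"
  proof
    fix \<sigma>
    have "n \<bullet> (k \<tau> - k \<sigma>) = - (n \<bullet> (k \<sigma> - k \<tau>))" by (simp add: inner_diff_right)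
    then show "2 * (n \<bullet> (k \<tau> - k \<sigma>)) / (\<sigma> - \<tau>)^2 * (\<sigma> - \<tau>) = - 2 * (n \<bullet> ((1 / (\<sigma> - \<tau>)) *\<^sub>R (k \<sigma> - k \<tau>)))"
      by (cases "\<sigma> = \<tau>") (simp_all add: power2_eq_square)
  qed
  ultimately have "q * (\<tau> - \<tau>) = - 2 * (n \<bullet> v)"
    by (intro tendsto_unique[OF ne]) simp_all
  then have "n \<bullet> v = 0" by simp
  then show ?thesis using norm_N(2)[of ?u] by (simp add: n_def)
qed

text \<open>Limits are unique, so \<open>q\<close> is the second fundamental form in every patch
  that contains the point. This is how estimates in one chart reach pieces measured in
  another.\<close>

lemma speed_sq_chart:
  assumes u: "u \<in> B" and q: "speed_sq K (y u) v q"
  shows "N u \<bullet> v = 0" "q = second_form e f u (v - (\<nu> \<bullet> v) *\<^sub>R \<nu>)"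
proof -
  obtain k S \<tau> where k: "k \<tau> = y u" "\<tau> \<in> S" "at \<tau> within S \<noteq> bot" "k ` S \<subseteq> frontier K"
      "(k has_vector_derivative v) (at \<tau> within S)"
    and lim: "\<And>n. outer_unit_normal K (y u) n \<Longrightarrow>
        ((\<lambda>\<sigma>. 2 * (n \<bullet> (k \<tau> - k \<sigma>)) / (\<sigma> - \<tau>)^2) \<longlongrightarrow> q) (at \<tau> within S)"
    using q by (rule speed_sqE) blast
  have kU: "k \<tau> \<in> U" and pk: "pr (k \<tau>) = u" using k(1) y_U(1)[OF u] pr_y nu_B u by auto
  show "N u \<bullet> v = 0" using curve_velocity_tangent[OF kU k(4,3,5)] pk by simp
  have n: "outer_unit_normal K (y u) ((1 / norm (N u)) *\<^sub>R N u)" using normal_iff[OF u] by simp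
  show "q = second_form e f u (v - (\<nu> \<bullet> v) *\<^sub>R \<nu>)"
    using tendsto_unique[OF k(3) lim[OF n] second_form_limit[OF kU k(4,5)]] n k(1) pk by simp
qed

lemma speed_sq_curve:
  fixes k :: "real \<Rightarrow> 'a"
  assumes "k \<tau> \<in> U" "\<tau> \<in> S" "k ` S \<subseteq> frontier K" "at \<tau> within S \<noteq> bot"
    "(k has_vector_derivative v) (at \<tau> within S)"
  shows "speed_sq K (k \<tau>) v (second_form e f (pr (k \<tau>)) (v - (\<nu> \<bullet> v) *\<^sub>R \<nu>))"
  unfolding speed_sq_def using assms second_form_limit[OF assms(1,3,5)] by blast

lemma y_line_derivative:
  assumes u: "u + t *\<^sub>R w \<in> B" and w: "\<nu> \<bullet> w = 0"
  shows "((\<lambda>t. y (u + t *\<^sub>R w)) has_vector_derivative (w - (grad f (u + t *\<^sub>R w) \<bullet> w) *\<^sub>R \<nu>)) (at t)"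
proof -
  note C1_has_derivative_line[OF C1_f u w]
  then show ?thesis unfolding y_def
    by (auto intro!: derivative_eq_intros)
qed

text \<open>Every tangent direction is the velocity of a lifted line. Thus values of the second
  fundamental form can be moved between charts without a given curve.\<close>

lemma speed_sq_tangent:
  assumes u: "u \<in> B" and w: "\<nu> \<bullet> w = 0"
  shows "speed_sq K (y u) (w - (grad f u \<bullet> w) *\<^sub>R \<nu>) (second_form e f u w)"
proof -
  define S where "S = {t. u + t *\<^sub>R w \<in> B}"
  have 0: "u + 0 *\<^sub>R w \<in> B" using u by simp
  have "0 \<in> interior S"
    using eventually_line_in_ball[OF 0 w] by (auto simp: eventually_nhds interior_def S_def)
  then have at: "at 0 within S = at 0" by (rule at_within_interior)
  let ?k = "\<lambda>t. y (u + t *\<^sub>R w)" and ?v = "w - (grad f u \<bullet> w) *\<^sub>R \<nu>"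
  have "speed_sq K (?k 0) ?v (second_form e f (pr (?k 0)) (?v - (\<nu> \<bullet> ?v) *\<^sub>R \<nu>))"
  proof (rule speed_sq_curve)
    show "?k 0 \<in> U" using y_U[OF u] by simp
    show "0 \<in> S" using u by (simp add: S_def)
    show "?k ` S \<subseteq> frontier K" using y_frontier by (auto simp: S_def)
    show "at 0 within S \<noteq> bot" unfolding at by simp
    show "(?k has_vector_derivative ?v) (at 0 within S)"
      using y_line_derivative[OF 0 w] unfolding at by simp
  qed
  then show ?thesis
    using u w by (simp add: pr_y nu_B inner_diff_right nu_nu)
qed

end

lemma speed_sq_nonneg:
  assumes q: "speed_sq K z v q" and n: "outer_unit_normal K z n" and K: "closed K"
  shows "q \<ge> 0"
proof -
  obtain k S \<tau> where k: "k \<tau> = z" "at \<tau> within S \<noteq> bot" "k ` S \<subseteq> frontier K"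
    and "\<And>n. outer_unit_normal K z n \<Longrightarrow>
        ((\<lambda>\<sigma>. 2 * (n \<bullet> (k \<tau> - k \<sigma>)) / (\<sigma> - \<tau>)^2) \<longlongrightarrow> q) (at \<tau> within S)"
    using q by (rule speed_sqE) blast
  then have lim: "((\<lambda>\<sigma>. 2 * (n \<bullet> (k \<tau> - k \<sigma>)) / (\<sigma> - \<tau>)^2) \<longlongrightarrow> q) (at \<tau> within S)"
    using n by simp
  have "\<forall>\<^sub>F \<sigma> in at \<tau> within S. \<sigma> \<in> S" by (simp add: eventually_at_filter)
  then have "\<forall>\<^sub>F \<sigma> in at \<tau> within S. 0 \<le> 2 * (n \<bullet> (k \<tau> - k \<sigma>)) / (\<sigma> - \<tau>)^2"
  proof eventually_elim
    case (elim \<sigma>)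
    then have "k \<sigma> \<in> K" using k(3) frontier_subset_closed[OF K] by auto
    then have "n \<bullet> (k \<tau> - k \<sigma>) \<ge> 0"
      using n k(1) by (auto simp: outer_unit_normal_def inner_diff_right)
    then show ?case by simp
  qed
  then show ?thesis using tendsto_lowerbound[OF lim] k(2) by (simp add: trivial_limit_def)
qed

lemma graph_chart_patch:
  fixes K :: "'a::euclidean_space set"
  assumes "compact K" "convex K" "interior K \<noteq> {}" and c: "graph_chart K p \<nu> e U"
  obtains r where "graph_patch \<nu> e (DIM('a) - 1) K p U r"
proof -
  obtain r g where r: "r > 0" "homeomorphism U (hyperplane_ball \<nu> r) (hyperplane_proj p \<nu>) g"
    "Ck_on 3 (DIM('a) - 1) e (hyperplane_ball \<nu> r) (graph_fun p \<nu> U)"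
    using c unfolding graph_chart_def by blast
  have "graph_patch \<nu> e (DIM('a) - 1) K p U r"
    by unfold_locales (use assms r in \<open>auto simp: graph_chart_def outer_unit_normal_def\<close>)
  then show ?thesis by (rule that)
qed

section \<open>Positivity of the second fundamental form\<close>

context graph_patch
begin

text \<open>The curvature hypothesis concerns base points only. The vector \<open>w\<close> is
  therefore lifted to a tangent vector \<open>v\<close> at \<open>y u\<close> and read in a chart
  centred there, where convexity makes the Hessian form nonnegative and the determinant makes it
  definite.\<close>

lemma second_form_pos:
  assumes K: "K \<in> K3_plus" and u: "u \<in> B" and w: "\<nu> \<bullet> w = 0" "w \<noteq> 0"
  shows "second_form e f u w > 0"
proof -
  define v where "v = w - (grad f u \<bullet> w) *\<^sub>R \<nu>"
  have v: "speed_sq K (y u) v (second_form e f u w)"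
    using speed_sq_tangent[OF u w(1)] by (simp add: v_def)
  have "v - (\<nu> \<bullet> v) *\<^sub>R \<nu> = w" using w(1) by (simp add: v_def inner_diff_right nu_nu)
  then have v0: "v \<noteq> 0" using w(2) by auto
  obtain \<mu> e' U' where c: "graph_chart K (y u) \<mu> e' U'" "gauss_curvature e' (graph_fun (y u) \<mu> U') > 0"
    using K y_frontier[OF u] unfolding K3_plus_def by blast
  then obtain r' where "graph_patch \<mu> e' (DIM('a) - 1) K (y u) U' r'"
    using graph_chart_patch[OF cpt cvx int] by blast
  then interpret c: graph_patch \<mu> e' "DIM('a) - 1" K "y u" U' r' .
  have N0: "c.N 0 = norm (c.N 0) *\<^sub>R \<mu>"
  proof -
    have "\<mu> = (1 / norm (c.N 0)) *\<^sub>R c.N 0"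
      using c.normal_iff[OF c.zero_B, of \<mu>] c.normal_p by (simp add: c.y_0)
    from arg_cong[OF this, of "\<lambda>x. norm (c.N 0) *\<^sub>R x"] show ?thesis
      using c.norm_N(2)[of 0] by simp
  qed
  have vq: "speed_sq K (c.y 0) v (second_form e f u w)" using v by (simp add: c.y_0)
  have "norm (c.N 0) * (\<mu> \<bullet> v) = 0"
    using c.speed_sq_chart(1)[OF c.zero_B vq] N0 by (metis inner_scaleR_left)
  then have mv: "\<mu> \<bullet> v = 0" using c.norm_N(2)[of 0] by simp
  have q: "second_form e f u w = second_form e' c.f 0 v"
    using c.speed_sq_chart(2)[OF c.zero_B vq] mv by simp
  have nn: "c.hess c.f 0 s \<ge> 0" for s
  proof -
    \<comment> \<open>\<open>hess\<close> sees only the coordinates along \<open>e'\<close>, so the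
      normal component can be removed without changing its value.\<close>
    define s' where "s' = s - (\<mu> \<bullet> s) *\<^sub>R \<mu>"
    have "\<mu> \<bullet> s' = 0" by (simp add: s'_def inner_diff_right c.nu_nu)
    then have "second_form e' c.f 0 s' \<ge> 0"
      using speed_sq_nonneg[OF c.speed_sq_tangent[OF c.zero_B] _ c.closed_K] c.normal_p by (metis c.y_0)
    moreover have "s' \<bullet> e' i = s \<bullet> e' i" if "i < DIM('a) - 1" for i
      using that by (simp add: s'_def inner_diff_left c.nu_e)
    then have "c.hess c.f 0 s' = c.hess c.f 0 s" unfolding c.hess_def by (intro sum.cong) simp_all
    ultimately show ?thesis using c.norm_N(2)[of 0] by (auto simp: c.second_form_N zero_le_divide_iff)
  qed
  have "c.hess c.f 0 v \<noteq> 0"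
  proof
    assume z: "c.hess c.f 0 v = 0"
    have "v \<bullet> e' i = 0" if i: "i < DIM('a) - 1" for i
    proof (rule psd_form_definite[where A = "\<lambda>i j. partial (e' j) (partial (e' i) c.f) 0" and c = "\<lambda>i. v \<bullet> e' i", OF _ _ _ _ i])
      show "partial (e' j) (partial (e' i) c.f) 0 = partial (e' i) (partial (e' j) c.f) 0"
        if "i < DIM('a) - 1" "j < DIM('a) - 1" for i j
        using c.C3_f c.zero_B that unfolding c.C3_def c.C2_def by (intro c.mixed_partials_commute) blast+
      show "0 \<le> (\<Sum>i<DIM('a) - 1. \<Sum>j<DIM('a) - 1. partial (e' j) (partial (e' i) c.f) 0 * a i * a j)" for a
        using nn[of "\<Sum>i<DIM('a) - 1. a i *\<^sub>R e' i"] unfolding c.hess_sum_coord .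
      show "Determinant.det (Matrix.mat (DIM('a) - 1) (DIM('a) - 1) (\<lambda>(i, j). partial (e' j) (partial (e' i) c.f) 0)) \<noteq> 0"
        using c(2) unfolding gauss_curvature_def by linarith
      show "(\<Sum>i<DIM('a) - 1. \<Sum>j<DIM('a) - 1. partial (e' j) (partial (e' i) c.f) 0 * (v \<bullet> e' i) * (v \<bullet> e' j)) = 0"
        using z unfolding c.hess_def .
    qed
    then have "v = 0" using c.expansion[OF mv] by simp
    then show False using v0 by simp
  qed
  then show ?thesis
    using nn[of v] c.norm_N(2)[of 0] by (simp add: q c.second_form_N zero_less_divide_iff)
qed

end

definition boundary_curve_length :: "'a::euclidean_space set \<Rightarrow> 'a \<Rightarrow> 'a \<Rightarrow> real \<Rightarrow> bool" where
  "boundary_curve_length K x z L \<longleftrightarrow> (\<exists>k. k C1_differentiable_on {0..1} \<and> path_image k \<subseteq> frontier K \<and>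
     pathstart k = x \<and> pathfinish k = z \<and> curve_length K k L)"

context graph_patch
begin

lemma grad_nu: "grad f u \<bullet> \<nu> = 0"
  using nu_grad[of f u] by (simp add: inner_commute)

subsection \<open>Estimates in a chart\<close>

lemma norm_N_diff: "\<bar>1 / norm (N u) - 1 / norm (N v)\<bar> \<le> norm (grad f u - grad f v)"
proof -
  have "1 / norm (N u) - 1 / norm (N v) = (norm (N v) - norm (N u)) / (norm (N u) * norm (N v))"
    using norm_N(2)[of u] norm_N(2)[of v] by (simp add: divide_simps)
  also have "\<bar>\<dots>\<bar> = \<bar>norm (N v) - norm (N u)\<bar> / (norm (N u) * norm (N v))" by (simp add: abs_mult)
  also have "\<dots> \<le> \<bar>norm (N v) - norm (N u)\<bar> / (1 * 1)"
    using norm_N(1,2)[of u] norm_N(1,2)[of v] by (intro divide_left_mono mult_mono) auto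
  also have "\<dots> \<le> norm (N v - N u)" by (simp add: norm_triangle_ineq3)
  also have "N v - N u = grad f v - grad f u" by (simp add: N_def)
  finally show ?thesis by (simp add: norm_minus_commute)
qed

text \<open>The form is homogeneous of degree 2, so extrema over the compact set of points and unit
  directions suffice; positivity makes the minimum positive.\<close>

lemma hess_bounds:
  assumes K: "K \<in> K3_plus" and r': "r' < r"
  obtains c M where "c > 0" "M \<ge> 0"
    "\<And>u s. u \<in> hcball r' \<Longrightarrow> \<nu> \<bullet> s = 0 \<Longrightarrow> c * (norm s)^2 \<le> hess f u s"
    "\<And>u s. u \<in> hcball r' \<Longrightarrow> \<nu> \<bullet> s = 0 \<Longrightarrow> hess f u s \<le> M * (norm s)^2"
proof -
  define T where "T = hcball r' \<times> ({s. \<nu> \<bullet> s = 0} \<inter> sphere 0 1)"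
  have T: "compact T"
    unfolding T_def by (intro compact_Times compact_hcball closed_Int_compact closed_hyperplane compact_sphere)
  have cont: "continuous_on T (\<lambda>(u, s). hess f u s)"
    using hcball_subset[OF r'] by (intro continuous_on_subset[OF continuous_on_hess[OF C2_f]]) (auto simp: T_def)
  have pos: "hess f u s > 0" if "(u, s) \<in> T" for u s
  proof -
    have "second_form e f u s > 0"
      using that hcball_subset[OF r'] by (intro second_form_pos[OF K]) (auto simp: T_def)
    then show ?thesis using norm_N(1)[of u] by (simp add: second_form_N zero_less_divide_iff)
  qed
  have "\<exists>c>0. \<exists>M\<ge>0. \<forall>(u, s)\<in>T. c \<le> hess f u s \<and> hess f u s \<le> M"
  \<comment> \<open>\<open>T\<close> is empty if the radius is negative or if the hyperplane
    contains no unit vector.\<close>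
  proof (cases "T = {}")
    case True
    then show ?thesis by (intro exI[of _ 1]) auto
  next
    case False
    obtain a where a: "a \<in> T" "\<forall>x\<in>T. (\<lambda>(u, s). hess f u s) a \<le> (\<lambda>(u, s). hess f u s) x"
      using continuous_attains_inf[OF T False cont] by blast
    obtain b where b: "b \<in> T" "\<forall>x\<in>T. (\<lambda>(u, s). hess f u s) x \<le> (\<lambda>(u, s). hess f u s) b"
      using continuous_attains_sup[OF T False cont] by blast
    have "(\<lambda>(u, s). hess f u s) a > 0" "(\<lambda>(u, s). hess f u s) b > 0" 
      using pos[of "fst a" "snd a"] pos[of "fst b" "snd b"] a(1) b(1) by (auto simp: case_prod_beta)
    then show ?thesis using a(2) b(2)
      by (intro exI[of _ "(\<lambda>(u, s). hess f u s) a"] exI[of _ "(\<lambda>(u, s). hess f u s) b"] conjI) fastforce+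
  qed
  then obtain c M where cM: "c > 0" "M \<ge> 0" "\<And>u s. (u, s) \<in> T \<Longrightarrow> c \<le> hess f u s"
    "\<And>u s. (u, s) \<in> T \<Longrightarrow> hess f u s \<le> M" by fast
  have unit: "hess f u s = (norm s)^2 * hess f u ((1 / norm s) *\<^sub>R s)"
    "(u, (1 / norm s) *\<^sub>R s) \<in> T"
    if "u \<in> hcball r'" "\<nu> \<bullet> s = 0" "s \<noteq> 0" for u s
    using that by (auto simp: T_def hess_scaleR power_divide)
  have h0: "hess f u 0 = 0" for u by (simp add: hess_def)
  show ?thesis
  proof (rule that[OF cM(1,2)])
    fix u s assume us: "u \<in> hcball r'" "\<nu> \<bullet> s = 0"
    show "c * (norm s)^2 \<le> hess f u s"
      using unit(1)[OF us] cM(3)[OF unit(2)[OF us]] h0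
      by (cases "s = 0") (auto simp: mult.commute intro: mult_right_mono)
    show "hess f u s \<le> M * (norm s)^2"
      using unit(1)[OF us] cM(4)[OF unit(2)[OF us]] h0
      by (cases "s = 0") (auto simp: mult.commute intro: mult_right_mono)
  qed
qed

text \<open>A single constant, at least 1, serves all estimates of a chart. Powers of it then
  increase with the exponent, and products of several constants collapse to one power.\<close>

definition chart_estimates :: "real \<Rightarrow> real \<Rightarrow> bool" where
  "chart_estimates r' C \<longleftrightarrow> C \<ge> 1 \<and> (\<forall>u\<in>hcball r'. \<forall>v\<in>hcball r'.
     (\<forall>n. outer_unit_normal K (y u) n \<longrightarrow>
        \<bar>2 * (n \<bullet> (y u - y v)) - second_form e f u (v - u)\<bar> \<le> C * norm (v - u) ^ 3 \<and>
        (norm (v - u))^2 \<le> C * (n \<bullet> (y u - y v))) \<and>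
     (\<forall>s. \<nu> \<bullet> s = 0 \<longrightarrow>
        \<bar>second_form e f u s - second_form e f v s\<bar> \<le> C * norm (u - v) * (norm s)^2 \<and>
        (norm s)^2 \<le> C * second_form e f u s \<and> second_form e f u s \<le> C * (norm s)^2) \<and>
     \<bar>1 / norm (N u) - 1 / norm (N v)\<bar> \<le> C * norm (u - v) \<and> \<bar>f u - f v\<bar> \<le> C * norm (u - v) \<and>
     norm (grad f u) \<le> C \<and> norm (N u) \<le> C)"

lemma chart_estimates_exist:
  assumes K: "K \<in> K3_plus" and r': "r' < r"
  shows "\<exists>C. chart_estimates r' C"
proof -
  note sub = subsetD[OF hcball_subset[OF r']]
  obtain M1 where M1: "M1 \<ge> 0" "\<And>u v. u \<in> hcball r' \<Longrightarrow> v \<in> hcball r' \<Longrightarrow>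
      \<bar>f v - f u - grad f u \<bullet> (v - u) - hess f u (v - u) / 2\<bar> \<le> M1 * norm (v - u) ^ 3"
    using taylor3[OF C3_f r'] by blast
  obtain M2 where M2: "M2 \<ge> 0" "\<And>u v s. u \<in> hcball r' \<Longrightarrow> v \<in> hcball r' \<Longrightarrow>
      \<bar>hess f u s - hess f v s\<bar> \<le> M2 * norm (u - v) * (norm s)^2"
    using hess_lipschitz[OF C3_f r'] by blast
  obtain M3 where M3: "M3 \<ge> 0" "\<And>u v. u \<in> hcball r' \<Longrightarrow> v \<in> hcball r' \<Longrightarrow>
      norm (grad f u - grad f v) \<le> M3 * norm (u - v)"
    using grad_lipschitz[OF C2_f r'] by blast
  obtain M4 where M4: "M4 \<ge> 0" "\<And>u v. u \<in> hcball r' \<Longrightarrow> v \<in> hcball r' \<Longrightarrow> \<bar>f u - f v\<bar> \<le> M4 * norm (u - v)"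
    using C1_lipschitz[OF C1_f r'] by blast
  have "bounded (grad f ` hcball r')"
    using sub by (intro compact_imp_bounded compact_continuous_image compact_hcball
        continuous_on_subset[OF continuous_on_grad]) auto
  then obtain M5 where M5: "M5 > 0" "\<And>u. u \<in> hcball r' \<Longrightarrow> norm (grad f u) \<le> M5"
    unfolding bounded_pos by auto
  obtain c M6 where c: "c > 0" and M6: "M6 \<ge> 0"
    and hl: "\<And>u s. u \<in> hcball r' \<Longrightarrow> \<nu> \<bullet> s = 0 \<Longrightarrow> c * (norm s)^2 \<le> hess f u s"
    and hu: "\<And>u s. u \<in> hcball r' \<Longrightarrow> \<nu> \<bullet> s = 0 \<Longrightarrow> hess f u s \<le> M6 * (norm s)^2"
    using hess_bounds[OF K r'] by blast
  define W where "W = 1 + M5"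
  have W: "norm (N u) \<le> W" if "u \<in> hcball r'" for u
    using norm_triangle_ineq[of \<nu> "grad f u"] M5(2)[OF that] by (simp add: N_def W_def norm_nu)
  have W1: "W \<ge> 1" using M5(1) by (simp add: W_def)
  \<comment> \<open>All summands are nonnegative, so \<open>C\<close> dominates each of them; each
    controls one or more of the estimates. The products and quotients come from the difference of
    second forms (\<open>M2 + M6 * M3\<close>) and from the lower bounds
    (\<open>2 * W / c\<close>).\<close>
  define C where "C = 1 + 2 * M1 + (M2 + M6 * M3) + M6 + M3 + M4 + M5 + W + 2 * W / c"
  have nn: "M6 * M3 \<ge> 0" "2 * W / c \<ge> 0" "W / c \<ge> 0" "W / c \<le> 2 * W / c"
    using M6 M3(1) c W1 by (auto simp: divide_right_mono)
  have C: "1 \<le> C" "2 * M1 \<le> C" "M2 + M6 * M3 \<le> C" "M6 \<le> C" "M3 \<le> C" "M4 \<le> C" "M5 \<le> C" "W \<le> C" "2 * W / c \<le> C" "W / c \<le> C"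
    unfolding C_def using M1(1) M2(1) M3(1) M4(1) M5(1) M6 W1 nn by linarith+
  have up: "x \<le> C * b" if "x \<le> a * b" "a \<le> C" "b \<ge> 0" for x a b
    using that mult_right_mono by (meson order_trans)
  have e1: "\<bar>2 * (n \<bullet> (y u - y v)) - second_form e f u (v - u)\<bar> \<le> C * norm (v - u) ^ 3"
    if "u \<in> hcball r'" "v \<in> hcball r'" "outer_unit_normal K (y u) n" for u v n
  proof -
    define R where "R = f v - f u - grad f u \<bullet> (v - u) - hess f u (v - u) / 2"
    have "n \<bullet> (y u - y v) = (R + hess f u (v - u) / 2) / norm (N u)"
      using height[OF sub sub, OF that] by (simp add: R_def)
    then have "2 * (n \<bullet> (y u - y v)) - second_form e f u (v - u) = 2 * R / norm (N u)"
      by (simp add: second_form_N add_divide_distrib)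
    also have "\<bar>\<dots>\<bar> = 2 * \<bar>R\<bar> / norm (N u)" by (simp add: abs_mult)
    also have "\<dots> \<le> 2 * \<bar>R\<bar> / 1" using norm_N(1)[of u] by (intro divide_left_mono) auto
    also have "\<dots> \<le> (2 * M1) * norm (v - u) ^ 3" using M1(2)[OF that(1,2)] by (simp add: R_def)
    finally show ?thesis using up C(2) by simp
  qed
  have e2: "(norm (v - u))^2 \<le> C * (n \<bullet> (y u - y v))"
    if uv: "u \<in> hcball r'" "v \<in> hcball r'" and n: "outer_unit_normal K (y u) n" for u v n
  proof -
    \<comment> \<open>The intermediate Hessian is bounded below on the whole ball, so this estimate
      needs no smallness of \<open>v - u\<close>, which a cubic remainder would require.\<close>
    obtain w where w: "w \<in> hcball r'" "f v = f u + grad f u \<bullet> (v - u) + hess f w (v - u) / 2"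
      using taylor2[OF C2_f uv r'] by blast
    have "\<nu> \<bullet> (v - u) = 0" using uv by (simp add: hcball_def inner_diff_right)
    then have h: "c * (norm (v - u))^2 \<le> hess f w (v - u)" using hl w(1) by blast
    have "n \<bullet> (y u - y v) = hess f w (v - u) / (2 * norm (N u))"
      using height[OF sub sub, OF uv n] w(2) by (simp add: field_simps)
    then have "c * (norm (v - u))^2 \<le> 2 * norm (N u) * (n \<bullet> (y u - y v))"
      using h norm_N(2)[of u] by (simp add: field_simps)
    moreover have np: "n \<bullet> (y u - y v) \<ge> 0"
      using n y_K[OF sub[OF uv(2)]] by (simp add: outer_unit_normal_def inner_diff_right)
    then have "2 * norm (N u) * (n \<bullet> (y u - y v)) \<le> 2 * W * (n \<bullet> (y u - y v))"
      using W[OF uv(1)] by (intro mult_right_mono) auto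
    ultimately have "c * (norm (v - u))^2 \<le> 2 * W * (n \<bullet> (y u - y v))" by linarith
    then have "(norm (v - u))^2 \<le> (2 * W / c) * (n \<bullet> (y u - y v))" using c by (simp add: field_simps)
    then show ?thesis using up C(9) np by blast
  qed
  have iW: "\<bar>1 / norm (N u) - 1 / norm (N v)\<bar> \<le> M3 * norm (u - v)" if "u \<in> hcball r'" "v \<in> hcball r'" for u v
    using norm_N_diff[of u v] M3(2)[OF that] by linarith
  have e3: "\<bar>second_form e f u s - second_form e f v s\<bar> \<le> C * norm (u - v) * (norm s)^2"
    if uv: "u \<in> hcball r'" "v \<in> hcball r'" and s: "\<nu> \<bullet> s = 0" for u v s
  proof -
    have "0 \<le> hess f v s" using hl[OF uv(2) s] c order_trans[of 0 "c * (norm s)^2"] by simp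
    then have hv: "\<bar>hess f v s\<bar> \<le> M6 * (norm s)^2" using hu[OF uv(2) s] by simp
    have eq: "second_form e f u s - second_form e f v s =
        (hess f u s - hess f v s) / norm (N u) + hess f v s * (1 / norm (N u) - 1 / norm (N v))"
      by (simp add: second_form_N diff_divide_distrib right_diff_distrib)
    have "\<bar>second_form e f u s - second_form e f v s\<bar> \<le> \<bar>hess f u s - hess f v s\<bar> / norm (N u) + \<bar>hess f v s\<bar> * \<bar>1 / norm (N u) - 1 / norm (N v)\<bar>"
      unfolding eq by (rule order_trans[OF abs_triangle_ineq]) (simp add: abs_mult)
    also have "\<dots> \<le> \<bar>hess f u s - hess f v s\<bar> / 1 + (M6 * (norm s)^2) * (M3 * norm (u - v))"
      using norm_N(1)[of u] M6 by (intro add_mono divide_left_mono mult_mono hv iW[OF uv]) auto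
    also have "\<dots> \<le> M2 * norm (u - v) * (norm s)^2 + (M6 * (norm s)^2) * (M3 * norm (u - v))"
      using M2(2)[OF uv, of s] by simp
    also have "\<dots> = (M2 + M6 * M3) * (norm (u - v) * (norm s)^2)" by (simp add: algebra_simps)
    also have "\<dots> \<le> C * (norm (u - v) * (norm s)^2)" using C(3) by (intro mult_right_mono) auto
    finally show ?thesis by (simp add: mult.assoc)
  qed
  have e4: "(norm s)^2 \<le> C * second_form e f u s \<and> second_form e f u s \<le> C * (norm s)^2"
    if u: "u \<in> hcball r'" and s: "\<nu> \<bullet> s = 0" for u s
  proof
    have h0: "0 \<le> hess f u s" using hl[OF u s] c order_trans[of 0 "c * (norm s)^2"] by simp
    have "hess f u s / norm (N u) \<le> hess f u s / 1"
      using norm_N(1)[of u] h0 by (intro divide_left_mono) auto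
    then have "second_form e f u s \<le> M6 * (norm s)^2" using hu[OF u s] by (simp add: second_form_N)
    then show "second_form e f u s \<le> C * (norm s)^2" using up C(4) by simp
    have "hess f u s / W \<le> hess f u s / norm (N u)"
      using norm_N(2)[of u] W[OF u] W1 h0 by (intro divide_left_mono) auto
    then have "hess f u s \<le> W * second_form e f u s" using W1 by (simp add: second_form_N field_simps)
    then have "c * (norm s)^2 \<le> W * second_form e f u s" using hl[OF u s] by linarith
    then have "(norm s)^2 \<le> (W / c) * second_form e f u s" using c by (simp add: field_simps)
    moreover have "second_form e f u s \<ge> 0" using h0 by (simp add: second_form_N)
    ultimately show "(norm s)^2 \<le> C * second_form e f u s" using up C(10) by blast
  qed
  have e5: "\<bar>1 / norm (N u) - 1 / norm (N v)\<bar> \<le> C * norm (u - v)" "\<bar>f u - f v\<bar> \<le> C * norm (u - v)"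
    "norm (grad f u) \<le> C" "norm (N u) \<le> C" if "u \<in> hcball r'" "v \<in> hcball r'" for u v
    using up[OF iW[OF that] C(5)] up[OF M4(2)[OF that] C(6)] M5(2)[OF that(1)] W[OF that(1)] C by auto
  show ?thesis
    unfolding chart_estimates_def
    by (rule exI[of _ C])
      (intro conjI ballI allI impI C(1) e1 e2 e3 e5 conjunct1[OF e4] conjunct2[OF e4], assumption+)
qed

text \<open>The compactness arguments use Euclidean balls in the whole space. Since
  \<open>pr\<close> does not increase distances, radius \<open>r / 2\<close> around \<open>p\<close>
  is enough to land in the closed ball.\<close>

lemma chart_nbhd:
  assumes K: "K \<in> K3_plus"
  obtains \<epsilon> C where "\<epsilon> > 0" "C \<ge> 1" "chart_estimates (r / 2) C"
    "\<And>x. x \<in> frontier K \<inter> ball p \<epsilon> \<Longrightarrow> pr x \<in> hcball (r / 2)"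
    "\<And>x. x \<in> frontier K \<inter> ball p \<epsilon> \<Longrightarrow> y (pr x) = x"
proof -
  obtain C where C: "chart_estimates (r / 2) C" using chart_estimates_exist[OF K] r_pos by fastforce
  then have C1: "C \<ge> 1" by (simp add: chart_estimates_def)
  obtain T where T: "open T" "U = frontier K \<inter> T" using U_open by (auto simp: openin_open)
  then obtain d where d: "d > 0" "ball p d \<subseteq> T" using p_U open_contains_ball by blast
  show ?thesis
  proof (rule that[OF _ C1 C])
    show "min d (r / 2) > 0" using d(1) r_pos by simp
    fix x assume x: "x \<in> frontier K \<inter> ball p (min d (r / 2))"
    then have "norm (pr x) \<le> r / 2"
      using norm_pr_diff[of x p] by (simp add: pr_p dist_norm norm_minus_commute)
    then show "pr x \<in> hcball (r / 2)" using nu_pr by (simp add: hcball_def)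
    show "y (pr x) = x" using x d T by (intro y_pr) auto
  qed
qed

lemma convex_hcball_line:
  assumes "u \<in> hcball r'" "v \<in> hcball r'" "0 \<le> t" "t \<le> 1"
  shows "u + t *\<^sub>R (v - u) \<in> hcball r'"
  using convexD_alt[OF convex_hcball assms] by (simp add: algebra_simps)

lemma chart_dist:
  assumes "chart_estimates r' C" "u \<in> hcball r'" "v \<in> hcball r'"
  shows "norm (y u - y v) \<le> (1 + C) * norm (u - v)"
proof -
  have "y u - y v = (u - v) - (f u - f v) *\<^sub>R \<nu>" by (simp add: y_def algebra_simps)
  then have "norm (y u - y v) \<le> norm (u - v) + \<bar>f u - f v\<bar>"
    using norm_triangle_ineq4[of "u - v" "(f u - f v) *\<^sub>R \<nu>"] by (simp add: norm_nu)
  also have "\<bar>f u - f v\<bar> \<le> C * norm (u - v)" using assms by (auto simp: chart_estimates_def)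
  finally show ?thesis by (simp add: algebra_simps)
qed

section \<open>Local estimates near a boundary point\<close>

lemma local_strong_convexity:
  assumes K: "K \<in> K3_plus"
  shows "\<exists>\<epsilon>>0. \<exists>C. \<forall>x\<in>frontier K \<inter> ball p \<epsilon>. \<forall>z\<in>frontier K \<inter> ball p \<epsilon>.
    \<forall>n. outer_unit_normal K x n \<longrightarrow> n \<bullet> (x - z) \<ge> 0 \<and> (norm (x - z))^2 \<le> C * (n \<bullet> (x - z))"
proof -
  have r2: "r / 2 < r" using r_pos by simp
  obtain \<epsilon> C where \<epsilon>: "\<epsilon> > 0" and C1: "C \<ge> 1" and C: "chart_estimates (r / 2) C"
    and pr: "\<And>x. x \<in> frontier K \<inter> ball p \<epsilon> \<Longrightarrow> pr x \<in> hcball (r / 2)"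
      "\<And>x. x \<in> frontier K \<inter> ball p \<epsilon> \<Longrightarrow> y (pr x) = x"
    using chart_nbhd[OF K] by blast
  \<comment> \<open>The factor \<open>C\<close> bounds chart distances by heights, and
    \<open>(1 + C)^2\<close> converts squared chart distances to ambient ones.\<close>
  have "n \<bullet> (x - z) \<ge> 0 \<and> (norm (x - z))^2 \<le> ((1 + C)^2 * C) * (n \<bullet> (x - z))"
    if x: "x \<in> frontier K \<inter> ball p \<epsilon>" and z: "z \<in> frontier K \<inter> ball p \<epsilon>" and n: "outer_unit_normal K x n" for x z n
  proof
    define u v where uv: "u = pr x" "v = pr z"
    have u: "u \<in> hcball (r / 2)" "y u = x" and v: "v \<in> hcball (r / 2)" "y v = z"
      using pr x z by (auto simp: uv)
    show "n \<bullet> (x - z) \<ge> 0" using n z frontier_K by (auto simp: outer_unit_normal_def inner_diff_right)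
    have h: "(norm (v - u))^2 \<le> C * (n \<bullet> (x - z))"
      using C u v n by (auto simp: chart_estimates_def)
    have "(norm (x - z))^2 \<le> ((1 + C) * norm (u - v))^2"
      using chart_dist[OF C u(1) v(1)] u v by (intro power_mono) auto
    also have "\<dots> = (1 + C)^2 * (norm (v - u))^2" by (simp add: power_mult_distrib norm_minus_commute)
    also have "\<dots> \<le> (1 + C)^2 * (C * (n \<bullet> (x - z)))" using h by (intro mult_left_mono) auto
    finally show "(norm (x - z))^2 \<le> ((1 + C)^2 * C) * (n \<bullet> (x - z))" by (simp add: mult.assoc)
  qed
  then show ?thesis using \<epsilon> by blast
qed

text \<open>Tangency recovers a velocity from its projection \<open>w\<close>, and the two norms
  agree up to the factor \<open>1 + C\<close>; the bounds on the second form at \<open>w\<close>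
  thus become bounds in terms of \<open>v\<close>.\<close>

lemma local_speed_bounds:
  assumes K: "K \<in> K3_plus"
  shows "\<exists>\<epsilon>>0. \<exists>C. \<forall>z\<in>frontier K \<inter> ball p \<epsilon>. \<forall>v q. speed_sq K z v q \<longrightarrow>
    0 \<le> q \<and> (norm v)^2 \<le> C * q \<and> q \<le> C * (norm v)^2"
proof -
  have r2: "r / 2 < r" using r_pos by simp
  obtain \<epsilon> C where \<epsilon>: "\<epsilon> > 0" and C1: "C \<ge> 1" and C: "chart_estimates (r / 2) C"
    and pr: "\<And>x. x \<in> frontier K \<inter> ball p \<epsilon> \<Longrightarrow> pr x \<in> hcball (r / 2)"
      "\<And>x. x \<in> frontier K \<inter> ball p \<epsilon> \<Longrightarrow> y (pr x) = x"
    using chart_nbhd[OF K] by blast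
  have "0 \<le> q \<and> (norm v)^2 \<le> ((1 + C)^2 * C) * q \<and> q \<le> ((1 + C)^2 * C) * (norm v)^2"
    if z: "z \<in> frontier K \<inter> ball p \<epsilon>" and q: "speed_sq K z v q" for z v q
  proof -
    define u where "u = pr z"
    have u: "u \<in> hcball (r / 2)" "y u = z" using pr z by (auto simp: u_def)
    have uB: "u \<in> B" using u(1) hcball_subset[OF r2] by blast
    define w where "w = v - (\<nu> \<bullet> v) *\<^sub>R \<nu>"
    have w: "\<nu> \<bullet> w = 0" by (simp add: w_def inner_diff_right nu_nu)
    have qw: "N u \<bullet> v = 0" "q = second_form e f u w"
      using speed_sq_chart[OF uB] q u(2) by (auto simp: w_def)
    have gC: "norm (grad f u) \<le> C" and ws: "(norm w)^2 \<le> C * q" "q \<le> C * (norm w)^2"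
      using C u(1) w qw(2) by (auto simp: chart_estimates_def)
    have "C * q \<ge> 0" using ws(1) zero_le_power2 order_trans by blast
    then have q0: "0 \<le> q" using C1 by (simp add: zero_le_mult_iff)
    have "grad f u \<bullet> v = grad f u \<bullet> w"
      using grad_nu[of u] by (simp add: w_def inner_diff_right)
    then have vw: "\<nu> \<bullet> v = - (grad f u \<bullet> w)" using qw(1) by (simp add: N_def inner_add_left)
    have "v = w + (\<nu> \<bullet> v) *\<^sub>R \<nu>" by (simp add: w_def)
    then have "v = w - (grad f u \<bullet> w) *\<^sub>R \<nu>" unfolding vw by simp
    then have "norm v \<le> norm w + \<bar>grad f u \<bullet> w\<bar>"
      using norm_triangle_ineq4[of w "(grad f u \<bullet> w) *\<^sub>R \<nu>"] by (simp add: norm_nu)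
    also have "\<bar>grad f u \<bullet> w\<bar> \<le> C * norm w"
      using Cauchy_Schwarz_ineq2[of "grad f u" w] mult_right_mono[OF gC norm_ge_zero[of w]] by linarith
    finally have "norm v \<le> (1 + C) * norm w" by (simp add: algebra_simps)
    then have "(norm v)^2 \<le> (1 + C)^2 * (norm w)^2" 
      using power_mono[of "norm v" _ 2] by (fastforce simp: power_mult_distrib)
    also have "\<dots> \<le> (1 + C)^2 * (C * q)" using ws(1) by (intro mult_left_mono) auto
    finally have 1: "(norm v)^2 \<le> ((1 + C)^2 * C) * q" by (simp add: mult.assoc)
    have "(norm w)^2 = (norm v)^2 - (\<nu> \<bullet> v)^2"
      unfolding power2_norm_eq_inner w_def
      by (simp add: inner_diff_left inner_diff_right nu_nu inner_commute[of v \<nu>] power2_eq_square)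
    then have wv: "(norm w)^2 \<le> (norm v)^2" by simp
    have "q \<le> C * (norm v)^2" using ws(2) mult_left_mono[OF wv, of C] C1 by linarith
    also have "\<dots> = 1 * (C * (norm v)^2)" by simp
    also have "\<dots> \<le> (1 + C)^2 * (C * (norm v)^2)"
      using C1 power_mono[of 1 "1 + C" 2] by (intro mult_right_mono) auto
    finally show ?thesis using q0 1 by (simp add: mult.assoc)
  qed
  then show ?thesis using \<epsilon> by blast
qed

text \<open>The discriminant argument: \<open>n\<close> supports \<open>K\<close> at \<open>y u\<close>, so the height over that hyperplane is
  nonnegative at \<open>y (z + a w)\<close> for all small \<open>a\<close>. The choice \<open>\<bar>a\<bar> = sqrt (2 \<phi> / q)\<close> is optimal.\<close>

lemma speed_estimate:
  assumes ch: "chart_estimates r' C" and r': "r' < r"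
    and u: "u \<in> hcball r'" and z: "z \<in> hcball r'" and n: "outer_unit_normal K (y u) n"
    and q: "speed_sq K (y z) v q"
    and \<phi>: "\<phi> = n \<bullet> (y u - y z)" and small: "sqrt (2 * \<phi>) \<le> 1" "norm z + C * sqrt (2 * \<phi>) \<le> r'"
  shows "\<bar>n \<bullet> v\<bar> \<le> sqrt (2 * \<phi>) * (1 + 2 * C ^ 7 * sqrt (2 * \<phi>)) * sqrt q"
proof -
  note sub = subsetD[OF hcball_subset[OF r']]
  have C1: "C \<ge> 1" using ch by (simp add: chart_estimates_def)
  define w where "w = v - (\<nu> \<bullet> v) *\<^sub>R \<nu>"
  define t where "t = sqrt (2 * \<phi>)"
  have w: "\<nu> \<bullet> w = 0" by (simp add: w_def inner_diff_right nu_nu)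
  have qw: "N z \<bullet> v = 0" "q = second_form e f z w"
    using speed_sq_chart[OF sub[OF z] q] by (auto simp: w_def)
  have ws: "(norm w)^2 \<le> C * q" using ch z w qw(2) by (auto simp: chart_estimates_def)
  have "C * q \<ge> 0" using ws zero_le_power2 order_trans by blast
  then have q0: "q \<ge> 0" using C1 by (simp add: zero_le_mult_iff)
  have phi0: "\<phi> \<ge> 0" using n y_K[OF sub[OF z]] by (simp add: \<phi> outer_unit_normal_def inner_diff_right)
  have dphi: "(norm (z - u))^2 \<le> C * \<phi>" using ch u z n by (auto simp: chart_estimates_def \<phi>)
  have gv: "grad f z \<bullet> v = grad f z \<bullet> w"
    using grad_nu[of z] by (simp add: w_def inner_diff_right)
  then have nv: "\<nu> \<bullet> v = - (grad f z \<bullet> w)" using qw(1) by (simp add: N_def inner_add_left)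
  have "v = w + (\<nu> \<bullet> v) *\<^sub>R \<nu>" by (simp add: w_def)
  then have vw: "v = w - (grad f z \<bullet> w) *\<^sub>R \<nu>" unfolding nv by simp
  show ?thesis
  \<comment> \<open>The optimal \<open>a\<close> is unusable here. If \<open>q = 0\<close> then
    \<open>v\<close> vanishes; if \<phi> = 0 then the two points coincide and \<open>v\<close> is
    orthogonal to \<open>n\<close>.\<close>
  proof (cases "q = 0 \<or> \<phi> = 0")
    case True
    have "n \<bullet> v = 0"
    proof (cases "q = 0")
      case True
      then have "w = 0" using ws by simp
      then show ?thesis using vw by simp
    next
      case False
      then have "u = z" using True dphi by simp
      then show ?thesis using normal_iff[OF sub[OF u]] n qw(1) by simp
    qed
    then show ?thesis using True phi0 q0 by auto
  next
    case False
    then have q1: "q > 0" and p1: "\<phi> > 0" using q0 phi0 by auto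
    then have t0: "t > 0" by (simp add: t_def)
    have t2: "t^2 = 2 * \<phi>" using phi0 by (simp add: t_def)
    \<comment> \<open>With this sign the linear term is
      \<open>t * (\<bar>n \<bullet> v\<bar> / sqrt q)\<close>. Since \<open>a^2 * q = t^2\<close>,
      the initial height and the quadratic term are both \<open>t^2 / 2\<close> to leading order;
      their sum \<open>t^2\<close> gives the sharp factor \<open>t\<close> after division.\<close>
    define a where "a = (if n \<bullet> v \<ge> 0 then 1 else - 1) * (t / sqrt q)"
    have l2: "a^2 * q = t^2" using q1 by (simp add: a_def power_mult_distrib power_divide)
    have lb: "a * (n \<bullet> v) = t * (\<bar>n \<bullet> v\<bar> / sqrt q)" by (simp add: a_def)
    have "(norm (a *\<^sub>R w))^2 \<le> C * t^2"
    proof -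
      have "(norm (a *\<^sub>R w))^2 = a^2 * (norm w)^2" by (simp add: power_mult_distrib)
      also have "\<dots> \<le> a^2 * (C * q)" using ws by (intro mult_left_mono) auto
      also have "\<dots> = C * (a^2 * q)" by simp
      finally show ?thesis unfolding l2 .
    qed
    also have "\<dots> \<le> C^2 * t^2" using C1 by (intro mult_right_mono) (auto simp: power2_eq_square)
    finally have "(norm (a *\<^sub>R w))^2 \<le> (C * t)^2" by (simp add: power_mult_distrib)
    then have lw: "norm (a *\<^sub>R w) \<le> C * t" by (rule power2_le_imp_le) (use C1 t0 in simp)
    have z': "z + a *\<^sub>R w \<in> hcball r'"
      using z w small(2) lw norm_triangle_ineq[of z "a *\<^sub>R w"] by (simp add: hcball_def inner_add_right t_def)
    define nz where "nz = (1 / norm (N z)) *\<^sub>R N z"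
    have nz: "outer_unit_normal K (y z) nz" using normal_iff[OF sub[OF z]] nz_def by simp
    define R where "R = f (z + a *\<^sub>R w) - f z - grad f z \<bullet> (a *\<^sub>R w)"
    have hR: "nz \<bullet> (y z - y (z + a *\<^sub>R w)) = R / norm (N z)"
      using height[OF sub sub nz, OF z z'] by (simp add: R_def)
    \<comment> \<open>By tangency the first-order part of the displacement is exactly
      \<open>a *\<^sub>R v\<close>; the rest \<open>R\<close> is of second order and points along
      \<nu>.\<close>
    have yl: "y z - y (z + a *\<^sub>R w) = R *\<^sub>R \<nu> - a *\<^sub>R v"
      by (subst vw) (simp add: y_def R_def algebra_simps)
    have Rn: "R / norm (N z) \<ge> 0"
      using nz y_K[OF sub[OF z']] hR by (auto simp: outer_unit_normal_def inner_diff_right)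
    have "\<bar>2 * (R / norm (N z)) - a^2 * q\<bar> \<le> C * norm (a *\<^sub>R w) ^ 3"
      using ch z z' nz hR qw(2) by (fastforce simp: chart_estimates_def second_form_N hess_scaleR)
    also have "\<dots> \<le> C * (C * t) ^ 3" using lw C1 by (intro mult_left_mono power_mono) auto
    also have "\<dots> = C ^ 4 * t ^ 3" by (simp add: power_mult_distrib eval_nat_numeral)
    finally have R2: "2 * (R / norm (N z)) \<le> t^2 + C ^ 4 * t ^ 3"
      unfolding l2 by linarith
    have nnu: "n \<bullet> \<nu> = 1 / norm (N u)"
      using normal_iff[OF sub[OF u]] n grad_nu[of u] by (simp add: N_def inner_add_left nu_nu)
    have "(norm (z - u))^2 \<le> (C * t)^2"
    proof -
      have "C * \<phi> \<le> C^2 * (2 * \<phi>)" using C1 phi0 by (intro mult_mono) (auto simp: power2_eq_square)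
      then show ?thesis using dphi t2 by (simp add: power_mult_distrib)
    qed
    then have du: "norm (u - z) \<le> C * t" using C1 t0 by (metis norm_minus_commute power2_le_imp_le mult_nonneg_nonneg less_imp_le order_trans zero_le_one)
    \<comment> \<open>\<open>R\<close> is controlled through the hyperplane at \<open>y z\<close>,
      with divisor \<open>norm (N z)\<close>, but it contributes \<open>R / norm (N u)\<close> to
      the height over the hyperplane at \<open>y u\<close>. The ratio of the divisors is
      \<open>1 + O(t)\<close>, because \<open>u\<close> and \<open>z\<close> are at distance
      \<open>O(t)\<close>.\<close>
    have "1 / norm (N u) \<le> 1 / norm (N z) + C * norm (u - z)"
      using ch u z by (fastforce simp: chart_estimates_def)
    then have "norm (N z) * (1 / norm (N u)) \<le> norm (N z) * (1 / norm (N z) + C * norm (u - z))"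
      by (intro mult_left_mono) auto
    also have "\<dots> = 1 + norm (N z) * (C * norm (u - z))" using norm_N(2)[of z] by (simp add: algebra_simps)
    also have "\<dots> \<le> 1 + C * (C * (C * t))"
      using ch z du C1 by (intro add_left_mono mult_mono) (auto simp: chart_estimates_def)
    finally have ratio: "norm (N z) / norm (N u) \<le> 1 + C ^ 3 * t" by (simp add: power3_eq_cube mult.assoc)
    have "0 \<le> n \<bullet> (y u - y (z + a *\<^sub>R w))"
      using n y_K[OF sub[OF z']] by (simp add: outer_unit_normal_def inner_diff_right)
    also have "\<dots> = \<phi> + n \<bullet> (y z - y (z + a *\<^sub>R w))" by (simp add: \<phi> inner_diff_right)
    also have "\<dots> = \<phi> + R / norm (N u) - a * (n \<bullet> v)" unfolding yl by (simp add: inner_diff_right nnu)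
    finally have "a * (n \<bullet> v) \<le> \<phi> + (R / norm (N z)) * (norm (N z) / norm (N u))"
      using norm_N(2)[of z] by simp
    also have "\<dots> \<le> \<phi> + ((t^2 + C ^ 4 * t ^ 3) / 2) * (1 + C ^ 3 * t)"
    proof -
      have "x \<le> b / 2" if "2 * x \<le> b" for x b :: real using that by linarith
      from this[OF R2] show ?thesis using Rn ratio t0 C1 by (intro add_left_mono mult_mono) auto
    qed
    also have "\<dots> = t * (t + (C ^ 4 * t^2 + C ^ 3 * t^2 + C ^ 7 * t ^ 3) / 2)"
    proof -
      have "\<phi> = t^2 / 2" using t2 by simp
      then show ?thesis by (simp add: field_simps eval_nat_numeral)
    qed
    finally have "t * (\<bar>n \<bullet> v\<bar> / sqrt q) \<le> t * (t + (C ^ 4 * t^2 + C ^ 3 * t^2 + C ^ 7 * t ^ 3) / 2)"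
      unfolding lb .
    then have "\<bar>n \<bullet> v\<bar> / sqrt q \<le> t + (C ^ 4 * t^2 + C ^ 3 * t^2 + C ^ 7 * t ^ 3) / 2"
      by (rule mult_left_le_imp_le) (rule t0)
    \<comment> \<open>Since \<open>C \<ge> 1\<close> and \<open>t \<le> 1\<close>, each of the three
      error terms is at most \<open>C ^ 7 * t^2\<close>.\<close>
    also have "\<dots> \<le> t * (1 + 2 * C ^ 7 * t)"
    proof -
      have p: "C ^ 4 \<le> C ^ 7" "C ^ 3 \<le> C ^ 7" using C1 by (auto intro: power_increasing)
      have "t \<le> 1" using small(1) unfolding t_def .
      then have "t ^ 3 \<le> t^2" using t0 by (intro power_decreasing) auto
      then have "C ^ 7 * t ^ 3 \<le> C ^ 7 * t^2" using C1 by (intro mult_left_mono) auto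
      moreover have "C ^ 4 * t^2 \<le> C ^ 7 * t^2" "C ^ 3 * t^2 \<le> C ^ 7 * t^2"
        using p by (auto intro: mult_right_mono)
      moreover have "0 \<le> C ^ 7 * t^2" using C1 by simp
      moreover have "(a + b + c) / 2 \<le> 2 * d" if "c \<le> d" "a \<le> d" "b \<le> d" "0 \<le> d" for a b c d :: real
        using that by simp
      ultimately have "(C ^ 4 * t^2 + C ^ 3 * t^2 + C ^ 7 * t ^ 3) / 2 \<le> 2 * (C ^ 7 * t^2)" by blast
      then show ?thesis by (simp add: power2_eq_square algebra_simps)
    qed
    finally show ?thesis using q1 by (simp add: t_def field_simps)
  qed
qed

lemma local_speed_estimate:
  assumes K: "K \<in> K3_plus"
  shows "\<exists>\<epsilon>>0. \<exists>C. \<forall>x\<in>frontier K \<inter> ball p \<epsilon>. \<forall>z\<in>frontier K \<inter> ball p \<epsilon>.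
    \<forall>n v q. outer_unit_normal K x n \<longrightarrow> speed_sq K z v q \<longrightarrow>
      \<bar>n \<bullet> v\<bar> \<le> sqrt (2 * (n \<bullet> (x - z))) * (1 + C * sqrt (2 * (n \<bullet> (x - z)))) * sqrt q"
proof -
  have r2: "r / 2 < r" using r_pos by simp
  obtain \<epsilon> C where \<epsilon>: "\<epsilon> > 0" and C1: "C \<ge> 1" and C: "chart_estimates (r / 2) C"
    and pr: "\<And>x. x \<in> frontier K \<inter> ball p \<epsilon> \<Longrightarrow> pr x \<in> hcball (r / 2)"
      "\<And>x. x \<in> frontier K \<inter> ball p \<epsilon> \<Longrightarrow> y (pr x) = x"
    using chart_nbhd[OF K] by blast
  \<comment> \<open>Within radius \<open>s^2\<close> of \<open>p\<close> the height is at most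
    \<open>2 * s^2\<close>, so its root in \<open>speed_estimate\<close> is at most
    \<open>2 * s\<close>, while \<open>norm (pr z) \<le> s\<close>. The two smallness conditions
    there become \<open>2 * s \<le> 1\<close> and
    \<open>s * (1 + 2 * C) \<le> r / 2\<close>.\<close>
  define s where "s = min (1 / 2) ((r / 2) / (1 + 2 * C))"
  have s: "s > 0" "2 * s \<le> 1" "s * (1 + 2 * C) \<le> r / 2"
  proof -
    show "s > 0" "2 * s \<le> 1" using r_pos C1 by (auto simp: s_def)
    have "s \<le> (r / 2) / (1 + 2 * C)" by (simp add: s_def)
    then show "s * (1 + 2 * C) \<le> r / 2" by (subst (asm) pos_le_divide_eq) (use C1 in auto)
  qed
  define \<delta> where "\<delta> = min \<epsilon> (s^2)"
  have "\<delta> > 0" using \<epsilon> s(1) by (simp add: \<delta>_def)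
  moreover have "\<bar>n \<bullet> v\<bar> \<le> sqrt (2 * (n \<bullet> (x - z))) * (1 + (2 * C ^ 7) * sqrt (2 * (n \<bullet> (x - z)))) * sqrt q"
    if x: "x \<in> frontier K \<inter> ball p \<delta>" and z: "z \<in> frontier K \<inter> ball p \<delta>"
      and n: "outer_unit_normal K x n" and q: "speed_sq K z v q" for x z n v q
  proof -
    have x': "x \<in> frontier K \<inter> ball p \<epsilon>" and z': "z \<in> frontier K \<inter> ball p \<epsilon>" using x z by (auto simp: \<delta>_def)
    have u: "pr x \<in> hcball (r / 2)" "y (pr x) = x" and v: "pr z \<in> hcball (r / 2)" "y (pr z) = z"
      using pr x' z' by auto
    have "n \<bullet> (x - z) \<le> norm (x - z)"
      using Cauchy_Schwarz_ineq2[of n "x - z"] n by (auto simp: outer_unit_normal_def)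
    also have "\<dots> \<le> dist p x + dist p z" using dist_triangle2[of x z p] by (simp add: dist_norm norm_minus_commute)
    also have "\<dots> \<le> 2 * s^2" using x z by (auto simp: \<delta>_def)
    finally have "2 * (n \<bullet> (x - z)) \<le> (2 * s)^2" by (simp add: power2_eq_square)
    then have t: "sqrt (2 * (n \<bullet> (x - z))) \<le> 2 * s" using s(1) by (intro real_le_lsqrt) auto
    have "norm (pr z) \<le> s^2"
      using norm_pr_diff[of z p] z by (auto simp: pr_p dist_norm norm_minus_commute \<delta>_def)
    also have "\<dots> \<le> s" using s(1,2) by (simp add: power2_eq_square mult_left_le)
    finally have "norm (pr z) + C * sqrt (2 * (n \<bullet> (x - z))) \<le> s + C * (2 * s)"
      using t C1 by (intro add_mono mult_left_mono) auto
    also have "\<dots> \<le> r / 2" using s(3) by (simp add: algebra_simps)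
    finally have b: "norm (pr z) + C * sqrt (2 * (n \<bullet> (x - z))) \<le> r / 2" .
    have t1: "sqrt (2 * (n \<bullet> (x - z))) \<le> 1" using t s(2) by linarith
    show ?thesis
      using speed_estimate[OF C r2 u(1) v(1), of n, unfolded u(2) v(2), OF n q refl t1 b] .
  qed
  ultimately show ?thesis by blast
qed

section \<open>Curves inside a chart\<close>

lemma is_chart: "graph_chart K p \<nu> e U"
  unfolding graph_chart_def using normal_p basis U_open p_U r_pos homeo smooth by (auto simp: m_def)

text \<open>The parametrisation \<open>s\<close> of the lifted segment stays free: the identity is
  used to measure length, a cubic with vanishing derivative at both ends to build curves that can be
  concatenated.\<close>

lemma chart_curve:
  fixes s s' :: "real \<Rightarrow> real"
  assumes ch: "chart_estimates r' C" and r': "r' < r" and u: "u \<in> hcball r'" and v: "v \<in> hcball r'"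
    and s: "\<And>t. (s has_real_derivative s' t) (at t)" and s': "continuous_on UNIV s'"
    and s01: "\<And>t. t \<in> {0..1} \<Longrightarrow> s t \<in> {0..1}"
  defines "k \<equiv> \<lambda>t. y (u + s t *\<^sub>R (v - u))"
    and "D \<equiv> \<lambda>t. s' t *\<^sub>R ((v - u) - (grad f (u + s t *\<^sub>R (v - u)) \<bullet> (v - u)) *\<^sub>R \<nu>)"
  shows "\<And>t. t \<in> {0..1} \<Longrightarrow> u + s t *\<^sub>R (v - u) \<in> hcball r'"
    "\<And>t. t \<in> {0..1} \<Longrightarrow> (k has_vector_derivative D t) (at t)"
    "continuous_on {0..1} D" "k ` {0..1} \<subseteq> U"
    "\<And>t. t \<in> {0..1} \<Longrightarrow> norm (D t) \<le> \<bar>s' t\<bar> * ((1 + C) * norm (v - u))"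
proof -
  let ?d = "v - u"
  note sub = subsetD[OF hcball_subset[OF r']]
  have d: "\<nu> \<bullet> ?d = 0" using u v by (simp add: hcball_def inner_diff_right)
  show in_ball: "u + s t *\<^sub>R ?d \<in> hcball r'" if "t \<in> {0..1}" for t
    using convex_hcball_line[OF u v] s01[OF that] by simp
  show "(k has_vector_derivative D t) (at t)" if "t \<in> {0..1}" for t
  proof -
    have "((\<lambda>t. y (u + t *\<^sub>R ?d)) \<circ> s has_vector_derivative
        s' t *\<^sub>R (?d - (grad f (u + s t *\<^sub>R ?d) \<bullet> ?d) *\<^sub>R \<nu>)) (at t)"
      by (intro vector_diff_chain_at y_line_derivative sub in_ball that d)
        (use s in \<open>simp add: has_real_derivative_iff_has_vector_derivative\<close>)
    then show ?thesis by (simp add: k_def D_def o_def)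
  qed
  have sc: "continuous_on {0..1} s"
    by (rule DERIV_continuous_on) (rule has_field_derivative_at_within[OF s])
  show "continuous_on {0..1} D"
    unfolding D_def
    by (intro continuous_intros continuous_on_subset[OF s'] sc continuous_on_compose2[OF continuous_on_grad])
      (use in_ball sub in auto)
  show "k ` {0..1} \<subseteq> U" unfolding k_def using in_ball sub y_U(1) by blast
  show "norm (D t) \<le> \<bar>s' t\<bar> * ((1 + C) * norm ?d)" if t: "t \<in> {0..1}" for t
  proof -
    let ?g = "grad f (u + s t *\<^sub>R ?d)"
    have g: "norm ?g \<le> C" using ch in_ball[OF t] by (auto simp: chart_estimates_def)
    have "norm (?d - (?g \<bullet> ?d) *\<^sub>R \<nu>) \<le> norm ?d + \<bar>?g \<bullet> ?d\<bar>"
      using norm_triangle_ineq4[of ?d "(?g \<bullet> ?d) *\<^sub>R \<nu>"] by (simp add: norm_nu)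
    also have "\<bar>?g \<bullet> ?d\<bar> \<le> C * norm ?d"
      using Cauchy_Schwarz_ineq2[of ?g ?d] mult_right_mono[OF g norm_ge_zero[of ?d]] by linarith
    finally show ?thesis unfolding D_def norm_scaleR by (intro mult_left_mono) (auto simp: algebra_simps)
  qed
qed

text \<open>In the chart the segment has constant velocity \<open>d\<close>, so its squared length
  is at most the maximum of the second form at \<open>d\<close> along it. The normal is taken at the
  end point \<open>y v\<close>, matching the direction from a point of P to \<open>x\<close> in the
  application.\<close>

lemma segment_length:
  assumes ch: "chart_estimates r' C" and r': "r' < r" and u: "u \<in> hcball r'" and v: "v \<in> hcball r'"
    and n: "outer_unit_normal K (y v) n" and \<phi>: "\<phi> = n \<bullet> (y v - y u)"
  shows "\<exists>L. boundary_curve_length K (y u) (y v) L \<and> L^2 \<le> 2 * \<phi> + 2 * C ^ 3 * (\<phi> * sqrt \<phi>)"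
proof -
  define d where "d = v - u"
  define k where "k t = y (u + t *\<^sub>R d)" for t :: real
  note sub = subsetD[OF hcball_subset[OF r']]
  have C1: "C \<ge> 1" using ch by (simp add: chart_estimates_def)
  have d: "\<nu> \<bullet> d = 0" using u v by (simp add: d_def hcball_def inner_diff_right)
  have idD: "((\<lambda>t. t) has_real_derivative 1) (at t)" for t :: real by (rule DERIV_ident)
  note cc = chart_curve[OF ch r' u v idD continuous_on_const, simplified, folded d_def k_def]
  have in_ball: "u + t *\<^sub>R d \<in> hcball r'" if "t \<in> {0..1}" for t using cc(1) that by simp
  have prk: "pr (k t) = u + t *\<^sub>R d" for t
    using u d by (simp add: k_def pr_y hcball_def inner_add_right)
  have line: "((\<lambda>\<sigma>::real. u + \<sigma> *\<^sub>R d) has_vector_derivative d) (at t)" for t :: real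
    by (auto intro!: derivative_eq_intros)
  have vd: "vector_derivative (\<lambda>\<sigma>::real. pr (k \<sigma>)) (at t) = d" for t :: real
    unfolding prk by (rule vector_derivative_at[OF line])
  define g where "g t = sqrt (second_form e f (u + t *\<^sub>R d) d)" for t
  define L where "L = integral {0..1} g"
  have kU: "k ` {0..1} \<subseteq> U" using cc(4) by (simp add: k_def[abs_def])
  have "piece_length K k 0 1 L"
    unfolding piece_length_def using is_chart kU
    by (intro exI[of _ p] exI[of _ \<nu>] exI[of _ e] exI[of _ U]) (simp add: vd prk L_def g_def[abs_def])
  then have cl: "curve_length K k L"
    unfolding curve_length_def
    by (intro exI[of _ 1] exI[of _ "\<lambda>i. real i"] exI[of _ "\<lambda>_. L"]) simp
  have cg: "continuous_on {0..1} g"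
  proof -
    have c: "continuous_on {0..1} (\<lambda>t::real. (u + t *\<^sub>R d, d))" by (intro continuous_intros)
    have "(\<lambda>t::real. (u + t *\<^sub>R d, d)) ` {0..1} \<subseteq> B \<times> UNIV" using in_ball sub by auto
    from continuous_on_compose2[OF continuous_on_hess[OF C2_f] c this]
    have h: "continuous_on {0..1} (\<lambda>t. hess f (u + t *\<^sub>R d) d)" by simp
    have n: "continuous_on {0..1} (\<lambda>t. norm (N (u + t *\<^sub>R d)))"
      by (intro continuous_intros continuous_on_compose2[OF continuous_on_N]) (use in_ball sub in auto)
    show ?thesis
      unfolding g_def second_form_N
      by (intro continuous_on_real_sqrt continuous_on_divide h n) (use norm_N(2) in auto)
  qed
  \<comment> \<open>One error \<open>C * norm d ^ 3\<close> comes from comparing the height with the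
    second form at \<open>v\<close>, the other from the variation of the second form along the
    segment.\<close>
  define A where "A = 2 * \<phi> + 2 * C * norm d ^ 3"
  have qA: "0 \<le> second_form e f (u + t *\<^sub>R d) d \<and> second_form e f (u + t *\<^sub>R d) d \<le> A" if t: "t \<in> {0..1}" for t
  proof
    have "(norm d)^2 \<le> C * second_form e f (u + t *\<^sub>R d) d"
      using ch in_ball[OF t] d by (auto simp: chart_estimates_def)
    then have "0 \<le> C * second_form e f (u + t *\<^sub>R d) d" using zero_le_power2 order_trans by blast
    then show "0 \<le> second_form e f (u + t *\<^sub>R d) d" using C1 by (simp add: zero_le_mult_iff)
    have vt: "v - (u + t *\<^sub>R d) = (1 - t) *\<^sub>R d" by (simp add: d_def algebra_simps)
    have "\<bar>second_form e f v d - second_form e f (u + t *\<^sub>R d) d\<bar> \<le> C * norm (v - (u + t *\<^sub>R d)) * (norm d)^2"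
      using ch in_ball[OF t] v d by (auto simp: chart_estimates_def)
    also have "\<dots> \<le> C * norm d * (norm d)^2"
      unfolding vt using t C1 by (intro mult_right_mono mult_left_mono) (auto intro: mult_left_le_one_le)
    finally have 1: "\<bar>second_form e f v d - second_form e f (u + t *\<^sub>R d) d\<bar> \<le> C * norm d ^ 3"
      by (simp add: power2_eq_square power3_eq_cube mult.assoc)
    have "\<bar>2 * \<phi> - second_form e f v (u - v)\<bar> \<le> C * norm (u - v) ^ 3"
      unfolding \<phi> using ch u v n by (auto simp: chart_estimates_def)
    moreover have "second_form e f v (u - v) = second_form e f v d"
      using hess_scaleR[of f v "- 1" d] by (simp add: second_form_N d_def)
    ultimately have "\<bar>2 * \<phi> - second_form e f v d\<bar> \<le> C * norm d ^ 3"
      by (simp add: d_def norm_minus_commute)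
    then show "second_form e f (u + t *\<^sub>R d) d \<le> A" using 1 by (simp add: A_def)
  qed
  have A0: "A \<ge> 0" using qA[of 0] by auto
  have L0: "0 \<le> L"
    unfolding L_def by (intro integral_nonneg integrable_continuous_real cg) (use qA in \<open>auto simp: g_def\<close>)
  have "L \<le> integral {0..1} (\<lambda>t::real. sqrt A)"
    unfolding L_def by (intro integral_le integrable_continuous_real cg) (use qA in \<open>auto simp: g_def\<close>)
  then have "L \<le> sqrt A" by simp
  then have "L^2 \<le> (sqrt A)^2" using L0 by (intro power_mono)
  then have LA: "L^2 \<le> A" using A0 by simp
  have dphi: "(norm d)^2 \<le> C * \<phi>"
  proof -
    have "(norm (u - v))^2 \<le> C * \<phi>"
      unfolding \<phi> using ch u v n by (auto simp: chart_estimates_def)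
    then show ?thesis by (simp only: d_def norm_minus_commute[of v u])
  qed
  then have "0 \<le> C * \<phi>" using zero_le_power2 order_trans by blast
  then have p0: "\<phi> \<ge> 0" using C1 by (simp add: zero_le_mult_iff)
  have "C * \<phi> \<le> C^2 * \<phi>" using C1 p0 by (intro mult_right_mono) (auto simp: power2_eq_square)
  then have "(norm d)^2 \<le> (C * sqrt \<phi>)^2" using dphi p0 by (simp add: power_mult_distrib)
  then have nd: "norm d \<le> C * sqrt \<phi>" by (rule power2_le_imp_le) (use C1 p0 in simp)
  \<comment> \<open>Because \<open>norm d\<close> is of order \<open>sqrt \<phi>\<close>, the cubic
    error becomes a multiple of \<open>\<phi> * sqrt \<phi>\<close>.\<close>
  have "norm d * (norm d)^2 \<le> (C * sqrt \<phi>) * (C * \<phi>)"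
    by (rule mult_mono[OF nd dphi]) (use C1 p0 in simp_all)
  then have "norm d ^ 3 \<le> C^2 * (\<phi> * sqrt \<phi>)"
    by (simp add: power2_eq_square power3_eq_cube algebra_simps)
  then have "C * norm d ^ 3 \<le> C * (C^2 * (\<phi> * sqrt \<phi>))" using C1 by (intro mult_left_mono) auto
  then have "A \<le> 2 * \<phi> + 2 * C ^ 3 * (\<phi> * sqrt \<phi>)"
    by (simp add: A_def power2_eq_square power3_eq_cube mult.assoc)
  then have fin: "L^2 \<le> 2 * \<phi> + 2 * C ^ 3 * (\<phi> * sqrt \<phi>)" using LA by linarith
  have "k C1_differentiable_on {0..1}"
    unfolding C1_differentiable_on_def k_def[abs_def]
    using cc(2,3) by (intro exI[of _ "\<lambda>t. d - (grad f (u + t *\<^sub>R d) \<bullet> d) *\<^sub>R \<nu>"]) auto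
  moreover have "path_image k \<subseteq> frontier K" using kU U_frontier by (auto simp: path_image_def)
  moreover have "pathstart k = y u" "pathfinish k = y v" by (simp_all add: pathstart_def pathfinish_def k_def d_def)
  ultimately show ?thesis using cl fin unfolding boundary_curve_length_def by blast
qed

lemma local_segment:
  assumes K: "K \<in> K3_plus"
  shows "\<exists>\<epsilon>>0. \<exists>C. \<forall>x\<in>frontier K \<inter> ball p \<epsilon>. \<forall>z\<in>frontier K \<inter> ball p \<epsilon>.
    \<forall>n. outer_unit_normal K x n \<longrightarrow> (\<exists>L. boundary_curve_length K z x L \<and>
      L^2 \<le> 2 * (n \<bullet> (x - z)) + C * ((n \<bullet> (x - z)) * sqrt (n \<bullet> (x - z))))"
proof -
  have r2: "r / 2 < r" using r_pos by simp
  obtain \<epsilon> C where \<epsilon>: "\<epsilon> > 0" and C1: "C \<ge> 1" and C: "chart_estimates (r / 2) C"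
    and pr: "\<And>x. x \<in> frontier K \<inter> ball p \<epsilon> \<Longrightarrow> pr x \<in> hcball (r / 2)"
      "\<And>x. x \<in> frontier K \<inter> ball p \<epsilon> \<Longrightarrow> y (pr x) = x"
    using chart_nbhd[OF K] by blast
  have "\<exists>L. boundary_curve_length K z x L \<and> L^2 \<le> 2 * (n \<bullet> (x - z)) + 2 * C ^ 3 * ((n \<bullet> (x - z)) * sqrt (n \<bullet> (x - z)))"
    if x: "x \<in> frontier K \<inter> ball p \<epsilon>" and z: "z \<in> frontier K \<inter> ball p \<epsilon>" and n: "outer_unit_normal K x n" for x z n
  proof -
    have u: "pr x \<in> hcball (r / 2)" "y (pr x) = x" and v: "pr z \<in> hcball (r / 2)" "y (pr z) = z"
      using pr x z by auto
    show ?thesis using segment_length[OF C r2 v(1) u(1), unfolded u(2) v(2), OF n refl] .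
  qed
  then show ?thesis using \<epsilon> by blast
qed

end

text \<open>Curves that start and end with zero velocity can be concatenated without losing continuous
  differentiability.\<close>

definition rest_curve :: "'a::euclidean_space set \<Rightarrow> 'a \<Rightarrow> 'a \<Rightarrow> real \<Rightarrow> bool" where
  "rest_curve K x z M \<longleftrightarrow> (\<exists>k D. (\<forall>t\<in>{0..1}. (k has_vector_derivative D t) (at t)) \<and> continuous_on {0..1} D \<and>
     k ` {0..1} \<subseteq> frontier K \<and> k 0 = x \<and> k 1 = z \<and> D 0 = 0 \<and> D 1 = 0 \<and> (\<forall>t\<in>{0..1}. norm (D t) \<le> M))"

context graph_patch
begin

lemma local_rest_curve:
  assumes K: "K \<in> K3_plus"
  shows "\<exists>\<epsilon>>0. \<exists>C. \<forall>x\<in>frontier K \<inter> ball p \<epsilon>. \<forall>z\<in>frontier K \<inter> ball p \<epsilon>. rest_curve K x z C"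
proof -
  have r2: "r / 2 < r" using r_pos by simp
  obtain \<epsilon> C where \<epsilon>: "\<epsilon> > 0" and C1: "C \<ge> 1" and C: "chart_estimates (r / 2) C"
    and pr: "\<And>x. x \<in> frontier K \<inter> ball p \<epsilon> \<Longrightarrow> pr x \<in> hcball (r / 2)"
      "\<And>x. x \<in> frontier K \<inter> ball p \<epsilon> \<Longrightarrow> y (pr x) = x"
    using chart_nbhd[OF K] by blast
  \<comment> \<open>The cubic that runs from 0 to 1 on the unit interval with derivative 0 at both
    ends, so that the lifted curve starts and ends at rest.\<close>
  define s :: "real \<Rightarrow> real" where "s t = 3 * t^2 - 2 * t ^ 3" for t
  define s' :: "real \<Rightarrow> real" where "s' t = 6 * t - 6 * t^2" for t
  have s: "(s has_real_derivative s' t) (at t)" for t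
    unfolding s_def[abs_def] s'_def by (auto intro!: derivative_eq_intros simp: power2_eq_square)
  have s'c: "continuous_on UNIV s'" unfolding s'_def[abs_def] by (intro continuous_intros)
  have s01: "s t \<in> {0..1}" if "t \<in> {0..1}" for t
  proof -
    have "s t = t^2 * (3 - 2 * t)" "1 - s t = (1 - t)^2 * (1 + 2 * t)"
      by (simp_all add: s_def power2_eq_square power3_eq_cube algebra_simps)
    moreover have "t^2 * (3 - 2 * t) \<ge> 0" "(1 - t)^2 * (1 + 2 * t) \<ge> 0" using that by auto
    ultimately show ?thesis by auto
  qed
  have s'b: "\<bar>s' t\<bar> \<le> 2" if "t \<in> {0..1}" for t
  proof -
    have "s' t = 6 * (t * (1 - t))" "s' t = 3 / 2 - 6 * (t - 1 / 2)^2"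
      by (simp_all add: s'_def power2_eq_square algebra_simps)
    moreover have "t * (1 - t) \<ge> 0" "6 * (t - 1 / 2)^2 \<ge> 0" using that by auto
    ultimately show ?thesis by linarith
  qed
  have "rest_curve K x z (2 * ((1 + C) * r))"
    if x: "x \<in> frontier K \<inter> ball p \<epsilon>" and z: "z \<in> frontier K \<inter> ball p \<epsilon>" for x z
  proof -
    have u: "pr x \<in> hcball (r / 2)" "y (pr x) = x" and v: "pr z \<in> hcball (r / 2)" "y (pr z) = z"
      using pr x z by auto
    let ?d = "pr z - pr x"
    define k where "k = (\<lambda>t. y (pr x + s t *\<^sub>R ?d))"
    define D where "D = (\<lambda>t. s' t *\<^sub>R (?d - (grad f (pr x + s t *\<^sub>R ?d) \<bullet> ?d) *\<^sub>R \<nu>))"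
    note cc = chart_curve[OF C r2 u(1) v(1) s s'c s01]
    have "norm ?d \<le> norm (pr z) + norm (pr x)" by (rule norm_triangle_ineq4)
    also have "\<dots> \<le> r" using u(1) v(1) by (simp add: hcball_def)
    finally have dr: "\<bar>s' t\<bar> * ((1 + C) * norm ?d) \<le> 2 * ((1 + C) * r)" if "t \<in> {0..1}" for t
      using s'b[OF that] C1 by (intro mult_mono) auto
    have "\<forall>t\<in>{0..1}. norm (D t) \<le> 2 * ((1 + C) * r)"
      unfolding D_def by (intro ballI order_trans[OF cc(5) dr])
    moreover have "\<forall>t\<in>{0..1}. (k has_vector_derivative D t) (at t)"
      unfolding D_def k_def by (intro ballI cc(2))
    moreover have "continuous_on {0..1} D" unfolding D_def by (rule cc(3))
    moreover have "k ` {0..1} \<subseteq> frontier K"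
      using cc(4) U_frontier unfolding k_def by (rule order_trans)
    moreover have "k 0 = x" "k 1 = z" "D 0 = 0" "D 1 = 0"
      using u(2) v(2) by (simp_all add: k_def D_def s_def s'_def)
    ultimately show ?thesis unfolding rest_curve_def by blast
  qed
  then show ?thesis using \<epsilon> by blast
qed

end

section \<open>Global estimates\<close>

lemma contact_in_frontier:
  assumes n: "outer_unit_normal K x n" and w: "w \<in> K" "n \<bullet> w = n \<bullet> x"
  shows "w \<in> frontier K"
proof (rule ccontr)
  assume "w \<notin> frontier K"
  then have "w \<in> interior K" using w(1) closure_subset by (auto simp: frontier_def)
  then obtain e where e: "e > 0" "cball w e \<subseteq> K" by (meson mem_interior_cball)
  have nn: "norm n = 1" using n by (simp add: outer_unit_normal_def)
  have "w + e *\<^sub>R n \<in> cball w e" using e(1) nn by (simp add: dist_norm)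
  then have "n \<bullet> (w + e *\<^sub>R n) \<le> n \<bullet> x" using e(2) n by (auto simp: outer_unit_normal_def)
  then show False using e(1) nn w(2) by (simp add: inner_add_right dot_square_norm)
qed

lemma rest_curve_mono: "rest_curve K x z C \<Longrightarrow> C \<le> C' \<Longrightarrow> rest_curve K x z C'"
  unfolding rest_curve_def by (elim exE, intro exI) (auto intro: order_trans)

locale k3_plus =
  fixes K :: "'a::euclidean_space set"
  assumes K: "K \<in> K3_plus" and dim: "DIM('a) \<ge> 2"
begin

lemma cpt: "compact K" and cvx: "convex K" and int: "interior K \<noteq> {}"
  using K by (auto simp: K3_plus_def)

lemma closed_K: "closed K"
  using cpt by (rule compact_imp_closed)

lemma frontier_K: "frontier K \<subseteq> K"
  using closed_K by (rule frontier_subset_closed)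

lemma compact_frontier: "compact (frontier K)"
  using cpt by (rule compact_frontier)

lemma normal_nonneg: "outer_unit_normal K x n \<Longrightarrow> z \<in> K \<Longrightarrow> 0 \<le> n \<bullet> (x - z)"
  by (simp add: outer_unit_normal_def inner_diff_right)

lemma normal_exists:
  assumes "x \<in> frontier K"
  obtains n where "outer_unit_normal K x n"
  using exists_outer_unit_normal[OF cvx closed_K int assms] .

section \<open>Uniform versions of the local estimates\<close>

lemma patch_at:
  assumes "p \<in> frontier K"
  obtains \<nu> e U r where "graph_patch \<nu> e (DIM('a) - 1) K p U r"
proof -
  obtain \<nu> e U where "graph_chart K p \<nu> e U" using K assms unfolding K3_plus_def by blast
  then obtain r where "graph_patch \<nu> e (DIM('a) - 1) K p U r" by (rule graph_chart_patch[OF cpt cvx int])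
  then show ?thesis by (rule that)
qed

text \<open>Close pairs are covered by the local estimate. For distant pairs the height has a
  positive minimum by compactness: height 0 would put a whole segment into the boundary, and a point
  of it close to \<open>x\<close> contradicts the local estimate.\<close>

lemma strong_convexity:
  obtains C where "C > 0"
    "\<And>x z n. x \<in> frontier K \<Longrightarrow> z \<in> frontier K \<Longrightarrow> outer_unit_normal K x n \<Longrightarrow>
      (norm (x - z))^2 \<le> C * (n \<bullet> (x - z))"
proof -
  \<comment> \<open>Nonnegativity of the height is carried along so that the estimate survives an
    enlargement of the constant.\<close>
  have "\<exists>l>0. \<exists>C. \<forall>x\<in>frontier K. \<forall>z\<in>frontier K. dist x z < l \<longrightarrow>
      (\<forall>n. outer_unit_normal K x n \<longrightarrow> n \<bullet> (x - z) \<ge> 0 \<and> (norm (x - z))^2 \<le> C * (n \<bullet> (x - z)))"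
  proof (rule compact_uniform_pairs[OF compact_frontier])
    fix C C' :: real and x z assume "C \<le> C'" and
      "\<forall>n. outer_unit_normal K x n \<longrightarrow> n \<bullet> (x - z) \<ge> 0 \<and> (norm (x - z))^2 \<le> C * (n \<bullet> (x - z))"
    then show "\<forall>n. outer_unit_normal K x n \<longrightarrow> n \<bullet> (x - z) \<ge> 0 \<and> (norm (x - z))^2 \<le> C' * (n \<bullet> (x - z))"
      by (meson mult_right_mono order_trans)
  next
    fix p assume "p \<in> frontier K"
    then obtain \<nu> e U r where "graph_patch \<nu> e (DIM('a) - 1) K p U r" by (rule patch_at)
    then show "\<exists>\<epsilon>>0. \<exists>C. \<forall>x\<in>frontier K \<inter> ball p \<epsilon>. \<forall>z\<in>frontier K \<inter> ball p \<epsilon>.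
      \<forall>n. outer_unit_normal K x n \<longrightarrow> n \<bullet> (x - z) \<ge> 0 \<and> (norm (x - z))^2 \<le> C * (n \<bullet> (x - z))"
      using graph_patch.local_strong_convexity K by blast
  qed
  then obtain l C where l: "l > 0" and C: "\<And>x z n. x \<in> frontier K \<Longrightarrow> z \<in> frontier K \<Longrightarrow> dist x z < l \<Longrightarrow>
      outer_unit_normal K x n \<Longrightarrow> (norm (x - z))^2 \<le> C * (n \<bullet> (x - z))"
    by blast
  \<comment> \<open>Including the normal as a variable makes \<open>T\<close> closed by inspection:
    no continuity of the normal in \<open>x\<close> has to be shown.\<close>
  define T where "T = {(x, n, z). x \<in> frontier K \<and> z \<in> frontier K \<and> outer_unit_normal K x n \<and> l \<le> dist x z}"
  have "T = (frontier K \<times> sphere 0 1 \<times> frontier K) \<inter> ({w. l \<le> dist (fst w) (snd (snd w))} \<inter>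
      (\<Inter>y\<in>K. {w. fst (snd w) \<bullet> y \<le> fst (snd w) \<bullet> fst w}))"
    by (auto simp: T_def outer_unit_normal_def)
  moreover have "compact \<dots>"
    by (intro compact_Int_closed compact_Times compact_frontier compact_sphere closed_Int closed_INT ballI
        closed_Collect_le continuous_intros)
  ultimately have "compact T" by simp
  have pos: "n \<bullet> (x - z) > 0" if xz: "x \<in> frontier K" "z \<in> frontier K" and n: "outer_unit_normal K x n"
    and "l \<le> dist x z" for x n z
  proof (rule ccontr)
    assume "\<not> 0 < n \<bullet> (x - z)"
    then have 0: "n \<bullet> (x - z) = 0" using normal_nonneg[OF n] xz(2) frontier_K by force
    \<comment> \<open>This places \<open>w\<close> on the segment at distance \<open>l / 2\<close>
      from \<open>x\<close>, inside the range of the local estimate.\<close>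
    define t where "t = l / (2 * dist x z)"
    have t: "0 < t" "t \<le> 1" "t * dist x z < l" using l \<open>l \<le> dist x z\<close> by (auto simp: t_def divide_simps)
    define w where "w = x + t *\<^sub>R (z - x)"
    have "w \<in> K"
      using convexD_alt[OF cvx, of x z t] xz frontier_K t by (auto simp: w_def algebra_simps)
    moreover have xw: "x - w = t *\<^sub>R (x - z)" by (simp add: w_def algebra_simps)
    then have nxw: "n \<bullet> (x - w) = 0" using 0 by simp
    ultimately have "w \<in> frontier K" using contact_in_frontier[OF n] by (simp add: inner_diff_right)
    moreover have "dist x w < l" using t xw by (simp add: dist_norm)
    ultimately have "(norm (x - w))^2 \<le> C * (n \<bullet> (x - w))" using C[OF xz(1) _ _ n] by blast
    then have "x = w" using nxw by simp
    then have "x = z" using xw t(1) by simp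
    then show False using l \<open>l \<le> dist x z\<close> by simp
  qed
  have "\<exists>c>0. \<forall>(x, n, z)\<in>T. c \<le> n \<bullet> (x - z)"
  proof (cases "T = {}")
    case True
    then show ?thesis by (intro exI[of _ 1]) auto
  next
    case False
    have "continuous_on T (\<lambda>w. fst (snd w) \<bullet> (fst w - snd (snd w)))" by (intro continuous_intros)
    then obtain a where a: "a \<in> T"
      "\<forall>w\<in>T. fst (snd a) \<bullet> (fst a - snd (snd a)) \<le> fst (snd w) \<bullet> (fst w - snd (snd w))"
      using continuous_attains_inf[OF \<open>compact T\<close> False] by blast
    have "fst (snd a) \<bullet> (fst a - snd (snd a)) > 0" using a(1) pos by (auto simp: T_def)
    then show ?thesis using a(2) by (intro exI[of _ "fst (snd a) \<bullet> (fst a - snd (snd a))"]) auto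
  qed
  then obtain c where c: "c > 0" "\<And>x n z. (x, n, z) \<in> T \<Longrightarrow> c \<le> n \<bullet> (x - z)" by blast
  define d where "d = diameter K"
  have d: "norm (x - z) \<le> d" if "x \<in> K" "z \<in> K" for x z
    using diameter_bounded_bound[OF compact_imp_bounded[OF cpt] that] by (simp add: d_def dist_norm)
  \<comment> \<open>For distant pairs the squared distance is at most \<open>d^2\<close>, and the
    height is at least \<open>c\<close>.\<close>
  define C' where "C' = max 1 (max C (d^2 / c))"
  show ?thesis
  proof (rule that[of C'])
    show "C' > 0" by (simp add: C'_def)
    fix x z n assume xz: "x \<in> frontier K" "z \<in> frontier K" and n: "outer_unit_normal K x n"
    have nn: "0 \<le> n \<bullet> (x - z)" using normal_nonneg[OF n] xz(2) frontier_K by blast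
    show "(norm (x - z))^2 \<le> C' * (n \<bullet> (x - z))"
    proof (cases "dist x z < l")
      case True
      have "C * (n \<bullet> (x - z)) \<le> C' * (n \<bullet> (x - z))" using nn by (intro mult_right_mono) (auto simp: C'_def)
      then show ?thesis using C[OF xz True n] by linarith
    next
      case False
      then have "c \<le> n \<bullet> (x - z)" using xz n by (intro c(2)) (auto simp: T_def)
      have "(norm (x - z))^2 \<le> d^2" using d xz frontier_K by (intro power_mono) auto
      also have "\<dots> = d^2 / c * c" using c(1) by simp
      also have "\<dots> \<le> C' * (n \<bullet> (x - z))"
        using \<open>c \<le> n \<bullet> (x - z)\<close> c(1) by (intro mult_mono) (auto simp: C'_def)
      finally show ?thesis .
    qed
  qed
qed

lemma speed_bounds:
  obtains C where "C > 0"
    "\<And>z v q. z \<in> frontier K \<Longrightarrow> speed_sq K z v q \<Longrightarrow> 0 \<le> q \<and> (norm v)^2 \<le> C * q \<and> q \<le> C * (norm v)^2"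
proof -
  have "\<exists>C. \<forall>z\<in>frontier K. \<forall>v q. speed_sq K z v q \<longrightarrow> 0 \<le> q \<and> (norm v)^2 \<le> C * q \<and> q \<le> C * (norm v)^2"
  proof (rule compact_uniform[OF compact_frontier])
    fix C C' :: real and z assume "C \<le> C'" and
      "\<forall>v q. speed_sq K z v q \<longrightarrow> 0 \<le> q \<and> (norm v)^2 \<le> C * q \<and> q \<le> C * (norm v)^2"
    then show "\<forall>v q. speed_sq K z v q \<longrightarrow> 0 \<le> q \<and> (norm v)^2 \<le> C' * q \<and> q \<le> C' * (norm v)^2"
      by (meson mult_right_mono order_trans zero_le_power2)
  next
    fix p assume "p \<in> frontier K"
    then obtain \<nu> e U r where "graph_patch \<nu> e (DIM('a) - 1) K p U r" by (rule patch_at)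
    then show "\<exists>\<epsilon>>0. \<exists>C. \<forall>z\<in>frontier K \<inter> ball p \<epsilon>. \<forall>v q. speed_sq K z v q \<longrightarrow>
        0 \<le> q \<and> (norm v)^2 \<le> C * q \<and> q \<le> C * (norm v)^2"
      using graph_patch.local_speed_bounds K by blast
  qed
  then obtain C where C: "\<And>z v q. z \<in> frontier K \<Longrightarrow> speed_sq K z v q \<Longrightarrow>
      0 \<le> q \<and> (norm v)^2 \<le> C * q \<and> q \<le> C * (norm v)^2" by blast
  show ?thesis
  proof (rule that[of "max 1 C"])
    fix z v q assume "z \<in> frontier K" "speed_sq K z v q"
    from C[OF this] show "0 \<le> q \<and> (norm v)^2 \<le> max 1 C * q \<and> q \<le> max 1 C * (norm v)^2"
      by (meson max.cobounded2 mult_right_mono order_trans zero_le_power2)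
  qed simp
qed

text \<open>No closeness of \<open>x\<close> and \<open>z\<close> may be assumed, since a curve
  ending at \<open>x\<close> can pass anywhere. For distant pairs the height is bounded below, and
  the quadratic term with a large constant exceeds the trivial bound \<open>norm v\<close>.\<close>

lemma height_speed:
  obtains C where "C > 0"
    "\<And>x z n v q. x \<in> frontier K \<Longrightarrow> z \<in> frontier K \<Longrightarrow> outer_unit_normal K x n \<Longrightarrow> speed_sq K z v q \<Longrightarrow>
      \<bar>n \<bullet> v\<bar> \<le> sqrt (2 * (n \<bullet> (x - z))) * (1 + C * sqrt (2 * (n \<bullet> (x - z)))) * sqrt q"
proof -
  obtain C1 where C1: "C1 > 0" "\<And>x z n. x \<in> frontier K \<Longrightarrow> z \<in> frontier K \<Longrightarrow> outer_unit_normal K x n \<Longrightarrow>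
      (norm (x - z))^2 \<le> C1 * (n \<bullet> (x - z))" using strong_convexity by metis
  obtain C2 where C2: "C2 > 0" "\<And>z v q. z \<in> frontier K \<Longrightarrow> speed_sq K z v q \<Longrightarrow>
      0 \<le> q \<and> (norm v)^2 \<le> C2 * q \<and> q \<le> C2 * (norm v)^2" using speed_bounds by metis
  define E where "E C x z \<longleftrightarrow> (\<forall>n v q. outer_unit_normal K x n \<longrightarrow> speed_sq K z v q \<longrightarrow>
      \<bar>n \<bullet> v\<bar> \<le> sqrt (2 * (n \<bullet> (x - z))) * (1 + C * sqrt (2 * (n \<bullet> (x - z)))) * sqrt q)" for C x z
  have mono: "sqrt (2 * (n \<bullet> (x - z))) * (1 + C * sqrt (2 * (n \<bullet> (x - z)))) * sqrt q
      \<le> sqrt (2 * (n \<bullet> (x - z))) * (1 + C' * sqrt (2 * (n \<bullet> (x - z)))) * sqrt q"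
    if "C \<le> C'" "z \<in> frontier K" "outer_unit_normal K x n" "speed_sq K z v q" for C C' x z n v q
  proof -
    have "0 \<le> n \<bullet> (x - z)" "0 \<le> q" using normal_nonneg that frontier_K C2(2) by blast+
    then show ?thesis using that(1) by (intro mult_right_mono mult_left_mono add_left_mono) auto
  qed
  have "\<exists>l>0. \<exists>C. \<forall>x\<in>frontier K. \<forall>z\<in>frontier K. dist x z < l \<longrightarrow> E C x z"
  proof (rule compact_uniform_pairs[OF compact_frontier])
    fix C C' :: real and x z assume "C \<le> C'" "E C x z" "z \<in> frontier K"
    then show "E C' x z" unfolding E_def using mono order_trans by blast
  next
    fix p assume "p \<in> frontier K"
    then obtain \<nu> e U r where "graph_patch \<nu> e (DIM('a) - 1) K p U r" by (rule patch_at)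
    then show "\<exists>\<epsilon>>0. \<exists>C. \<forall>x\<in>frontier K \<inter> ball p \<epsilon>. \<forall>z\<in>frontier K \<inter> ball p \<epsilon>. E C x z"
      unfolding E_def by (rule graph_patch.local_speed_estimate[OF _ K])
  qed
  then obtain l C where l: "l > 0" and C: "\<And>x z. x \<in> frontier K \<Longrightarrow> z \<in> frontier K \<Longrightarrow> dist x z < l \<Longrightarrow> E C x z"
    by blast
  define t0 where "t0 = sqrt (2 * (l^2 / C1))"
  have t0: "t0 > 0" using l C1(1) by (simp add: t0_def)
  \<comment> \<open>Distant pairs satisfy \<open>t0 \<le> t\<close>, so \<open>C' * t^2\<close> is
    at least \<open>sqrt C2\<close>, the constant in
    \<open>norm v \<le> sqrt (C2 * q)\<close>.\<close>
  define C' where "C' = max (max 1 C) (sqrt C2 / t0^2)"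
  show ?thesis
  proof (rule that[of C'])
    show "C' > 0" by (simp add: C'_def)
    fix x z n v q
    assume a: "x \<in> frontier K" "z \<in> frontier K" "outer_unit_normal K x n" "speed_sq K z v q"
    show "\<bar>n \<bullet> v\<bar> \<le> sqrt (2 * (n \<bullet> (x - z))) * (1 + C' * sqrt (2 * (n \<bullet> (x - z)))) * sqrt q"
    proof (cases "dist x z < l")
      case True
      then have "E C x z" using C a by blast
      then show ?thesis
        using mono[of C C' z x n v q] a unfolding E_def by (force simp: C'_def)
    next
      case False
      define t where "t = sqrt (2 * (n \<bullet> (x - z)))"
      have "l^2 \<le> (norm (x - z))^2" using False l by (intro power_mono) (auto simp: dist_norm)
      also have "\<dots> \<le> C1 * (n \<bullet> (x - z))" using C1(2) a by blast
      finally have "l^2 / C1 \<le> n \<bullet> (x - z)" using C1(1) by (simp add: field_simps)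
      then have t: "t0 \<le> t" by (simp add: t_def t0_def)
      have q: "0 \<le> q" "(norm v)^2 \<le> C2 * q" using C2(2) a by blast+
      have "norm n = 1" using a(3) by (simp add: outer_unit_normal_def)
      then have "\<bar>n \<bullet> v\<bar> \<le> norm v" using Cauchy_Schwarz_ineq2[of n v] by simp
      also have "\<dots> \<le> sqrt (C2 * q)" using q(2) by (rule real_le_rsqrt)
      also have "\<dots> = (sqrt C2 / t0^2 * t0^2) * sqrt q" using t0 by (simp add: real_sqrt_mult)
      also have "\<dots> \<le> (C' * t^2) * sqrt q"
        using t t0 C2(1) q(1) by (intro mult_right_mono mult_mono power_mono) (auto simp: C'_def)
      also have "\<dots> \<le> (t * (1 + C' * t)) * sqrt q"
        using t t0 q(1) by (intro mult_right_mono) (auto simp: power2_eq_square algebra_simps)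
      finally show ?thesis by (simp add: t_def)
    qed
  qed
qed

lemma short_segment:
  obtains l C where "l > 0" "C > 0"
    "\<And>x z n. x \<in> frontier K \<Longrightarrow> z \<in> frontier K \<Longrightarrow> dist x z < l \<Longrightarrow> outer_unit_normal K x n \<Longrightarrow>
      \<exists>L. boundary_curve_length K z x L \<and> L^2 \<le> 2 * (n \<bullet> (x - z)) + C * ((n \<bullet> (x - z)) * sqrt (n \<bullet> (x - z)))"
proof -
  define E where "E C x z \<longleftrightarrow> (\<forall>n. outer_unit_normal K x n \<longrightarrow>
      (\<exists>L. boundary_curve_length K z x L \<and> L^2 \<le> 2 * (n \<bullet> (x - z)) + C * ((n \<bullet> (x - z)) * sqrt (n \<bullet> (x - z)))))" for C x z
  have mono: "E C' x z" if "z \<in> frontier K" "E C x z" "C \<le> C'" for C C' x z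
    unfolding E_def
  proof (intro impI allI)
    fix n assume n: "outer_unit_normal K x n"
    note z = \<open>z \<in> frontier K\<close>
    have "0 \<le> n \<bullet> (x - z)" using normal_nonneg[OF n] z frontier_K by blast
    then have "C * ((n \<bullet> (x - z)) * sqrt (n \<bullet> (x - z))) \<le> C' * ((n \<bullet> (x - z)) * sqrt (n \<bullet> (x - z)))"
      using that(3) by (intro mult_right_mono) auto
    then show "\<exists>L. boundary_curve_length K z x L \<and> L^2 \<le> 2 * (n \<bullet> (x - z)) + C' * ((n \<bullet> (x - z)) * sqrt (n \<bullet> (x - z)))"
      using that(2) n unfolding E_def by (meson add_left_mono order_trans)
  qed
  have "\<exists>l>0. \<exists>C. \<forall>x\<in>frontier K. \<forall>z\<in>frontier K. dist x z < l \<longrightarrow> E C x z"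
  proof (rule compact_uniform_pairs[OF compact_frontier])
    show "E C' x z" if "z \<in> frontier K" "E C x z" "C \<le> C'" for C C' x z using mono that .
    fix p assume "p \<in> frontier K"
    then obtain \<nu> e U r where "graph_patch \<nu> e (DIM('a) - 1) K p U r" by (rule patch_at)
    then show "\<exists>\<epsilon>>0. \<exists>C. \<forall>x\<in>frontier K \<inter> ball p \<epsilon>. \<forall>z\<in>frontier K \<inter> ball p \<epsilon>. E C x z"
      unfolding E_def by (rule graph_patch.local_segment[OF _ K])
  qed
  then obtain l C where l: "l > 0" and C: "\<And>x z. x \<in> frontier K \<Longrightarrow> z \<in> frontier K \<Longrightarrow> dist x z < l \<Longrightarrow> E C x z"
    by blast
  then have "E (max 1 C) x z" if "x \<in> frontier K" "z \<in> frontier K" "dist x z < l" for x z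
    using mono that by (meson max.cobounded2)
  then show ?thesis using that[of l "max 1 C"] l unfolding E_def by auto
qed

lemma short_rest_curve:
  obtains l C where "l > 0" "\<And>x z. x \<in> frontier K \<Longrightarrow> z \<in> frontier K \<Longrightarrow> dist x z < l \<Longrightarrow> rest_curve K x z C"
proof -
  have "\<exists>l>0. \<exists>C. \<forall>x\<in>frontier K. \<forall>z\<in>frontier K. dist x z < l \<longrightarrow> rest_curve K x z C"
  proof (rule compact_uniform_pairs[OF compact_frontier])
    fix C C' :: real and x z assume "C \<le> C'" "rest_curve K x z C"
    then show "rest_curve K x z C'" by (rule rest_curve_mono[rotated])
  next
    fix p assume "p \<in> frontier K"
    then obtain \<nu> e U r where "graph_patch \<nu> e (DIM('a) - 1) K p U r" by (rule patch_at)
    then show "\<exists>\<epsilon>>0. \<exists>C. \<forall>x\<in>frontier K \<inter> ball p \<epsilon>. \<forall>z\<in>frontier K \<inter> ball p \<epsilon>. rest_curve K x z C"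
      using graph_patch.local_rest_curve K by blast
  qed
  then show ?thesis using that by blast
qed

end

lemma at_within_01_neq_bot: "\<tau> \<in> {0..1::real} \<Longrightarrow> at \<tau> within {0..1} \<noteq> bot"
  by (simp add: trivial_limit_within islimpt_Icc)

section \<open>Lengths of arbitrary boundary curves\<close>

context k3_plus
begin

text \<open>Replaces the unknown chart of a piece by a continuous integrand whose square satisfies
  the chart-free relation \<open>speed_sq\<close>; from here on lengths are handled without
  charts.\<close>

lemma piece_speed:
  assumes D: "\<And>\<tau>. \<tau> \<in> {0..1} \<Longrightarrow> (k has_vector_derivative D \<tau>) (at \<tau>)"
    and Dc: "continuous_on {0..1} D" and kK: "k ` {0..1} \<subseteq> frontier K"
    and ab: "0 \<le> a" "a \<le> b" "b \<le> 1" and l: "piece_length K k a b l"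
  obtains g where "continuous_on {a..b} g" "l = integral {a..b} g"
    "\<And>\<tau>. \<tau> \<in> {a..b} \<Longrightarrow> 0 \<le> g \<tau> \<and> speed_sq K (k \<tau>) (D \<tau>) ((g \<tau>)^2)"
proof -
  have sub: "{a..b} \<subseteq> {0..1}" using ab by auto
  obtain p \<nu> e U where ch: "graph_chart K p \<nu> e U" and kU: "k ` {a..b} \<subseteq> U"
    and l: "l = integral {a..b} (\<lambda>\<tau>. sqrt (second_form e (graph_fun p \<nu> U) (hyperplane_proj p \<nu> (k \<tau>))
              (vector_derivative (\<lambda>\<sigma>. hyperplane_proj p \<nu> (k \<sigma>)) (at \<tau>))))"
    using l unfolding piece_length_def by blast
  obtain r where "graph_patch \<nu> e (DIM('a) - 1) K p U r" using graph_chart_patch[OF cpt cvx int ch] .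
  then interpret c: graph_patch \<nu> e "DIM('a) - 1" K p U r .
  define w where "w \<tau> = D \<tau> - (\<nu> \<bullet> D \<tau>) *\<^sub>R \<nu>" for \<tau>
  define q where "q \<tau> = second_form e c.f (c.pr (k \<tau>)) (w \<tau>)" for \<tau>
  have vd: "vector_derivative (\<lambda>\<sigma>. c.pr (k \<sigma>)) (at \<tau>) = w \<tau>" if "\<tau> \<in> {a..b}" for \<tau>
  proof (rule vector_derivative_at)
    have "(k has_vector_derivative D \<tau>) (at \<tau>)" using D that sub by blast
    moreover have "((\<lambda>\<sigma>. \<nu> \<bullet> (k \<sigma> - p)) has_vector_derivative (\<nu> \<bullet> D \<tau>)) (at \<tau>)"
      using calculation
      by (intro bounded_linear.has_vector_derivative[OF bounded_linear_inner_right]) (auto intro!: derivative_eq_intros)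
    ultimately show "((\<lambda>\<sigma>. c.pr (k \<sigma>)) has_vector_derivative w \<tau>) (at \<tau>)"
      unfolding hyperplane_proj_def w_def
      by (auto intro!: derivative_eq_intros simp: has_real_derivative_iff_has_vector_derivative)
  qed
  have kcon: "continuous_on {a..b} k"
    using D sub by (intro continuous_at_imp_continuous_on) (blast intro: has_vector_derivative_continuous)
  have prc: "continuous_on {a..b} (\<lambda>\<tau>. c.pr (k \<tau>))"
    unfolding hyperplane_proj_def by (intro continuous_intros kcon)
  have wc: "continuous_on {a..b} w"
    unfolding w_def by (intro continuous_intros continuous_on_subset[OF Dc sub])
  have prB: "c.pr (k \<tau>) \<in> c.B" "c.y (c.pr (k \<tau>)) = k \<tau>" if "\<tau> \<in> {a..b}" for \<tau>
  proof -
    have "k \<tau> \<in> U" using kU that by blast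
    then show "c.pr (k \<tau>) \<in> c.B" "c.y (c.pr (k \<tau>)) = k \<tau>" using c.y_pr by auto
  qed
  have qc: "continuous_on {a..b} q"
  proof -
    have i1: "(\<lambda>\<tau>. (c.pr (k \<tau>), w \<tau>)) ` {a..b} \<subseteq> c.B \<times> UNIV" using prB by auto
    have "continuous_on {a..b} (\<lambda>\<tau>. (c.pr (k \<tau>), w \<tau>))" by (intro continuous_intros prc wc)
    from continuous_on_compose2[OF c.continuous_on_hess[OF c.C2_f] this i1]
    have h: "continuous_on {a..b} (\<lambda>\<tau>. c.hess c.f (c.pr (k \<tau>)) (w \<tau>))" by simp
    have n: "continuous_on {a..b} (\<lambda>\<tau>. norm (c.N (c.pr (k \<tau>))))"
      by (intro continuous_intros continuous_on_compose2[OF c.continuous_on_N prc]) (use prB in auto)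
    show ?thesis unfolding q_def c.second_form_N
      by (intro continuous_on_divide h n) (use c.norm_N(2) in auto)
  qed
  have sq: "speed_sq K (k \<tau>) (D \<tau>) (q \<tau>)" if "\<tau> \<in> {a..b}" for \<tau>
    unfolding q_def w_def
  \<comment> \<open>Only the part of the curve over \<open>{0..1}\<close> is known to lie in the
    boundary, so derivatives are taken within that interval, one-sided at its ends.\<close>
  proof (rule c.speed_sq_curve)
    show "k \<tau> \<in> U" "\<tau> \<in> {0..1}" "k ` {0..1} \<subseteq> frontier K" using that kU sub kK by auto
    then show "at \<tau> within {0..1} \<noteq> bot" "(k has_vector_derivative D \<tau>) (at \<tau> within {0..1})"
      using D at_within_01_neq_bot by (auto intro: has_vector_derivative_at_within)
  qed
  have q0: "0 \<le> q \<tau>" if "\<tau> \<in> {a..b}" for \<tau>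
  proof -
    have "k \<tau> \<in> frontier K" using that sub kK by blast
    then obtain n where "outer_unit_normal K (k \<tau>) n" by (rule normal_exists)
    then show ?thesis using speed_sq_nonneg[OF sq[OF that] _ closed_K] by blast
  qed
  show ?thesis
  proof (rule that[of "\<lambda>\<tau>. sqrt (q \<tau>)"])
    show "continuous_on {a..b} (\<lambda>\<tau>. sqrt (q \<tau>))" by (intro continuous_intros qc)
    show "l = integral {a..b} (\<lambda>\<tau>. sqrt (q \<tau>))"
      unfolding l q_def by (intro integral_cong) (simp add: vd)
    show "0 \<le> sqrt (q \<tau>) \<and> speed_sq K (k \<tau>) (D \<tau>) ((sqrt (q \<tau>))^2)" if "\<tau> \<in> {a..b}" for \<tau>
      using sq[OF that] q0[OF that] by simp
  qed
qed

lemma curve_length_pieces: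
  assumes "curve_length K k L"
  obtains m t l where "t 0 = 0" "t (m::nat) = (1::real)" "L = (\<Sum>i<m. l i)"
    "\<And>i. i < m \<Longrightarrow> 0 \<le> t i \<and> t i \<le> t (Suc i) \<and> t (Suc i) \<le> 1 \<and> piece_length K k (t i) (t (Suc i)) (l i)"
proof -
  obtain m t l where t: "t 0 = 0" "t m = 1" "L = (\<Sum>i<m. l i)"
    "\<And>i. i < m \<Longrightarrow> t i < t (Suc i) \<and> piece_length K k (t i) (t (Suc i)) (l i)"
    using assms unfolding curve_length_def by blast
  have mono: "t i \<le> t j" if "i \<le> j" "j \<le> m" for i j
    using that
  proof (induction j rule: dec_induct)
    case (step j)
    then show ?case using t(4)[of j] by simp
  qed simp
  show ?thesis
  proof (rule that[OF t(1-3)])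
    fix i assume i: "i < m"
    show "0 \<le> t i \<and> t i \<le> t (Suc i) \<and> t (Suc i) \<le> 1 \<and> piece_length K k (t i) (t (Suc i)) (l i)"
      using mono[of 0 i] mono[of i "Suc i"] mono[of "Suc i" m] t(1,2) t(4)[OF i] i by auto
  qed
qed

lemma boundary_curve_length_nonneg:
  assumes "boundary_curve_length K x z L"
  shows "0 \<le> L"
proof -
  obtain k where k: "k C1_differentiable_on {0..1}" and kK: "path_image k \<subseteq> frontier K"
    and L: "curve_length K k L" using assms unfolding boundary_curve_length_def by blast
  obtain D where D: "\<And>\<tau>. \<tau> \<in> {0..1} \<Longrightarrow> (k has_vector_derivative D \<tau>) (at \<tau>)" "continuous_on {0..1} D"
    using k unfolding C1_differentiable_on_def by blast
  obtain m t l where t: "L = (\<Sum>i<m. l i)"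
    "\<And>i. i < m \<Longrightarrow> 0 \<le> t i \<and> t i \<le> t (Suc i) \<and> t (Suc i) \<le> 1 \<and> piece_length K k (t i) (t (Suc i)) (l i)"
    using curve_length_pieces[OF L] by metis
  have "0 \<le> l i" if i: "i < m" for i
  proof -
    obtain g where g: "continuous_on {t i..t (Suc i)} g" "l i = integral {t i..t (Suc i)} g"
      "\<And>\<tau>. \<tau> \<in> {t i..t (Suc i)} \<Longrightarrow> 0 \<le> g \<tau> \<and> speed_sq K (k \<tau>) (D \<tau>) ((g \<tau>)^2)"
      using piece_speed[OF D, of "t i" "t (Suc i)" "l i"] t(2)[OF i] kK unfolding path_image_def by metis
    show ?thesis unfolding g(2) using g(1,3) by (intro integral_nonneg integrable_continuous_real) auto
  qed
  then show ?thesis unfolding t(1) by (intro sum_nonneg) auto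
qed

lemma curve_length_le:
  assumes sb: "\<And>z v q. z \<in> frontier K \<Longrightarrow> speed_sq K z v q \<Longrightarrow> q \<le> C * (norm v)^2" and C: "C > 0"
    and D: "\<And>\<tau>. \<tau> \<in> {0..1} \<Longrightarrow> (k has_vector_derivative D \<tau>) (at \<tau>)" "continuous_on {0..1} D"
    and kK: "k ` {0..1} \<subseteq> frontier K" and M: "\<And>\<tau>. \<tau> \<in> {0..1} \<Longrightarrow> norm (D \<tau>) \<le> M"
    and L: "curve_length K k L"
  shows "L \<le> sqrt C * M"
proof -
  obtain m t l where t: "t 0 = 0" "t m = 1" "L = (\<Sum>i<m. l i)"
    "\<And>i. i < m \<Longrightarrow> 0 \<le> t i \<and> t i \<le> t (Suc i) \<and> t (Suc i) \<le> 1 \<and> piece_length K k (t i) (t (Suc i)) (l i)"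
    using curve_length_pieces[OF L] by metis
  have "l i \<le> (t (Suc i) - t i) * (sqrt C * M)" if i: "i < m" for i
  proof -
    obtain g where g: "continuous_on {t i..t (Suc i)} g" "l i = integral {t i..t (Suc i)} g"
      "\<And>\<tau>. \<tau> \<in> {t i..t (Suc i)} \<Longrightarrow> 0 \<le> g \<tau> \<and> speed_sq K (k \<tau>) (D \<tau>) ((g \<tau>)^2)"
      using piece_speed[OF D kK, of "t i" "t (Suc i)" "l i"] t(4)[OF i] by metis
    have "g \<tau> \<le> sqrt C * M" if \<tau>: "\<tau> \<in> {t i..t (Suc i)}" for \<tau>
    proof -
      have \<tau>1: "\<tau> \<in> {0..1}" using t(4)[OF i] \<tau> by auto
      then have "k \<tau> \<in> frontier K" using kK by blast
      then have "(g \<tau>)^2 \<le> C * (norm (D \<tau>))^2" using sb g(3)[OF \<tau>] by blast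
      also have "\<dots> \<le> C * M^2" using C M[OF \<tau>1] by (intro mult_left_mono power_mono) auto
      finally have "(g \<tau>)^2 \<le> (sqrt C * M)^2" using C by (simp add: power_mult_distrib)
      moreover have "0 \<le> M" using order_trans[OF norm_ge_zero M[OF \<tau>1]] .
      ultimately show ?thesis using C by (intro power2_le_imp_le[of "g \<tau>"]) simp_all
    qed
    then have "integral {t i..t (Suc i)} g \<le> integral {t i..t (Suc i)} (\<lambda>_. sqrt C * M)"
      using g(1) by (intro integral_le integrable_continuous_real) auto
    then show ?thesis using g(2) t(4)[OF i] by (simp add: ac_simps)
  qed
  then have "L \<le> (\<Sum>i<m. (t (Suc i) - t i) * (sqrt C * M))" unfolding t(3) by (intro sum_mono) auto
  also have "\<dots> = (t m - t 0) * (sqrt C * M)" by (simp add: sum_distrib_right[symmetric] sum_lessThan_telescope)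
  finally show ?thesis using t(1,2) by simp
qed

text \<open>Along a curve the height \<open>\<phi>\<close> above the tangent hyperplane at \<open>x\<close> satisfies
  \<open>s' \<le> (1 + C s) g\<close> for \<open>s = sqrt (2 \<phi>)\<close> and the speed \<open>g\<close>, so \<open>ln (1 + C s) / C\<close> grows at most like
  the length. The summand \<open>\<epsilon>\<close> keeps the square root differentiable.\<close>

lemma height_along_piece:
  assumes C: "C > 0"
    and hs: "\<And>z v q. z \<in> frontier K \<Longrightarrow> speed_sq K z v q \<Longrightarrow>
      \<bar>n \<bullet> v\<bar> \<le> sqrt (2 * (n \<bullet> (x - z))) * (1 + C * sqrt (2 * (n \<bullet> (x - z)))) * sqrt q"
    and n: "outer_unit_normal K x n"
    and D: "\<And>\<tau>. \<tau> \<in> {0..1} \<Longrightarrow> (k has_vector_derivative D \<tau>) (at \<tau>)" "continuous_on {0..1} D"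
    and kK: "k ` {0..1} \<subseteq> frontier K"
    and ab: "0 \<le> a" "a \<le> b" "b \<le> 1" and l: "piece_length K k a b l" and \<epsilon>: "\<epsilon> > 0"
  shows "ln (1 + C * sqrt (2 * (n \<bullet> (x - k a)) + \<epsilon>)) / C \<le> ln (1 + C * sqrt (2 * (n \<bullet> (x - k b)) + \<epsilon>)) / C + l"
proof -
  obtain g where g: "continuous_on {a..b} g" "l = integral {a..b} g"
    "\<And>\<tau>. \<tau> \<in> {a..b} \<Longrightarrow> 0 \<le> g \<tau> \<and> speed_sq K (k \<tau>) (D \<tau>) ((g \<tau>)^2)"
    using piece_speed[OF D kK ab l] by blast
  define s where "s \<tau> = sqrt (2 * (n \<bullet> (x - k \<tau>)) + \<epsilon>)" for \<tau>
  define F where "F \<tau> = - (ln (1 + C * s \<tau>) / C)" for \<tau>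
  define F' where "F' \<tau> = (n \<bullet> D \<tau>) / (s \<tau> * (1 + C * s \<tau>))" for \<tau>
  have sub: "\<tau> \<in> {0..1}" if "\<tau> \<in> {a..b}" for \<tau> using that ab by auto
  have \<phi>0: "0 \<le> n \<bullet> (x - k \<tau>)" if "\<tau> \<in> {a..b}" for \<tau>
    using normal_nonneg[OF n] kK sub[OF that] frontier_K by blast
  have s0: "s \<tau> > 0" if "\<tau> \<in> {a..b}" for \<tau> using \<phi>0[OF that] \<epsilon> by (simp add: s_def)
  have F': "(F has_vector_derivative F' \<tau>) (at \<tau> within {a..b})" if \<tau>: "\<tau> \<in> {a..b}" for \<tau>
  proof -
    have "((\<lambda>\<tau>. n \<bullet> k \<tau>) has_vector_derivative (n \<bullet> D \<tau>)) (at \<tau>)"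
      by (rule bounded_linear.has_vector_derivative[OF bounded_linear_inner_right D(1)[OF sub[OF \<tau>]]])
    then have h: "((\<lambda>\<tau>. n \<bullet> k \<tau>) has_real_derivative (n \<bullet> D \<tau>)) (at \<tau>)"
      by (simp add: has_real_derivative_iff_has_vector_derivative)
    have "((\<lambda>\<tau>. 2 * (n \<bullet> x - n \<bullet> k \<tau>) + \<epsilon>) has_real_derivative - 2 * (n \<bullet> D \<tau>)) (at \<tau>)"
      by (auto intro!: derivative_eq_intros h)
    moreover have pos: "2 * (n \<bullet> x - n \<bullet> k \<tau>) + \<epsilon> > 0" using \<phi>0[OF \<tau>] \<epsilon> by (simp add: inner_diff_right)
    moreover have seq: "s = (\<lambda>\<tau>. sqrt (2 * (n \<bullet> x - n \<bullet> k \<tau>) + \<epsilon>))"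
      by (simp add: s_def[abs_def] inner_diff_right)
    ultimately have "(s has_real_derivative (inverse (s \<tau>) / 2) * (- 2 * (n \<bullet> D \<tau>))) (at \<tau>)"
      unfolding seq by (intro DERIV_chain2[OF DERIV_real_sqrt])
    then have sd: "(s has_real_derivative - (n \<bullet> D \<tau>) / s \<tau>) (at \<tau>)"
      by (rule DERIV_cong) (use s0[OF \<tau>] in \<open>simp add: field_simps\<close>)
    define X where "X = 1 + C * s \<tau>"
    have X: "X > 0" using C s0[OF \<tau>] by (simp add: X_def add_pos_pos)
    have "((\<lambda>\<tau>. 1 + C * s \<tau>) has_real_derivative 0 + C * (- (n \<bullet> D \<tau>) / s \<tau>)) (at \<tau>)"
      by (intro DERIV_add DERIV_const DERIV_cmult sd)
    from DERIV_chain2[OF DERIV_ln_divide[OF X, unfolded X_def] this]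
    have "(F has_real_derivative - (1 / X * (0 + C * (- (n \<bullet> D \<tau>) / s \<tau>)) / C)) (at \<tau>)"
      unfolding F_def[abs_def] X_def by (intro DERIV_minus DERIV_cdivide)
    moreover have "- (1 / X * (0 + C * (- (n \<bullet> D \<tau>) / s \<tau>)) / C) = F' \<tau>"
      unfolding F'_def X_def[symmetric] using C X s0[OF \<tau>] by (simp add: field_simps)
    ultimately have "(F has_real_derivative F' \<tau>) (at \<tau>)" by simp
    then show ?thesis
      by (simp add: has_real_derivative_iff_has_vector_derivative has_vector_derivative_at_within)
  qed
  have le: "F' \<tau> \<le> g \<tau>" if \<tau>: "\<tau> \<in> {a..b}" for \<tau>
  proof -
    \<comment> \<open>\<open>hs\<close> involves the unperturbed root \<open>?t\<close>. Since
      \<open>?t \<le> s \<tau>\<close> and the bound increases in this root, it also holds for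
      \<open>s\<close>, which stays differentiable where the height vanishes.\<close>
    let ?t = "sqrt (2 * (n \<bullet> (x - k \<tau>)))"
    have t: "0 \<le> ?t" "?t \<le> s \<tau>" using \<phi>0[OF \<tau>] \<epsilon> by (auto simp: s_def)
    have kf: "k \<tau> \<in> frontier K" using kK sub[OF \<tau>] by blast
    have "n \<bullet> D \<tau> \<le> ?t * (1 + C * ?t) * sqrt ((g \<tau>)^2)"
      using hs[OF kf] g(3)[OF \<tau>] by (meson abs_le_D1)
    also have "\<dots> \<le> s \<tau> * (1 + C * s \<tau>) * g \<tau>"
      using t C g(3)[OF \<tau>] s0[OF \<tau>] by (intro mult_mono add_left_mono mult_left_mono) auto
    finally have "n \<bullet> D \<tau> \<le> g \<tau> * (s \<tau> * (1 + C * s \<tau>))" by (simp add: mult.commute)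
    moreover have "s \<tau> * (1 + C * s \<tau>) > 0" using C s0[OF \<tau>] by (simp add: add_pos_pos)
    ultimately show ?thesis unfolding F'_def by (simp add: pos_divide_le_eq)
  qed
  have "(F' has_integral F b - F a) {a..b}"
    using F' ab(2) by (intro fundamental_theorem_of_calculus) auto
  moreover have "(g has_integral l) {a..b}"
    using g(1,2) integrable_continuous_real integrable_integral by blast
  ultimately have "F b - F a \<le> l" using le by (rule has_integral_le)
  then show ?thesis by (simp add: F_def s_def)
qed

text \<open>The pieces telescope from \<open>z\<close> to \<open>x\<close>, where the height is 0.
  This bounds \<open>ln (1 + C * sqrt (2 * \<phi>))\<close> by \<open>C * L\<close>, and
  exponentiating gives \<open>sqrt (2 * \<phi>) \<le> L + C * L^2\<close>.\<close>

lemma height_le_length: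
  obtains C where "C > 0"
    "\<And>x z L n. boundary_curve_length K z x L \<Longrightarrow> outer_unit_normal K x n \<Longrightarrow> C * L \<le> 1 \<Longrightarrow>
      n \<bullet> (x - z) \<le> L^2 / 2 + C * L ^ 3"
proof -
  obtain C where C: "C > 0" and hs: "\<And>x z n v q. x \<in> frontier K \<Longrightarrow> z \<in> frontier K \<Longrightarrow>
      outer_unit_normal K x n \<Longrightarrow> speed_sq K z v q \<Longrightarrow>
      \<bar>n \<bullet> v\<bar> \<le> sqrt (2 * (n \<bullet> (x - z))) * (1 + C * sqrt (2 * (n \<bullet> (x - z)))) * sqrt q"
    using height_speed by metis
  have "n \<bullet> (x - z) \<le> L^2 / 2 + (2 * C) * L ^ 3"
    if bc: "boundary_curve_length K z x L" and n: "outer_unit_normal K x n" and CL: "2 * C * L \<le> 1" for x z L n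
  proof -
    obtain k where k: "k C1_differentiable_on {0..1}" and kK: "path_image k \<subseteq> frontier K"
      and kx: "k 0 = z" "k 1 = x" and L: "curve_length K k L"
      using bc unfolding boundary_curve_length_def pathstart_def pathfinish_def by blast
    have x: "x \<in> frontier K" "outer_unit_normal K x n" using kK kx n by (auto simp: path_image_def)
    have kK': "k ` {0..1} \<subseteq> frontier K" using kK by (simp add: path_image_def)
    obtain D where D: "\<And>\<tau>. \<tau> \<in> {0..1} \<Longrightarrow> (k has_vector_derivative D \<tau>) (at \<tau>)" "continuous_on {0..1} D"
      using k unfolding C1_differentiable_on_def by blast
    obtain m t l where t: "t 0 = 0" "t m = 1" "L = (\<Sum>i<m. l i)"
      "\<And>i. i < m \<Longrightarrow> 0 \<le> t i \<and> t i \<le> t (Suc i) \<and> t (Suc i) \<le> 1 \<and> piece_length K k (t i) (t (Suc i)) (l i)"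
      using curve_length_pieces[OF L] by metis
    define \<phi> where "\<phi> = n \<bullet> (x - k 0)"
    have \<phi>0: "0 \<le> \<phi>" unfolding \<phi>_def using normal_nonneg[OF x(2)] kK' frontier_K by force
    have L0: "0 \<le> L" using boundary_curve_length_nonneg[OF bc] .
    have step: "ln (1 + C * sqrt (2 * \<phi>)) \<le> C * L + \<eta>" if \<eta>: "\<eta> > 0" for \<eta>
    proof -
      \<comment> \<open>Chosen so that the perturbation at the end point costs at most \<eta> / C,
        because \<open>ln (1 + C * sqrt \<epsilon>) \<le> C * sqrt \<epsilon> =
        \<eta>\<close>.\<close>
      define \<epsilon> where "\<epsilon> = (\<eta> / C)^2"
      have \<epsilon>: "\<epsilon> > 0" "sqrt \<epsilon> = \<eta> / C" using \<eta> C by (auto simp: \<epsilon>_def)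
      define F where "F \<tau> = ln (1 + C * sqrt (2 * (n \<bullet> (x - k \<tau>)) + \<epsilon>)) / C" for \<tau>
      have "F (t 0) \<le> F (t j) + (\<Sum>i<j. l i)" if "j \<le> m" for j
        using that
      proof (induction j)
        case (Suc j)
        then have j: "j < m" by simp
        have "F (t j) \<le> F (t (Suc j)) + l j"
          unfolding F_def using t(4)[OF j]
          by (intro height_along_piece[OF C hs[OF x(1) _ x(2)] x(2) D kK' _ _ _ _ \<epsilon>(1)]) auto
        then show ?case using Suc by simp
      qed simp
      from this[of m] have "F 0 \<le> F 1 + L" using t by simp
      moreover have "ln (1 + C * sqrt (2 * \<phi>)) / C \<le> F 0"
        unfolding F_def \<phi>_def[symmetric] using C \<phi>0 \<epsilon>(1)
        by (intro divide_right_mono) (auto simp: add_pos_nonneg)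
      moreover have "F 1 \<le> \<eta> / C"
      proof -
        have "ln (1 + C * sqrt \<epsilon>) \<le> C * sqrt \<epsilon>" using C \<epsilon> \<eta> by (intro ln_add_one_self_le_self) auto
        then show ?thesis unfolding F_def kx using C \<epsilon>(2) by (auto intro!: divide_right_mono)
      qed
      ultimately have "ln (1 + C * sqrt (2 * \<phi>)) / C \<le> L + \<eta> / C" by linarith
      then show ?thesis using C by (simp add: field_simps)
    qed
    then have "ln (1 + C * sqrt (2 * \<phi>)) \<le> C * L" by (rule field_le_epsilon)
    then have "exp (ln (1 + C * sqrt (2 * \<phi>))) \<le> exp (C * L)" by simp
    moreover have "0 < 1 + C * sqrt (2 * \<phi>)" using C \<phi>0 by (intro add_pos_nonneg) auto
    ultimately have "1 + C * sqrt (2 * \<phi>) \<le> exp (C * L)" by (simp only: exp_ln)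
    \<comment> \<open>The quadratic bound of the exponential needs \<open>C * L \<le> 1\<close>, the
      origin of the smallness hypothesis on \<open>L\<close>.\<close>
    also have "\<dots> \<le> 1 + C * L + (C * L)^2" using C L0 CL by (intro exp_bound) auto
    finally have "C * sqrt (2 * \<phi>) \<le> C * (L + C * L^2)" by (simp add: power2_eq_square algebra_simps)
    then have "sqrt (2 * \<phi>) \<le> L + C * L^2" using C by simp
    then have "(sqrt (2 * \<phi>))^2 \<le> (L + C * L^2)^2" using \<phi>0 by (intro power_mono) auto
    then have "2 * \<phi> \<le> (L + C * L^2)^2" using \<phi>0 by simp
    also have "\<dots> = L^2 + 2 * C * L ^ 3 + C * (C * L) * L ^ 3" by (simp add: eval_nat_numeral algebra_simps)
    also have "\<dots> \<le> L^2 + 2 * C * L ^ 3 + C * 1 * L ^ 3"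
      using C L0 CL by (intro add_left_mono mult_right_mono mult_left_mono) auto
    \<comment> \<open>Rounding 3 up to 4 lets the constant after halving equal the
      \<open>2 * C\<close> of the smallness hypothesis.\<close>
    also have "\<dots> \<le> L^2 + 4 * (C * L ^ 3)" using C L0 by simp
    finally show ?thesis by (simp add: \<phi>_def kx)
  qed
  then show ?thesis using that[of "2 * C"] C by (simp add: mult.assoc)
qed

end

section \<open>Connecting boundary points by curves\<close>

text \<open>The filter at \<open>x\<close> within a union is the supremum of the two filters, so
  equal one-sided derivatives glue to a two-sided one.\<close>

lemma has_vector_derivative_union:
  "(k has_vector_derivative v) (at x within S) \<Longrightarrow> (k has_vector_derivative v) (at x within T) \<Longrightarrow>
    (k has_vector_derivative v) (at x within S \<union> T)"
  unfolding has_vector_derivative_def has_derivative_iff_norm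
  unfolding at_within_union by (auto intro: filterlim_sup)

lemma rest_curve_sym:
  assumes "rest_curve K x z M"
  shows "rest_curve K z x M"
proof -
  obtain k D where k: "\<forall>t\<in>{0..1}. (k has_vector_derivative D t) (at t)" "continuous_on {0..1} D"
     "k ` {0..1} \<subseteq> frontier K" "k 0 = x" "k 1 = z" "D 0 = 0" "D 1 = 0" "\<forall>t\<in>{0..1}. norm (D t) \<le> M"
    using assms unfolding rest_curve_def by (elim exE conjE) (rule that)
  define k' where "k' = (\<lambda>t. k (1 - t))"
  define D' where "D' = (\<lambda>t. - D (1 - t))"
  have "(k' has_vector_derivative D' t) (at t)" if "t \<in> {0..1}" for t
  proof -
    have "((\<lambda>t. 1 - t) has_vector_derivative - 1) (at t)" by (auto intro!: derivative_eq_intros)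
    moreover have "(k has_vector_derivative D (1 - t)) (at (1 - t))" using k(1) that by auto
    ultimately have "(k \<circ> (\<lambda>t. 1 - t) has_vector_derivative (- 1) *\<^sub>R D (1 - t)) (at t)"
      by (rule vector_diff_chain_at)
    then show ?thesis by (simp add: k'_def D'_def o_def)
  qed
  moreover have "continuous_on {0..1} D'"
    unfolding D'_def by (intro continuous_intros continuous_on_compose2[OF k(2)]) auto
  moreover have "k' ` {0..1} \<subseteq> frontier K" using k(3) unfolding k'_def by auto
  moreover have "\<forall>t\<in>{0..1}. norm (D' t) \<le> M" using k(8) by (auto simp: D'_def)
  moreover have "k' 0 = z" "k' 1 = x" "D' 0 = 0" "D' 1 = 0" using k(4-7) by (simp_all add: k'_def D'_def)
  ultimately show ?thesis unfolding rest_curve_def by blast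
qed

text \<open>Each curve is run at double speed, hence the factor 2. At the junction both one-sided
  derivatives are 0, so the concatenation is differentiable there with continuous
  derivative.\<close>

lemma rest_curve_trans:
  assumes "rest_curve K x y M1" "rest_curve K y z M2"
  shows "rest_curve K x z (2 * max M1 M2)"
proof -
  obtain k1 D1 where k1: "\<forall>t\<in>{0..1}. (k1 has_vector_derivative D1 t) (at t)" "continuous_on {0..1} D1"
     "k1 ` {0..1} \<subseteq> frontier K" "k1 0 = x" "k1 1 = y" "D1 0 = 0" "D1 1 = 0" "\<forall>t\<in>{0..1}. norm (D1 t) \<le> M1"
    using assms(1) unfolding rest_curve_def by (elim exE conjE) (rule that)
  obtain k2 D2 where k2: "\<forall>t\<in>{0..1}. (k2 has_vector_derivative D2 t) (at t)" "continuous_on {0..1} D2"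
     "k2 ` {0..1} \<subseteq> frontier K" "k2 0 = y" "k2 1 = z" "D2 0 = 0" "D2 1 = 0" "\<forall>t\<in>{0..1}. norm (D2 t) \<le> M2"
    using assms(2) unfolding rest_curve_def by (elim exE conjE) (rule that)
  define k where "k = (\<lambda>t::real. if t \<le> 1/2 then k1 (2 * t) else k2 (2 * t - 1))"
  define D where "D = (\<lambda>t::real. if t \<le> 1/2 then 2 *\<^sub>R D1 (2 * t) else 2 *\<^sub>R D2 (2 * t - 1))"
  have d1: "(k has_vector_derivative 2 *\<^sub>R D1 (2 * t)) (at t within {..1/2})" if "0 \<le> t" "t \<le> 1/2" for t
  proof -
    have "((\<lambda>t. 2 * t) has_vector_derivative 2) (at t)" by (auto intro!: derivative_eq_intros)
    moreover have "(k1 has_vector_derivative D1 (2 * t)) (at (2 * t))" using k1(1) that by auto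
    ultimately have "(k1 \<circ> (\<lambda>t. 2 * t) has_vector_derivative 2 *\<^sub>R D1 (2 * t)) (at t within {..1/2})"
      by (intro has_vector_derivative_at_within[OF vector_diff_chain_at])
    then show ?thesis
      by (rule has_vector_derivative_transform[rotated 2]) (use that in \<open>auto simp: k_def\<close>)
  qed
  have d2: "(k has_vector_derivative 2 *\<^sub>R D2 (2 * t - 1)) (at t within {1/2..})" if "1/2 \<le> t" "t \<le> 1" for t
  proof -
    have "((\<lambda>t. 2 * t - 1) has_vector_derivative 2) (at t)" by (auto intro!: derivative_eq_intros)
    moreover have "(k2 has_vector_derivative D2 (2 * t - 1)) (at (2 * t - 1))" using k2(1) that by auto
    ultimately have hd: "(k2 \<circ> (\<lambda>t. 2 * t - 1) has_vector_derivative 2 *\<^sub>R D2 (2 * t - 1)) (at t within {1/2..})"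
      by (intro has_vector_derivative_at_within[OF vector_diff_chain_at])
    have "k s = (k2 \<circ> (\<lambda>t. 2 * t - 1)) s" if "s \<in> {1/2..}" for s
    proof (cases "s = 1/2")
      case True
      show ?thesis unfolding True using k1(5) k2(4) by (simp add: k_def)
    qed (use that in \<open>simp add: k_def\<close>)
    then show ?thesis
      by (rule has_vector_derivative_transform[OF _ _ hd, rotated]) (use that in auto)
  qed
  have A: "(k has_vector_derivative D t) (at t)" if t: "t \<in> {0..1}" for t
  proof (cases t "1/2 :: real" rule: linorder_cases)
    case less
    then have "at t within {..1/2} = at t" by (intro at_within_interior) simp
    then show ?thesis using d1[of t] t less by (simp add: D_def)
  next
    case greater
    then have "at t within {1/2..} = at t" by (intro at_within_interior) simp
    then show ?thesis using d2[of t] t greater by (simp add: D_def)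
  next
    case equal
    have "(k has_vector_derivative 0) (at (1/2) within {..1/2} \<union> {1/2..})"
      using d1[of "1/2"] d2[of "1/2"] k1(7) k2(6) by (intro has_vector_derivative_union) auto
    moreover have "{..1/2} \<union> {1/2..} = (UNIV :: real set)" by auto
    ultimately show ?thesis unfolding equal using k1(7) by (simp add: D_def)
  qed
  have B: "continuous_on {0..1} D"
    unfolding D_def
    by (intro continuous_on_cases_le continuous_intros continuous_on_compose2[OF k1(2)] continuous_on_compose2[OF k2(2)])
      (use k1(7) k2(6) in \<open>auto simp: mult.commute\<close>)
  have E: "k ` {0..1} \<subseteq> frontier K"
  proof
    fix w assume "w \<in> k ` {0..1}"
    then obtain t where t: "t \<in> {0..1}" "w = k t" by auto
    have "2 * t \<in> {0..1}" if "t \<le> 1/2" using t(1) that by auto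
    moreover have "2 * t - 1 \<in> {0..1}" if "\<not> t \<le> 1/2" using t(1) that by auto
    ultimately show "w \<in> frontier K" using k1(3) k2(3) t(2) by (auto simp: k_def image_subset_iff)
  qed
  have F: "norm (D t) \<le> 2 * max M1 M2" if t: "t \<in> {0..1}" for t
  proof (cases "t \<le> 1/2")
    case True
    then have "norm (D1 (2 * t)) \<le> M1" using k1(8) t by auto
    then show ?thesis using True by (simp add: D_def)
  next
    case False
    then have "norm (D2 (2 * t - 1)) \<le> M2" using k2(8) t by auto
    then show ?thesis using False by (simp add: D_def)
  qed
  have G: "k 0 = x" "k 1 = z" "D 0 = 0" "D 1 = 0" using k1(4,6) k2(5,7) by (simp_all add: k_def D_def)
  show ?thesis
    unfolding rest_curve_def by (rule exI[of _ k], rule exI[of _ D]) (intro conjI ballI A B E F G)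
qed

context k3_plus
begin

text \<open>\<open>curve_length\<close> is a relation, so a value has to be produced: uniform
  continuity gives an equidistant dissection so fine that each piece lies in one chart.\<close>

lemma curve_length_exists:
  assumes k: "continuous_on {0..1} k" and kK: "k ` {0..1} \<subseteq> frontier K"
  shows "\<exists>L. curve_length K k L"
proof -
  \<comment> \<open>Charts are open only relative to the boundary; open sets of the whole space that
    cut out parts of charts make the Lebesgue number lemma applicable.\<close>
  let ?G = "{T. open T \<and> (\<exists>p \<nu> e U. graph_chart K p \<nu> e U \<and> frontier K \<inter> T \<subseteq> U)}"
  have cov: "k ` {0..1} \<subseteq> \<Union>?G"
  proof
    fix x assume "x \<in> k ` {0..1}"
    then have "x \<in> frontier K" using kK by blast
    then obtain \<nu> e U where c: "graph_chart K x \<nu> e U" using K unfolding K3_plus_def by blast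
    then obtain T where "open T" "U = frontier K \<inter> T" "x \<in> U"
      unfolding graph_chart_def by (auto simp: openin_open)
    then show "x \<in> \<Union>?G" using c by blast
  qed
  have "compact (k ` {0..1})" using k by (intro compact_continuous_image) auto
  then obtain d where d: "d > 0" "\<And>x. x \<in> k ` {0..1} \<Longrightarrow> \<exists>T\<in>?G. ball x d \<subseteq> T"
    by (rule Heine_Borel_lemma[OF _ cov]) (blast, blast)
  obtain \<delta> where \<delta>: "\<delta> > 0" "\<And>s t. s \<in> {0..1} \<Longrightarrow> t \<in> {0..1} \<Longrightarrow> dist t s < \<delta> \<Longrightarrow> dist (k t) (k s) < d"
    using compact_uniformly_continuous[OF k] d(1) unfolding uniformly_continuous_on_def by (metis compact_Icc)
  obtain m :: nat where m: "1 / \<delta> < real m" using reals_Archimedean2 by blast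
  have m0: "m > 0" using m \<delta>(1) by (cases m) auto
  have md: "1 / real m < \<delta>" using m m0 \<delta>(1) by (simp add: field_simps)
  define t where "t i = real i / real m" for i
  have "\<exists>l. piece_length K k (t i) (t (Suc i)) l" if i: "i < m" for i
  proof -
    have ti: "t i \<in> {0..1}" "t (Suc i) = t i + 1 / real m" "t (Suc i) \<le> 1"
    proof -
      show "t i \<in> {0..1}" using i by (simp add: t_def)
      show "t (Suc i) = t i + 1 / real m" by (simp add: t_def add_divide_distrib)
      have "real (Suc i) \<le> real m" using i by linarith
      then show "t (Suc i) \<le> 1" using m0 by (simp add: t_def)
    qed
    obtain T p \<nu> e U where T: "ball (k (t i)) d \<subseteq> T" "graph_chart K p \<nu> e U" "frontier K \<inter> T \<subseteq> U"
      using d(2)[of "k (t i)"] ti(1) by blast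
    have "k ` {t i..t (Suc i)} \<subseteq> U"
    proof
      fix w assume "w \<in> k ` {t i..t (Suc i)}"
      then obtain s where s: "s \<in> {t i..t (Suc i)}" "w = k s" by auto
      then have s1: "s \<in> {0..1}" "dist (t i) s < \<delta>" using ti md by (auto simp: dist_real_def)
      then have "dist (k (t i)) (k s) < d" using \<delta>(2)[OF s1(1) ti(1)] by simp
      then have "w \<in> T" using T(1) s(2) by auto
      moreover have "w \<in> frontier K" using kK s1(1) s(2) by auto
      ultimately show "w \<in> U" using T(3) by blast
    qed
    then show ?thesis unfolding piece_length_def using T(2) by blast
  qed
  then obtain l where l: "\<And>i. i < m \<Longrightarrow> piece_length K k (t i) (t (Suc i)) (l i)" by metis
  have "curve_length K k (\<Sum>i<m. l i)"
    unfolding curve_length_def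
    by (rule exI[of _ m], rule exI[of _ t], rule exI[of _ l])
      (use l m0 in \<open>auto simp: t_def divide_strict_right_mono\<close>)
  then show ?thesis by blast
qed

lemma rest_curve_length:
  obtains C where "C > 0" "\<And>x z M. rest_curve K x z M \<Longrightarrow> \<exists>L. boundary_curve_length K x z L \<and> L \<le> C * M"
proof -
  obtain C where C: "C > 0" "\<And>z v q. z \<in> frontier K \<Longrightarrow> speed_sq K z v q \<Longrightarrow> q \<le> C * (norm v)^2"
    using speed_bounds by metis
  have "\<exists>L. boundary_curve_length K x z L \<and> L \<le> sqrt C * M" if rc: "rest_curve K x z M" for x z M
  proof -
    obtain k D where k: "\<forall>t\<in>{0..1}. (k has_vector_derivative D t) (at t)" "continuous_on {0..1} D"
       "k ` {0..1} \<subseteq> frontier K" "k 0 = x" "k 1 = z" "D 0 = 0" "D 1 = 0" "\<forall>t\<in>{0..1}. norm (D t) \<le> M"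
      using rc unfolding rest_curve_def by (elim exE conjE) (rule that)
    have "continuous_on {0..1} k"
      using k(1) by (intro continuous_at_imp_continuous_on) (blast intro: has_vector_derivative_continuous)
    then obtain L where L: "curve_length K k L" using curve_length_exists k(3) by blast
    have "L \<le> sqrt C * M" using k by (intro curve_length_le[OF C(2,1) _ k(2,3) _ L]) auto
    moreover have "k C1_differentiable_on {0..1}" unfolding C1_differentiable_on_def using k(1,2) by blast
    ultimately show ?thesis
      using k(3-5) L unfolding boundary_curve_length_def path_image_def pathstart_def pathfinish_def by blast
  qed
  then show ?thesis using that[of "sqrt C"] C(1) by simp
qed

text \<open>Here the dimension enters: in dimension 1 the boundary consists of two points.\<close>

lemma connected_frontier: "connected (frontier K)"
proof -
  have "aff_dim K = int DIM('a)" using aff_dim_nonempty_interior[OF int] .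
  then have "connected (rel_frontier K)"
    using dim by (intro connected_sphere_gen cvx compact_imp_bounded cpt) auto
  then show ?thesis using int by (simp add: rel_frontier_nonempty_interior)
qed

text \<open>Being joined by such a curve is an equivalence relation with relatively open classes on
  a connected set.\<close>

lemma rest_curve_exists:
  assumes "x \<in> frontier K" "z \<in> frontier K"
  shows "\<exists>M. rest_curve K x z M"
proof -
  obtain l C where l: "l > 0" "\<And>x z. x \<in> frontier K \<Longrightarrow> z \<in> frontier K \<Longrightarrow> dist x z < l \<Longrightarrow> rest_curve K x z C"
    using short_rest_curve by metis
  show ?thesis
  proof (rule connected_equivalence_relation[OF connected_frontier assms, where R = "\<lambda>x z. \<exists>M. rest_curve K x z M"])
    show "\<exists>M. rest_curve K y x M" if "\<exists>M. rest_curve K x y M" for x y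
      using that rest_curve_sym by blast
    show "\<exists>M. rest_curve K x z M" if "\<exists>M. rest_curve K x y M" "\<exists>M. rest_curve K y z M" for x y z
      using that rest_curve_trans by blast
    show "\<exists>T. openin (top_of_set (frontier K)) T \<and> a \<in> T \<and> (\<forall>x\<in>T. \<exists>M. rest_curve K a x M)"
      if a: "a \<in> frontier K" for a
    proof (intro exI conjI ballI)
      show "openin (top_of_set (frontier K)) (frontier K \<inter> ball a l)" by (simp add: openin_open_Int)
      show "a \<in> frontier K \<inter> ball a l" using a l(1) by simp
      show "rest_curve K a x C" if "x \<in> frontier K \<inter> ball a l" for x
        using l(2)[OF a] that by simp
    qed
  qed
qed

section \<open>Geodesic distance and covering radius\<close>

lemma geodesic_dist_eq: "geodesic_dist K x z = Inf {L. boundary_curve_length K x z L}"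
  by (simp add: geodesic_dist_def boundary_curve_length_def)

lemma geodesic_dist_le:
  assumes "boundary_curve_length K x z L"
  shows "geodesic_dist K x z \<le> L"
  unfolding geodesic_dist_eq using assms boundary_curve_length_nonneg
  by (intro cInf_lower) (auto intro: bdd_belowI[of _ 0])

text \<open>An upper bound on the infimum yields a curve only because some admissible curve exists;
  the infimum of the empty set would carry no information.\<close>

lemma geodesic_dist_less:
  assumes x: "x \<in> frontier K" and z: "z \<in> frontier K" and r: "geodesic_dist K x z < r"
  obtains L where "boundary_curve_length K x z L" "0 \<le> L" "L < r"
proof -
  obtain M where M: "rest_curve K x z M" using rest_curve_exists[OF x z] by blast
  have ne: "{L. boundary_curve_length K x z L} \<noteq> {}"
  proof (rule rest_curve_length)
    fix C :: real
    assume "\<And>x z M. rest_curve K x z M \<Longrightarrow> \<exists>L. boundary_curve_length K x z L \<and> L \<le> C * M"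
    from this[OF M] show ?thesis by blast
  qed
  from cInf_lessD[OF ne r[unfolded geodesic_dist_eq]] obtain L
    where L: "boundary_curve_length K x z L" "L < r" by blast
  show ?thesis using that[OF L(1) boundary_curve_length_nonneg[OF L(1)] L(2)] .
qed

text \<open>Ensures that a single point covers the boundary with some finite radius, so that the
  infimum defining the covering radius is taken over a nonempty set.\<close>

lemma geodesic_dist_bounded:
  assumes a: "a \<in> frontier K"
  shows "\<exists>B>0. \<forall>z\<in>frontier K. geodesic_dist K a z \<le> B"
proof -
  obtain l C where l: "l > 0" "\<And>x z. x \<in> frontier K \<Longrightarrow> z \<in> frontier K \<Longrightarrow> dist x z < l \<Longrightarrow> rest_curve K x z C"
    using short_rest_curve by metis
  have "\<exists>B. \<forall>z\<in>frontier K. rest_curve K a z B"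
  proof (rule compact_uniform[OF compact_frontier rest_curve_mono])
    fix p assume p: "p \<in> frontier K"
    obtain M where M: "rest_curve K a p M" using rest_curve_exists[OF a p] by blast
    have "rest_curve K a z (2 * max M C)" if "z \<in> frontier K \<inter> ball p l" for z
      using rest_curve_trans[OF M l(2)[OF p]] that by simp
    then show "\<exists>\<epsilon>>0. \<exists>B. \<forall>z\<in>frontier K \<inter> ball p \<epsilon>. rest_curve K a z B" using l(1) by blast
  qed
  then obtain B where B: "\<And>z. z \<in> frontier K \<Longrightarrow> rest_curve K a z B" by blast
  obtain C' where C': "\<And>x z M. rest_curve K x z M \<Longrightarrow> \<exists>L. boundary_curve_length K x z L \<and> L \<le> C' * M"
    using rest_curve_length by metis
  have "geodesic_dist K a z \<le> max 1 (C' * B)" if "z \<in> frontier K" for z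
    using C'[OF B[OF that]] geodesic_dist_le by (metis max.coboundedI2 order_trans)
  then show ?thesis by (intro exI[of _ "max 1 (C' * B)"]) auto
qed

text \<open>Whether the infimum is attained is left open. Only radii strictly above or strictly
  below it are used, and the Hausdorff estimates recover the value itself as a limit.\<close>

lemma covering_radius_props:
  assumes P: "P \<noteq> {}" "P \<subseteq> frontier K"
  shows "0 \<le> covering_radius K P"
    "\<And>r x. covering_radius K P < r \<Longrightarrow> x \<in> frontier K \<Longrightarrow> \<exists>y\<in>P. geodesic_dist K y x < r"
    "\<And>r. 0 < r \<Longrightarrow> r < covering_radius K P \<Longrightarrow> \<exists>x\<in>frontier K. \<forall>y\<in>P. r < geodesic_dist K y x"
proof -
  define S where "S = {\<rho>. \<rho> > 0 \<and> frontier K \<subseteq> (\<Union>x\<in>P. geodesic_ball K x \<rho>)}"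
  have cr: "covering_radius K P = Inf S" by (simp add: covering_radius_def S_def)
  obtain a where a: "a \<in> P" using P(1) by blast
  obtain B where "B > 0" "\<forall>z\<in>frontier K. geodesic_dist K a z \<le> B"
    using geodesic_dist_bounded a P(2) by blast
  then have ne: "B \<in> S" using a by (auto simp: S_def geodesic_ball_def)
  have bdd: "bdd_below S" by (rule bdd_belowI[of _ 0]) (auto simp: S_def)
  show "0 \<le> covering_radius K P" unfolding cr using ne by (intro cInf_greatest) (auto simp: S_def)
  show "\<exists>y\<in>P. geodesic_dist K y x < r" if "covering_radius K P < r" "x \<in> frontier K" for r x
  proof -
    have "S \<noteq> {}" "Inf S < r" using ne that(1) cr by auto
    from cInf_lessD[OF this] obtain \<rho> where "\<rho> \<in> S" "\<rho> < r" by blast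
    moreover from this that(2) obtain y where "y \<in> P" "x \<in> geodesic_ball K y \<rho>" by (auto simp: S_def)
    ultimately show ?thesis by (intro bexI[of _ y]) (auto simp: geodesic_ball_def)
  qed
  show "\<exists>x\<in>frontier K. \<forall>y\<in>P. r < geodesic_dist K y x" if "0 < r" "r < covering_radius K P" for r
  proof (rule ccontr)
    assume "\<not> ?thesis"
    then have "r \<in> S" using that(1) by (fastforce simp: S_def geodesic_ball_def not_less)
    then have "covering_radius K P \<le> r" unfolding cr using bdd by (rule cInf_lower)
    then show False using that(2) by simp
  qed
qed

subsection \<open>Distance to the convex hull\<close>

lemma dist_to_hull_le:
  assumes P: "finite P" "P \<noteq> {}" "P \<subseteq> frontier K"
    and b: "b \<ge> 0" and cover: "\<And>x n. x \<in> frontier K \<Longrightarrow> outer_unit_normal K x n \<Longrightarrow> \<exists>y\<in>P. n \<bullet> (x - y) \<le> b"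
    and x: "x \<in> frontier K"
  shows "(INF y\<in>convex hull P. norm (x - y)) \<le> b"
proof -
  let ?Q = "convex hull P"
  have Q: "closed ?Q" "?Q \<noteq> {}" "convex ?Q"
    using P(1,2) by (auto simp: finite_imp_compact_convex_hull compact_imp_closed)
  define z where "z = closest_point ?Q x"
  have z: "z \<in> ?Q" using closest_point_in_set[OF Q(1,2)] by (simp add: z_def)
  have "(INF y\<in>?Q. norm (x - y)) \<le> norm (x - z)"
    using z by (intro cINF_lower) (auto intro: bdd_belowI[of _ 0])
  also have "\<dots> \<le> b"
  proof (cases "x = z")
    case True
    then show ?thesis using b by simp
  next
    case False
    define v where "v = (1 / norm (x - z)) *\<^sub>R (x - z)"
    have nv: "norm v = 1" using False by (simp add: v_def)
    have vz: "v \<bullet> (x - z) = norm (x - z)" using False by (simp add: v_def dot_square_norm power2_eq_square)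
    have K0: "K \<noteq> {}" using int by auto
    have "continuous_on K (\<lambda>w. v \<bullet> w)" by (intro continuous_intros)
    \<comment> \<open>At \<open>w\<close> the functional \<open>v\<close> is maximal on K, so
      \<open>v\<close> is an outer normal there and some \<open>y\<close> in P has
      \<open>v \<bullet> (w - y) \<le> b\<close>. As \<open>y\<close> lies behind the hyperplane
      through \<open>z\<close>, the distance \<open>v \<bullet> (x - z)\<close> is at most
      \<open>v \<bullet> (w - y)\<close>.\<close>
    then obtain w where w: "w \<in> K" "\<forall>y\<in>K. v \<bullet> y \<le> v \<bullet> w"
      using continuous_attains_sup[OF cpt K0] by blast
    then have n: "outer_unit_normal K w v" using nv by (simp add: outer_unit_normal_def)
    then have "w \<in> frontier K" using contact_in_frontier w(1) by blast
    then obtain y where y: "y \<in> P" "v \<bullet> (w - y) \<le> b" using cover n by blast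
    have "y \<in> ?Q" using y(1) by (rule hull_inc)
    then have "(x - z) \<bullet> (y - z) \<le> 0"
      unfolding z_def by (rule closest_point_dot[OF Q(3,1)])
    then have "v \<bullet> (y - z) \<le> 0" by (simp add: v_def divide_nonpos_nonneg)
    moreover have "v \<bullet> x \<le> v \<bullet> w" using w(2) x frontier_K by blast
    ultimately show ?thesis using y(2) vz by (simp add: inner_diff_right)
  qed
  finally show ?thesis .
qed

lemma hausdorff_ge:
  assumes P: "P \<noteq> {}" "P \<subseteq> frontier K" and x: "x \<in> frontier K" and n: "outer_unit_normal K x n"
    and b: "\<And>y. y \<in> P \<Longrightarrow> b \<le> n \<bullet> (x - y)"
  shows "b \<le> hausdorff_dist_inner (convex hull P) K"
proof -
  let ?Q = "convex hull P"
  obtain a where a: "a \<in> P" using P(1) by blast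
  have aQ: "a \<in> ?Q" using a by (rule hull_inc)
  have "?Q \<subseteq> {z. n \<bullet> z \<le> n \<bullet> x - b}"
    using b by (intro hull_minimal convex_halfspace_le) (force simp: inner_diff_right)
  then have "b \<le> norm (x - z)" if "z \<in> ?Q" for z
    using that Cauchy_Schwarz_ineq2[of n "x - z"] n
    by (force simp: outer_unit_normal_def inner_diff_right)
  then have "b \<le> (INF y\<in>?Q. norm (x - y))" using aQ by (intro cINF_greatest) auto
  also have "\<dots> \<le> (SUP x\<in>frontier K. INF y\<in>?Q. norm (x - y))"
  \<comment> \<open>A real supremum is an upper bound only for a bounded family; the diameter of K
    is a bound.\<close>
  proof (rule cSUP_upper[OF x], rule bdd_aboveI2)
    fix x' assume "x' \<in> frontier K"
    then have "norm (x' - a) \<le> diameter K"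
      using diameter_bounded_bound[OF compact_imp_bounded[OF cpt], of x' a] a P(2) frontier_K
      by (auto simp: dist_norm)
    moreover have "(INF y\<in>?Q. norm (x' - y)) \<le> norm (x' - a)"
      using aQ by (intro cINF_lower) (auto intro: bdd_belowI[of _ 0])
    ultimately show "(INF y\<in>?Q. norm (x' - y)) \<le> diameter K" by linarith
  qed
  finally show ?thesis by (simp add: hausdorff_dist_inner_def)
qed

section \<open>Upper and lower bound of the Hausdorff distance\<close>

lemma hausdorff_upper:
  obtains \<rho> C where "\<rho> > 0" "C > 0"
    "\<And>P. finite P \<Longrightarrow> P \<noteq> {} \<Longrightarrow> P \<subseteq> frontier K \<Longrightarrow> covering_radius K P \<le> \<rho> \<Longrightarrow>
      hausdorff_dist_inner (convex hull P) K \<le> (covering_radius K P)^2 / 2 + C * covering_radius K P ^ 3"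
proof -
  obtain C where C: "C > 0" and hl: "\<And>x z L n. boundary_curve_length K z x L \<Longrightarrow>
      outer_unit_normal K x n \<Longrightarrow> C * L \<le> 1 \<Longrightarrow> n \<bullet> (x - z) \<le> L^2 / 2 + C * L ^ 3"
    using height_le_length by metis
  have "hausdorff_dist_inner (convex hull P) K \<le> (covering_radius K P)^2 / 2 + C * covering_radius K P ^ 3"
    if P: "finite P" "P \<noteq> {}" "P \<subseteq> frontier K" and R: "covering_radius K P \<le> 1 / (2 * C)" for P
  proof -
    define R where "R = covering_radius K P"
    note cr = covering_radius_props[OF P(2,3), folded R_def]
    \<comment> \<open>The factor 2 in the bound on the covering radius leaves room for values
      \<open>s\<close> strictly between \<open>R\<close> and \<open>1 / C\<close>, where
      \<open>height_le_length\<close> applies.\<close>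
    have RC: "R < 1 / C" using R C order_le_less_trans[of R "1 / (2 * C)" "1 / C"] by (simp add: R_def field_simps)
    have bound: "(INF y\<in>convex hull P. norm (x - y)) \<le> s^2 / 2 + C * s ^ 3"
      if s: "R < s" "s < 1 / C" and x: "x \<in> frontier K" for s x
    proof (rule dist_to_hull_le[OF P _ _ x])
      have s0: "0 \<le> s" using cr(1) s(1) by simp
      then show "0 \<le> s^2 / 2 + C * s ^ 3" using C by simp
      fix w n assume w: "w \<in> frontier K" and n: "outer_unit_normal K w n"
      obtain y where y: "y \<in> P" "geodesic_dist K y w < s" using cr(2)[OF s(1) w] by blast
      have yf: "y \<in> frontier K" using y(1) P(3) by blast
      obtain L where k: "boundary_curve_length K y w L" and L: "0 \<le> L" "L < s"
        using geodesic_dist_less[OF yf w y(2)] by blast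
      have "C * L \<le> C * (1 / C)" using C L(2) s(2) by (intro mult_left_mono) auto
      then have CL: "C * L \<le> 1" using C by simp
      have "n \<bullet> (w - y) \<le> L^2 / 2 + C * L ^ 3"
        using hl[OF k n CL] .
      also have "\<dots> \<le> s^2 / 2 + C * s ^ 3"
        using L C by (intro add_mono divide_right_mono mult_left_mono power_mono) auto
      finally show "\<exists>y\<in>P. n \<bullet> (w - y) \<le> s^2 / 2 + C * s ^ 3" using y(1) by blast
    qed
    have "(INF y\<in>convex hull P. norm (x - y)) \<le> R^2 / 2 + C * R ^ 3" if x: "x \<in> frontier K" for x
    proof (rule tendsto_lowerbound)
      show "((\<lambda>s. s^2 / 2 + C * s ^ 3) \<longlongrightarrow> R^2 / 2 + C * R ^ 3) (at_right R)" by (intro tendsto_intros) auto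
      show "\<forall>\<^sub>F s in at_right R. (INF y\<in>convex hull P. norm (x - y)) \<le> s^2 / 2 + C * s ^ 3"
        using bound[OF _ _ x] RC by (intro eventually_at_rightI[of R "1 / C"]) auto
    qed simp
    moreover have "frontier K \<noteq> {}" using P by blast
    ultimately show ?thesis
      unfolding hausdorff_dist_inner_def R_def[symmetric] by (intro cSUP_least)
  qed
  then show ?thesis using that[of "1 / (2 * C)" C] C by simp
qed

lemma hausdorff_lower:
  obtains \<rho> C where "\<rho> > 0" "C > 0"
    "\<And>P. P \<noteq> {} \<Longrightarrow> P \<subseteq> frontier K \<Longrightarrow> covering_radius K P \<le> \<rho> \<Longrightarrow>
      (covering_radius K P)^2 / 2 - C * covering_radius K P ^ 3 \<le> hausdorff_dist_inner (convex hull P) K"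
proof -
  obtain C3 where C3: "C3 > 0" "\<And>x z n. x \<in> frontier K \<Longrightarrow> z \<in> frontier K \<Longrightarrow> outer_unit_normal K x n \<Longrightarrow>
      (norm (x - z))^2 \<le> C3 * (n \<bullet> (x - z))" using strong_convexity by metis
  obtain l C where l: "l > 0" and C: "C > 0" and seg: "\<And>x z n. x \<in> frontier K \<Longrightarrow> z \<in> frontier K \<Longrightarrow>
      dist x z < l \<Longrightarrow> outer_unit_normal K x n \<Longrightarrow>
      \<exists>L. boundary_curve_length K z x L \<and> L^2 \<le> 2 * (n \<bullet> (x - z)) + C * ((n \<bullet> (x - z)) * sqrt (n \<bullet> (x - z)))"
    using short_segment by metis
  \<comment> \<open>If \<open>dist x y\<close> is at least \<open>l\<close>, strong convexity makes
    the height at least \<open>l^2 / C3\<close>, which is the square of this radius; distant points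
    of P are then harmless.\<close>
  define \<rho> where "\<rho> = l / sqrt C3"
  have \<rho>: "\<rho> > 0" "\<rho>^2 = l^2 / C3" using l C3(1) by (auto simp: \<rho>_def power_divide)
  have "(covering_radius K P)^2 / 2 - C * covering_radius K P ^ 3 \<le> hausdorff_dist_inner (convex hull P) K"
    if P: "P \<noteq> {}" "P \<subseteq> frontier K" and R: "covering_radius K P \<le> \<rho>" for P
  proof -
    define R where "R = covering_radius K P"
    note cr = covering_radius_props[OF P, folded R_def]
    have bound: "s^2 / 2 - C * s ^ 3 \<le> hausdorff_dist_inner (convex hull P) K" if s: "0 < s" "s < R" for s
    proof -
      obtain x where x: "x \<in> frontier K" "\<And>y. y \<in> P \<Longrightarrow> s < geodesic_dist K y x" using cr(3)[OF s] by blast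
      obtain n where n: "outer_unit_normal K x n" using normal_exists[OF x(1)] .
      have "s^2 / 2 - C * s ^ 3 \<le> n \<bullet> (x - y)" if y: "y \<in> P" for y
      proof -
        define \<phi> where "\<phi> = n \<bullet> (x - y)"
        have yf: "y \<in> frontier K" using y P(2) by blast
        have p0: "\<phi> \<ge> 0" unfolding \<phi>_def using normal_nonneg[OF n] yf frontier_K by blast
        have s3: "0 \<le> C * s ^ 3" "0 \<le> s^2" using C s(1) by auto
        show ?thesis
        \<comment> \<open>A height of at least \<open>s^2\<close> is more than enough. Otherwise
          \<open>sqrt \<phi>\<close> is at most \<open>s\<close>, which turns the error of the short
          segment into a multiple of \<open>s ^ 3\<close>.\<close>
        proof (cases "dist x y < l \<and> \<phi> < s^2")
          case True
          then obtain L where k: "boundary_curve_length K y x L" and L: "L^2 \<le> 2 * \<phi> + C * (\<phi> * sqrt \<phi>)"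
            using seg[OF x(1) yf _ n] unfolding \<phi>_def by blast
          have "s < L" using x(2)[OF y] geodesic_dist_le[OF k] by linarith
          then have "s^2 \<le> L^2" using s(1) by (intro power_mono) auto
          moreover have "\<phi> * sqrt \<phi> \<le> s^2 * s"
            using True p0 s(1) by (intro mult_mono real_le_lsqrt) auto
          then have "C * (\<phi> * sqrt \<phi>) \<le> C * s ^ 3"
            using C by (intro mult_left_mono) (auto simp: power2_eq_square power3_eq_cube)
          ultimately have "s^2 \<le> 2 * \<phi> + C * s ^ 3" using L by linarith
          then show ?thesis using s3 unfolding \<phi>_def by linarith
        next
          case False
          have "s^2 \<le> \<phi>"
          proof (cases "\<phi> < s^2")
            case True
            then have "l \<le> norm (x - y)" using False by (simp add: dist_norm)
            then have "l^2 \<le> (norm (x - y))^2" using l by (intro power_mono) auto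
            also have "\<dots> \<le> C3 * \<phi>" unfolding \<phi>_def using C3(2) x(1) yf n by blast
            finally have "\<rho>^2 \<le> \<phi>" unfolding \<rho>(2) using C3(1) by (simp add: field_simps)
            moreover have "s^2 \<le> \<rho>^2" using s R unfolding R_def by (intro power_mono) auto
            ultimately show ?thesis by linarith
          qed simp
          then show ?thesis using s3 unfolding \<phi>_def by linarith
        qed
      qed
      then show ?thesis by (rule hausdorff_ge[OF P x(1) n])
    qed
    have "R^2 / 2 - C * R ^ 3 \<le> hausdorff_dist_inner (convex hull P) K"
    \<comment> \<open>For \<open>R = 0\<close> there is no \<open>s\<close> with
      \<open>0 < s < R\<close>, so the claim, nonnegativity of the Hausdorff distance, is shown
      directly.\<close>
    proof (cases "R = 0")
      case True
      obtain a where a: "a \<in> P" using P(1) by blast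
      then have "a \<in> frontier K" using P(2) by blast
      then obtain n where n: "outer_unit_normal K a n" by (rule normal_exists)
      have "0 \<le> hausdorff_dist_inner (convex hull P) K"
        using a P(2) frontier_K by (intro hausdorff_ge[OF P _ n] normal_nonneg[OF n]) auto
      then show ?thesis using True by simp
    next
      case False
      then have R0: "0 < R" using cr(1) by simp
      show ?thesis
      proof (rule tendsto_upperbound)
        show "((\<lambda>s. s^2 / 2 - C * s ^ 3) \<longlongrightarrow> R^2 / 2 - C * R ^ 3) (at_left R)" by (intro tendsto_intros) auto
        show "\<forall>\<^sub>F s in at_left R. s^2 / 2 - C * s ^ 3 \<le> hausdorff_dist_inner (convex hull P) K"
          using bound R0 by (intro eventually_at_leftI[of 0 R]) auto
      qed simp
    qed
    then show ?thesis by (simp add: R_def)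
  qed
  then show ?thesis using that[of \<rho> C] \<rho>(1) C by blast
qed

end

theorem theorem2:
  fixes K :: "'a::euclidean_space set"
  assumes "DIM('a) \<ge> 2"
    and "K \<in> K3_plus"
  shows "\<exists>\<rho>>0. \<exists>C>0. \<forall>P. finite P \<and> P \<noteq> {} \<and> P \<subseteq> frontier K \<and> covering_radius K P \<le> \<rho> \<longrightarrow>
    \<bar>hausdorff_dist_inner (convex hull P) K - (covering_radius K P)\<^sup>2 / 2\<bar>
      \<le> C * (covering_radius K P) ^ 3"
proof -
  interpret k3_plus K using assms by unfold_locales
  obtain \<rho>1 C1 where 1: "\<rho>1 > 0" "C1 > 0" "\<And>P. finite P \<Longrightarrow> P \<noteq> {} \<Longrightarrow> P \<subseteq> frontier K \<Longrightarrow>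
      covering_radius K P \<le> \<rho>1 \<Longrightarrow>
      hausdorff_dist_inner (convex hull P) K \<le> (covering_radius K P)^2 / 2 + C1 * covering_radius K P ^ 3"
    using hausdorff_upper by metis
  obtain \<rho>2 C2 where 2: "\<rho>2 > 0" "C2 > 0" "\<And>P. P \<noteq> {} \<Longrightarrow> P \<subseteq> frontier K \<Longrightarrow>
      covering_radius K P \<le> \<rho>2 \<Longrightarrow>
      (covering_radius K P)^2 / 2 - C2 * covering_radius K P ^ 3 \<le> hausdorff_dist_inner (convex hull P) K"
    using hausdorff_lower by metis
  have "\<bar>hausdorff_dist_inner (convex hull P) K - (covering_radius K P)^2 / 2\<bar> \<le> max C1 C2 * covering_radius K P ^ 3"
    if P: "finite P" "P \<noteq> {}" "P \<subseteq> frontier K" "covering_radius K P \<le> min \<rho>1 \<rho>2" for P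
  proof -
    have "0 \<le> covering_radius K P" using covering_radius_props(1)[OF P(2,3)] .
    then have "C1 * covering_radius K P ^ 3 \<le> max C1 C2 * covering_radius K P ^ 3"
      "C2 * covering_radius K P ^ 3 \<le> max C1 C2 * covering_radius K P ^ 3"
      by (auto intro!: mult_right_mono)
    then show ?thesis using 1(3)[OF P(1-3)] 2(3)[OF P(2,3)] P(4) by (simp add: abs_le_iff)
  qed
  then show ?thesis using 1(1,2) 2(1,2) by (intro exI[of _ "min \<rho>1 \<rho>2"] exI[of _ "max C1 C2"] conjI) auto
qed

end
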